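(* Let $D$ and $D'$ be oriented link diagrams on $\mathbb{R}^2$, let $p$ be an odd prime and let $\theta_p$ be Mochizuki's $3$-cocycle of the dihedral quandle $R_p$. For any $a\in R_p$ and any subset $S\subset\mathrm{End}(R_p)$, the shadow quandle cocycle quivers $SQ^{S,\theta_p}_{R_p}(D,a)$ and $SQ^{S,\theta_p}_{R_p}(D',a)$ are isomorphic if and only if $\Phi_{\theta_p}(D)=\Phi_{\theta_p}(D')$ (equality of multisets).
   Context: The dihedral quandle $R_p$ is $\mathbb{Z}_p=\mathbb{Z}/p\mathbb{Z}$ with operation $x\ast y=2y-x$. $\mathrm{End}(R_p)$ is the set of maps $f:R_p\to R_p$ with $f(x\ast y)=f(x)\ast f(y)$ for all $x,y$. Mochizuki's $3$-cocycle is the map $\theta_p:(R_p)^3\to\mathbb{Z}_p$ given by $$\theta_p(x,y,z)=(x-y)\,\frac{y^p+(2z-y)^p-2z^p}{p},$$ where the fraction is computed using integer lifts of $y,z$ and then reduced modulo $p$ (the result does not depend on the lifts). Let $D$ be an oriented link diagram on $\mathbb{R}^2$. $\mathrm{Arc}(D)$ is the set of its arcs (maximal connected pieces running between under-crossings). $|D|$ is the union of immersed circles obtained by ignoring over/under information, $\mathrm{Region}(D)$ is the set of connected components of $\mathbb{R}^2\setminus|D|$, and $r_\infty$ is the unbounded region. An $R_p$-coloring is a map $c:\mathrm{Arc}(D)\to R_p$ such that at every crossing with over-arc $x_j$ and under-arcs $x_i$ (to the right of the over-arc with respect to its orientation) and $x_k$ (to the left), $c(x_i)\ast c(x_j)=c(x_k)$.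 A shadow $R_p$-coloring is a map $c_\ast:\mathrm{Arc}(D)\cup\mathrm{Region}(D)\to R_p$ whose restriction to $\mathrm{Arc}(D)$ is an $R_p$-coloring and such that, for adjacent regions $r_1$ (on the right) and $r_2$ (on the left) along an arc $\alpha$, $c_\ast(r_1)\ast c_\ast(\alpha)=c_\ast(r_2)$. $\mathrm{SCol}_{R_p}(D)$ is the set of shadow $R_p$-colorings, and $\mathrm{SCol}_{R_p}(D,a)$ is the subset of those with $c_\ast(r_\infty)=a$. Weights: given a shadow coloring $c_\ast$, to each crossing assign $\varepsilon\,\theta_p(x,y,z)$, where $\varepsilon=\pm1$ is the sign of the crossing, $x$ is the label of the region at the crossing lying to the right of both strands, $y$ is the label of the under-arc adjacent to that region (the under-arc to the right of the over-arc), and $z$ is the label of the over-arc. $\Phi_{\theta_p}(D,c_\ast)\in\mathbb{Z}_p$ is the sum of the weights over all crossings of $D$. The shadow quandle cocycle invariant is the multiset $\Phi_{\theta_p}(D)=\{\Phi_{\theta_p}(D,c_\ast)\mid c_\ast\in\mathrm{SCol}_{R_p}(D)\}$. The shadow quandle coloring quiver $SQ^S_{R_p}(D,a)$ is the directed graph with vertex set $\mathrm{SCol}_{R_p}(D,a)$ and an edge directed from $v_\ast$ to $w_\ast$ when $w_\ast|_{\mathrm{Arc}(D)}=f\circ v_\ast|_{\mathrm{Arc}(D)}$ for an element $f\in S$. The shadow quandle cocycle quiver $SQ^{S,\theta_p}_{R_p}(D,a)$ is the pair $(SQ^S_{R_p}(D,a),\rho)$ with $\rho:\mathrm{SCol}_{R_p}(D,a)\to\mathbb{Z}_p$,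 $\rho(c_\ast)=\Phi_{\theta_p}(D,c_\ast)$. Two such pairs $(SQ^S_{R_p}(D,a),\rho)$ and $(SQ^S_{R_p}(D',a),\rho')$ are isomorphic if there is a bijection $\varphi:\mathrm{SCol}_{R_p}(D,a)\to\mathrm{SCol}_{R_p}(D',a)$ such that $(v_\ast,w_\ast)$ is an edge if and only if $(\varphi(v_\ast),\varphi(w_\ast))$ is an edge, and $\rho(c_\ast)=\rho'(\varphi(c_\ast))$ for all $c_\ast$. *)

theory Defs
  imports "HOL-Analysis.Analysis" "HOL-Library.Multiset" "HOL-Computational_Algebra.Primes"
begin

section \<open>Dihedral quandles and Mochizuki's cocycle\<close>

text \<open>Residues modulo \<open>p\<close> are represented by the integers \<open>0, \<dots>, p - 1\<close>.\<close>

definition R :: "nat \<Rightarrow> int set" where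
  "R p = {0..<int p}"

definition quandle_op :: "nat \<Rightarrow> int \<Rightarrow> int \<Rightarrow> int" where
  "quandle_op p x y = (2 * y - x) mod int p"

definition End_R :: "nat \<Rightarrow> (int \<Rightarrow> int) set" where
  "End_R p = {f \<in> R p \<rightarrow>\<^sub>E R p.
     \<forall>x\<in>R p. \<forall>y\<in>R p. f (quandle_op p x y) = quandle_op p (f x) (f y)}"

text \<open>For prime \<open>p\<close> the integer division below is exact, by Fermat's little theorem.\<close>

definition mochizuki_cocycle :: "nat \<Rightarrow> int \<Rightarrow> int \<Rightarrow> int \<Rightarrow> int" where
  "mochizuki_cocycle p x y z =
     ((x - y) * ((y ^ p + (2 * z - y) ^ p - 2 * z ^ p) div int p)) mod int p"


section \<open>Oriented link diagrams\<close>

text \<open>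
  The plane is the type \<^typ>\<open>complex\<close>. A diagram with \<open>ncomp\<close> components is given by a map
  \<open>imm\<close> of the disjoint union of \<open>ncomp\<close> unit circles, realised as
  \<open>{..<ncomp} \<times> sphere 0 1\<close>, into the plane (values elsewhere are irrelevant). Each circle is
  oriented counterclockwise. The crossing information is the set \<open>under\<close> of those points of the
  source circles at which the curve passes below.
\<close>

record diagram =
  ncomp :: nat
  imm :: "nat \<times> complex \<Rightarrow> complex"
  under :: "(nat \<times> complex) set"

definition circles :: "diagram \<Rightarrow> (nat \<times> complex) set" where
  "circles D = {..<ncomp D} \<times> sphere 0 1"

definition move :: "nat \<times> complex \<Rightarrow> real \<Rightarrow> nat \<times> complex" where
  "move P t = (fst P, snd P * cis t)"

definition tangent :: "diagram \<Rightarrow> nat \<times> complex \<Rightarrow> complex" where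
  "tangent D P = vector_derivative (\<lambda>t. imm D (move P t)) (at 0)"

definition double_pairs :: "diagram \<Rightarrow> ((nat \<times> complex) \<times> (nat \<times> complex)) set" where
  "double_pairs D = {(P, Q). P \<in> circles D \<and> Q \<in> circles D \<and> P \<noteq> Q \<and> imm D P = imm D Q}"

text \<open>\<open>Im (cnj v * w)\<close> is the determinant of the pair \<open>v, w\<close> of plane vectors.\<close>

definition left_of :: "complex \<Rightarrow> complex \<Rightarrow> bool" where
  "left_of v w \<longleftrightarrow> Im (cnj v * w) > 0"

definition right_of :: "complex \<Rightarrow> complex \<Rightarrow> bool" where
  "right_of v w \<longleftrightarrow> Im (cnj v * w) < 0"

text \<open>
  A link diagram is a \<open>C\<^sup>1\<close> immersion of at least one circle whose only multiple points are
  finitely many transverse double points, at each of which exactly one strand is marked as the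
  under-strand.
\<close>

definition link_diagram :: "diagram \<Rightarrow> bool" where
  "link_diagram D \<longleftrightarrow>
     ncomp D \<ge> 1 \<and>
     (\<forall>i<ncomp D. (\<lambda>t. imm D (i, cis t)) C1_differentiable_on UNIV) \<and>
     (\<forall>P\<in>circles D. tangent D P \<noteq> 0) \<and>
     finite (double_pairs D) \<and>
     (\<forall>P\<in>circles D. \<forall>Q\<in>circles D. \<forall>S\<in>circles D.
        imm D P = imm D Q \<and> imm D Q = imm D S \<longrightarrow> P = Q \<or> Q = S \<or> P = S) \<and>
     (\<forall>(P, Q)\<in>double_pairs D. Im (cnj (tangent D P) * tangent D Q) \<noteq> 0) \<and>
     under D \<subseteq> fst ` double_pairs D \<and>
     (\<forall>(P, Q)\<in>double_pairs D. P \<in> under D \<longleftrightarrow> Q \<notin> under D)"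

text \<open>A crossing is recorded as the pair of its over-point and its under-point.\<close>

definition crossings :: "diagram \<Rightarrow> ((nat \<times> complex) \<times> (nat \<times> complex)) set" where
  "crossings D = {(P, Q) \<in> double_pairs D. Q \<in> under D}"

text \<open>
  Arcs are subsets of the source circles rather than of the plane, since different arcs meet in
  the plane at the crossings. The first factor of \<^typ>\<open>nat \<times> complex\<close> is discrete, so different
  circles are never connected to each other.
\<close>

definition Arc :: "diagram \<Rightarrow> (nat \<times> complex) set set" where
  "Arc D = components (circles D - under D)"

definition Region :: "diagram \<Rightarrow> complex set set" where
  "Region D = components (- (imm D ` circles D))"

definition r_infinity :: "diagram \<Rightarrow> complex set" where
  "r_infinity D = (THE r. r \<in> Region D \<and> \<not> bounded r)"

text \<open>In the definitions below, \<open>(P, Q)\<close> is a crossing with over-point \<open>P\<close> and under-point \<open>Q\<close>.\<close>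

definition over_arc :: "diagram \<Rightarrow> nat \<times> complex \<Rightarrow> (nat \<times> complex) set" where
  "over_arc D P = (THE \<alpha>. \<alpha> \<in> Arc D \<and> P \<in> \<alpha>)"

text \<open>The two under-arcs leave \<open>Q\<close> in the directions \<open>\<plusminus> tangent D Q\<close>.\<close>

definition under_arc_right ::
    "diagram \<Rightarrow> nat \<times> complex \<Rightarrow> nat \<times> complex \<Rightarrow> (nat \<times> complex) set" where
  "under_arc_right D P Q = (THE \<alpha>. \<alpha> \<in> Arc D \<and>
     (\<exists>\<eta>\<in>{-1, 1}. right_of (tangent D P) (\<eta> *\<^sub>R tangent D Q) \<and>
        (\<forall>\<^sub>F s in at_right 0. move Q (\<eta> * s) \<in> \<alpha>)))"

definition under_arc_left ::
    "diagram \<Rightarrow> nat \<times> complex \<Rightarrow> nat \<times> complex \<Rightarrow> (nat \<times> complex) set" where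
  "under_arc_left D P Q = (THE \<alpha>. \<alpha> \<in> Arc D \<and>
     (\<exists>\<eta>\<in>{-1, 1}. left_of (tangent D P) (\<eta> *\<^sub>R tangent D Q) \<and>
        (\<forall>\<^sub>F s in at_right 0. move Q (\<eta> * s) \<in> \<alpha>)))"

definition region_right_of_both ::
    "diagram \<Rightarrow> nat \<times> complex \<Rightarrow> nat \<times> complex \<Rightarrow> complex set" where
  "region_right_of_both D P Q = (THE r. r \<in> Region D \<and>
     (\<forall>d. right_of (tangent D P) d \<and> right_of (tangent D Q) d \<longrightarrow>
        (\<forall>\<^sub>F s in at_right 0. imm D P + s *\<^sub>R d \<in> r)))"

definition crossing_sign :: "diagram \<Rightarrow> nat \<times> complex \<Rightarrow> nat \<times> complex \<Rightarrow> int" where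
  "crossing_sign D P Q = (if left_of (tangent D P) (tangent D Q) then 1 else -1)"

text \<open>
  Sides of an arc are read off along the normal at a point that is not a crossing;
  \<open>\<i> * tangent D P\<close> is the normal pointing to the left.
\<close>

definition adjacent_along ::
    "diagram \<Rightarrow> (nat \<times> complex) set \<Rightarrow> complex set \<Rightarrow> complex set \<Rightarrow> bool" where
  "adjacent_along D \<alpha> r\<^sub>1 r\<^sub>2 \<longleftrightarrow>
     (\<exists>P\<in>\<alpha>. (\<forall>Q\<in>circles D. imm D Q = imm D P \<longrightarrow> Q = P) \<and>
        (\<forall>\<^sub>F s in at_right 0. imm D P - s *\<^sub>R (\<i> * tangent D P) \<in> r\<^sub>1) \<and>
        (\<forall>\<^sub>F s in at_right 0. imm D P + s *\<^sub>R (\<i> * tangent D P) \<in> r\<^sub>2))"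


section \<open>Colorings and shadow colorings\<close>

definition coloring :: "nat \<Rightarrow> diagram \<Rightarrow> ((nat \<times> complex) set \<Rightarrow> int) \<Rightarrow> bool" where
  "coloring p D c \<longleftrightarrow> (\<forall>\<alpha>\<in>Arc D. c \<alpha> \<in> R p) \<and>
     (\<forall>(P, Q)\<in>crossings D.
        quandle_op p (c (under_arc_right D P Q)) (c (over_arc D P)) = c (under_arc_left D P Q))"

text \<open>
  A shadow coloring is a function on the disjoint union of the arcs (\<open>Inl\<close>) and the
  regions (\<open>Inr\<close>).
\<close>

type_synonym shadow = "(nat \<times> complex) set + complex set \<Rightarrow> int"

definition SCol :: "nat \<Rightarrow> diagram \<Rightarrow> shadow set" where
  "SCol p D = {c \<in> (Arc D <+> Region D) \<rightarrow>\<^sub>E R p.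
     coloring p D (c \<circ> Inl) \<and>
     (\<forall>\<alpha>\<in>Arc D. \<forall>r\<^sub>1\<in>Region D. \<forall>r\<^sub>2\<in>Region D. adjacent_along D \<alpha> r\<^sub>1 r\<^sub>2 \<longrightarrow>
        quandle_op p (c (Inr r\<^sub>1)) (c (Inl \<alpha>)) = c (Inr r\<^sub>2))}"

definition SCol_at :: "nat \<Rightarrow> diagram \<Rightarrow> int \<Rightarrow> shadow set" where
  "SCol_at p D a = {c \<in> SCol p D. c (Inr (r_infinity D)) = a}"

definition weight :: "nat \<Rightarrow> diagram \<Rightarrow> shadow \<Rightarrow> nat \<times> complex \<Rightarrow> nat \<times> complex \<Rightarrow> int" where
  "weight p D c P Q = crossing_sign D P Q *
     mochizuki_cocycle p (c (Inr (region_right_of_both D P Q)))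
       (c (Inl (under_arc_right D P Q))) (c (Inl (over_arc D P)))"

definition shadow_weight :: "nat \<Rightarrow> diagram \<Rightarrow> shadow \<Rightarrow> int" where
  "shadow_weight p D c = (\<Sum>(P, Q)\<in>crossings D. weight p D c P Q) mod int p"

text \<open>A link diagram has finitely many shadow colorings, so \<^const>\<open>mset_set\<close> is not degenerate.\<close>

definition shadow_cocycle_invariant :: "nat \<Rightarrow> diagram \<Rightarrow> int multiset" where
  "shadow_cocycle_invariant p D = image_mset (shadow_weight p D) (mset_set (SCol p D))"


section \<open>Quivers\<close>

record shadow_quiver =
  vertices :: "shadow set"
  edges :: "(shadow \<times> shadow) set"

definition coloring_quiver ::
    "nat \<Rightarrow> (int \<Rightarrow> int) set \<Rightarrow> diagram \<Rightarrow> int \<Rightarrow> shadow_quiver" where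
  "coloring_quiver p S D a =
     \<lparr>vertices = SCol_at p D a,
      edges = {(v, w) \<in> SCol_at p D a \<times> SCol_at p D a.
        \<exists>f\<in>S. \<forall>\<alpha>\<in>Arc D. w (Inl \<alpha>) = f (v (Inl \<alpha>))}\<rparr>"

definition cocycle_quiver ::
    "nat \<Rightarrow> (int \<Rightarrow> int) set \<Rightarrow> diagram \<Rightarrow> int \<Rightarrow> shadow_quiver \<times> (shadow \<Rightarrow> int)" where
  "cocycle_quiver p S D a = (coloring_quiver p S D a, shadow_weight p D)"

definition isomorphic_cocycle_quivers ::
    "shadow_quiver \<times> (shadow \<Rightarrow> int) \<Rightarrow> shadow_quiver \<times> (shadow \<Rightarrow> int) \<Rightarrow> bool" where
  "isomorphic_cocycle_quivers G H \<longleftrightarrow>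
     (\<exists>\<phi>. bij_betw \<phi> (vertices (fst G)) (vertices (fst H)) \<and>
        (\<forall>v\<in>vertices (fst G). \<forall>w\<in>vertices (fst G).
           (v, w) \<in> edges (fst G) \<longleftrightarrow> (\<phi> v, \<phi> w) \<in> edges (fst H)) \<and>
        (\<forall>v\<in>vertices (fst G). snd G v = snd H (\<phi> v)))"

end

theory Submission
  imports Defs "HOL-Complex_Analysis.Winding_Numbers" "HOL-Number_Theory.Residues"
begin

text \<open>
  The endomorphisms of the dihedral quandle are the affine maps \<open>x \<mapsto> k * x + b\<close>. They act on the
  shadow colorings with color \<open>a\<close> at infinity: the colors of arcs and regions are replaced by their
  images, and the color at infinity is then restored by adding a multiple of a checkerboard sign
  to the colors of the regions. The edges of the quiver are read off from this action, and the
  weight is multiplied by \<open>k\<^sup>2\<close> (\<open>shadow_weight_affine\<close>).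

  Constant colorings form a copy of \<open>R p\<close> on which the weight is 0. On the other colorings
  the group of invertible affine maps acts freely, because two distinct arc colors determine an
  affine map. Two finite free actions with weights that follow the same rule are equivariantly
  isomorphic as soon as the multisets of weights agree (\<open>equivariant_bijection\<close>), and sending
  constants to constants extends the bijection to an isomorphism of quivers. Conversely an
  isomorphism preserves the multiset of weights over \<open>a\<close>. The invariant consists of \<open>p\<close> copies of
  this multiset, since recoloring by the identity map moves the base color and keeps the weights
  (\<open>count_invariant\<close>).

  The geometry of the diagram enters in three places.

  \<^item> The parity of the sum of the winding numbers of the components is a checkerboard sign: it
    changes across every strand because one winding number jumps by 1 there (\<open>wind_jump\<close>).

  \<^item> Any region is reached from the unbounded one by crossing strands at simple points
    (\<open>Region_propagate\<close>), so the arc colors and the color at infinity determine a shadow coloring.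

  \<^item> For integers \<open>A\<close> on the arcs and \<open>B\<close> on the regions that satisfy the relations of a shadow
    coloring modulo \<open>m\<close>, and for any function \<open>h\<close> on the arcs, the sum over the crossings of
    \<open>\<epsilon> * (B x - A y) * (h y + h y' - 2 * h z)\<close> vanishes modulo \<open>m\<close> (\<open>crossing_sum\<close>); here \<open>x\<close>, \<open>y\<close>,
    \<open>z\<close> are as in the definition of the weight and \<open>y'\<close> is the other under-arc. The reason is that
    the summands are the jumps of one function along the circles.

  The last fact gives the behaviour of the weight. The second factor of Mochizuki's cocycle is
  \<open>y\<^sup>p + y'\<^sup>p - 2 * z\<^sup>p\<close> divided by \<open>p\<close>. With the checkerboard sign for \<open>B\<close>, zero for \<open>A\<close>, \<open>p\<close>-th
  powers for \<open>h\<close> and the modulus \<open>p\<^sup>2\<close>, the vanishing sum says that the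
  color at infinity does not influence the weight. A translation by \<open>b\<close> changes the second factor by the second difference of
  \<open>n \<mapsto> ((n + b)\<^sup>p - n\<^sup>p - b\<^sup>p) / p\<close>, so the vanishing sum for the coloring itself shows that translations
  preserve the weight. Multiplication by \<open>k\<close> multiplies the cocycle by \<open>k * k\<^sup>p\<close>, which is congruent to
  \<open>k\<^sup>2\<close> by Fermat's theorem.
\<close>


section \<open>Local geometry of a diagram\<close>

lemma move_0 [simp]: "move P 0 = P"
  by (simp add: move_def)

lemma move_move [simp]: "move (move P s) t = move P (s + t)"
  by (simp add: move_def cis_mult mult.assoc)

lemma move_in_circles [simp]: "move P t \<in> circles D \<longleftrightarrow> P \<in> circles D"
  by (cases P) (auto simp: circles_def move_def norm_mult)

lemma move_pair: "move (i, cis s) t = (i, cis (s + t))"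
  by (simp add: move_def cis_mult)

lemma unit_circle_cis:
  assumes "z \<in> sphere (0::complex) 1"
  obtains t where "0 \<le> t" "t < 2 * pi" "z = cis t"
proof -
  have "cis (Arg2pi z) = z"
    using assms by (metis Arg2pi_eq cis_conv_exp mem_sphere_0 mult_1 of_real_1)
  then show thesis
    using that Arg2pi by metis
qed

lemma circles_cis:
  assumes "P \<in> circles D"
  obtains i t where "i < ncomp D" "0 \<le> t" "t < 2 * pi" "P = (i, cis t)"
proof -
  have "fst P < ncomp D" "snd P \<in> sphere 0 1"
    using assms by (auto simp: circles_def)
  then show thesis
    using that unit_circle_cis[of "snd P"] by (metis prod.collapse)
qed

lemma cis_in_circles [simp]: "(i, cis t) \<in> circles D \<longleftrightarrow> i < ncomp D"
  by (simp add: circles_def)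

locale link =
  fixes D :: diagram
  assumes link: "link_diagram D"
begin

abbreviation K :: "complex set" where
  "K \<equiv> imm D ` circles D"

abbreviation doubles :: "(nat \<times> complex) set" where
  "doubles \<equiv> fst ` double_pairs D"

definition simple :: "nat \<times> complex \<Rightarrow> bool" where
  "simple P \<longleftrightarrow> P \<in> circles D \<and> (\<forall>Q\<in>circles D. imm D Q = imm D P \<longrightarrow> Q = P)"

lemmas link_facts = link[unfolded link_diagram_def]

lemma ncomp_pos: "0 < ncomp D"
  using link_facts by linarith

lemma C1: "i < ncomp D \<Longrightarrow> (\<lambda>t. imm D (i, cis t)) C1_differentiable_on UNIV"
  using link_facts by (elim conjE) simp

lemma tangent_nz: "P \<in> circles D \<Longrightarrow> tangent D P \<noteq> 0"
  using link_facts by (elim conjE) simp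

lemma finite_double_pairs: "finite (double_pairs D)"
  using link_facts by (elim conjE) simp

lemma no_triple:
  assumes "P \<in> circles D" "Q \<in> circles D" "S \<in> circles D" "imm D P = imm D Q" "imm D Q = imm D S"
  shows "P = Q \<or> Q = S \<or> P = S"
  using link_facts assms by (elim conjE) metis

lemma transverse:
  "(P, Q) \<in> double_pairs D \<Longrightarrow> Im (cnj (tangent D P) * tangent D Q) \<noteq> 0"
  using link_facts by (elim conjE) fast

lemma under_doubles: "under D \<subseteq> doubles"
  using link_facts by (elim conjE)

lemma under_iff: "(P, Q) \<in> double_pairs D \<Longrightarrow> P \<in> under D \<longleftrightarrow> Q \<notin> under D"
  using link_facts by (elim conjE) fast

lemma double_pairsD:
  assumes "(P, Q) \<in> double_pairs D"
  shows "P \<in> circles D" "Q \<in> circles D" "P \<noteq> Q" "imm D P = imm D Q" "(Q, P) \<in> double_pairs D"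
  using assms unfolding double_pairs_def by (simp_all add: eq_commute)

lemma simple_iff: "simple P \<longleftrightarrow> P \<in> circles D - doubles"
proof
  assume "simple P"
  then have "P \<in> circles D" "\<And>Q. (P, Q) \<notin> double_pairs D"
    by (auto simp: simple_def double_pairs_def)
  then show "P \<in> circles D - doubles" by auto
next
  assume P: "P \<in> circles D - doubles"
  have "Q = P" if "Q \<in> circles D" "imm D Q = imm D P" for Q
  proof (rule ccontr)
    assume "Q \<noteq> P"
    then have "(P, Q) \<in> double_pairs D"
      using that P by (simp add: double_pairs_def)
    then have "P \<in> doubles" by (rule image_eqI[rotated]) simp
    with P show False by blast
  qed
  with P show "simple P" by (simp add: simple_def)
qed

lemma simple_circles: "simple P \<Longrightarrow> P \<in> circles D"
  by (simp add: simple_def)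

lemma simple_not_under: "simple P \<Longrightarrow> P \<notin> under D"
  using under_doubles by (auto simp: simple_iff)

lemma finite_doubles: "finite doubles"
  using finite_double_pairs by simp

text \<open>The parameter of \<^const>\<open>move\<close> runs along a circle at unit speed, so the derivative that defines
  \<^const>\<open>tangent\<close> at time 0 gives the velocity at every time.\<close>

lemma velocity:
  assumes "P \<in> circles D"
  shows "((\<lambda>t. imm D (move P t)) has_vector_derivative tangent D (move P t)) (at t)"
    and "continuous_on UNIV (\<lambda>t. tangent D (move P t))"
proof -
  obtain i \<theta> where i: "i < ncomp D" and P: "P = (i, cis \<theta>)"
    using circles_cis[OF assms] by metis
  obtain G' where G': "\<And>t. ((\<lambda>t. imm D (i, cis t)) has_vector_derivative G' t) (at t)"
    and cont: "continuous_on UNIV G'"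
    using C1[OF i] unfolding C1_differentiable_on_def by auto
  have d: "((\<lambda>t. imm D (move P (s + t))) has_vector_derivative G' (\<theta> + s + t)) (at t)" for s t
  proof -
    have "((\<lambda>t. \<theta> + s + t) has_vector_derivative 1) (at t)"
      by (auto intro!: derivative_eq_intros)
    from vector_diff_chain_at[OF this, of "\<lambda>t. imm D (i, cis t)" "G' (\<theta> + s + t)"] G'
    show ?thesis by (simp add: o_def P move_pair add.assoc)
  qed
  have tan: "tangent D (move P s) = G' (\<theta> + s)" for s
    using vector_derivative_at[OF d[of s 0]] by (simp add: tangent_def)
  show "((\<lambda>t. imm D (move P t)) has_vector_derivative tangent D (move P t)) (at t)"
    using d[of 0 t] by (simp add: tan)
  show "continuous_on UNIV (\<lambda>t. tangent D (move P t))"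
    unfolding tan by (intro continuous_on_compose2[OF cont] continuous_intros) auto
qed

lemma continuous_imm_move:
  "P \<in> circles D \<Longrightarrow> continuous_on T (\<lambda>t. imm D (move P t))"
  using velocity(1) by (meson continuous_at_imp_continuous_on has_vector_derivative_continuous)

lemma isCont_imm_move: "P \<in> circles D \<Longrightarrow> isCont (\<lambda>t. imm D (move P t)) t"
  using velocity(1) has_vector_derivative_continuous by blast

lemma isCont_tangent_move: "P \<in> circles D \<Longrightarrow> isCont (\<lambda>t. tangent D (move P t)) t"
  using velocity(2) by (simp add: continuous_on_eq_continuous_at)

lemma compact_K: "compact K"
proof -
  have "K = (\<Union>i<ncomp D. (\<lambda>t. imm D (move (i, cis 0) t)) ` {0..2 * pi})"
    (is "_ = ?U")
  proof
    show "K \<subseteq> ?U"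
    proof
      fix z assume "z \<in> K"
      then obtain P where P: "P \<in> circles D" "z = imm D P" by auto
      then obtain i t where "i < ncomp D" "0 \<le> t" "t < 2 * pi" "P = (i, cis t)"
        using circles_cis by metis
      then show "z \<in> ?U" using P by (force simp: move_pair simp del: cis_zero)
    qed
  qed (auto simp: move_pair simp del: cis_zero)
  moreover have "compact ((\<lambda>t. imm D (move (i, cis 0) t)) ` {0..2 * pi})" if "i < ncomp D" for i
    by (intro compact_continuous_image continuous_imm_move compact_Icc)
      (simp add: that del: cis_zero)
  ultimately show ?thesis
    by (metis (no_types, lifting) compact_UN finite_lessThan lessThan_iff)
qed

lemma Region_memD: "r \<in> Region D \<Longrightarrow> z \<in> r \<Longrightarrow> z \<notin> K"
  using in_components_subset unfolding Region_def by blast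

lemma Region_unique: "r \<in> Region D \<Longrightarrow> r' \<in> Region D \<Longrightarrow> z \<in> r \<Longrightarrow> z \<in> r' \<Longrightarrow> r = r'"
  unfolding Region_def by (metis IntI components_eq empty_iff)

lemma Region_open: "r \<in> Region D \<Longrightarrow> open r"
  unfolding Region_def using compact_K by (meson compact_imp_closed open_Compl open_components)

lemma Region_exists: "z \<notin> K \<Longrightarrow> \<exists>r\<in>Region D. z \<in> r"
  unfolding Region_def using Union_components[of "- K"] by blast

text \<open>Connected sets off the diagram are used throughout to transport a region.\<close>

lemma connected_in_Region:
  assumes "connected C" "C \<inter> K = {}" "C \<noteq> {}"
  obtains r where "r \<in> Region D" "C \<subseteq> r"
  using assms exists_component_superset[of C "- K"] unfolding Region_def by blast

text \<open>
  Continuity of the velocity gives a linear approximation that is uniform for pairs of nearby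
  times, so a strand cannot return to a cone transverse to its tangent.
\<close>

lemma strand_linear:
  assumes P: "P \<in> circles D" and "\<eta> > 0"
  obtains \<delta> where "\<delta> > 0"
    "\<And>t t'. \<bar>t\<bar> \<le> \<delta> \<Longrightarrow> \<bar>t'\<bar> \<le> \<delta> \<Longrightarrow>
       norm (imm D (move P t') - imm D (move P t) - (t' - t) *\<^sub>R tangent D P) \<le> \<eta> * \<bar>t' - t\<bar>"
proof -
  have "\<exists>\<delta>>0. \<forall>t. dist t 0 < \<delta> \<longrightarrow> dist (tangent D (move P t)) (tangent D (move P 0)) < \<eta>"
    using isCont_tangent_move[OF P, of 0] \<open>\<eta> > 0\<close> unfolding continuous_at_eps_delta by blast
  then obtain \<delta> where \<delta>: "\<delta> > 0"
    "\<And>t. \<bar>t\<bar> < \<delta> \<Longrightarrow> norm (tangent D (move P t) - tangent D P) < \<eta>"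
    by (auto simp: dist_norm)
  show thesis
  proof (rule that[of "\<delta> / 2"])
    fix t t' assume t: "\<bar>t\<bar> \<le> \<delta> / 2" "\<bar>t'\<bar> \<le> \<delta> / 2"
    have "norm (imm D (move P t') - imm D (move P t) - (t' - t) *\<^sub>R tangent D (move P 0))
        \<le> norm (t' - t) * \<eta>"
    proof (rule vector_differentiable_bound_linearization[where S = "{-\<delta>/2..\<delta>/2}"])
      show "closed_segment t t' \<subseteq> {- \<delta> / 2..\<delta> / 2}"
        using t by (auto simp: closed_segment_eq_real_ivl)
      show "norm (tangent D (move P x) - tangent D (move P 0)) \<le> \<eta>"
        if "x \<in> {- \<delta> / 2..\<delta> / 2}" for x
        using \<delta>(2)[of x] that \<delta>(1) by (auto simp: abs_le_iff intro!: less_imp_le)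
    qed (use \<delta>(1) in \<open>auto intro: has_vector_derivative_at_within[OF velocity(1)[OF P]]\<close>)
    then show "norm (imm D (move P t') - imm D (move P t) - (t' - t) *\<^sub>R tangent D P) \<le> \<eta> * \<bar>t' - t\<bar>"
      by (simp add: mult.commute)
  qed (use \<delta> in auto)
qed

lemma strand_cone:
  assumes P: "P \<in> circles D" and "\<epsilon> > 0"
  obtains \<delta> where "\<delta> > 0"
    "\<And>t t' w. \<bar>t\<bar> \<le> \<delta> \<Longrightarrow> \<bar>t'\<bar> \<le> \<delta> \<Longrightarrow> w \<noteq> 0 \<Longrightarrow>
       \<epsilon> * norm w \<le> \<bar>Im (cnj (tangent D P) * w)\<bar> \<Longrightarrow> imm D (move P t) + w \<noteq> imm D (move P t')"
proof -
  define v where "v = tangent D P"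
  have v: "norm v > 0" using tangent_nz[OF P] by (simp add: v_def)
  \<comment> \<open>chosen so that \<open>|v| * \<eta> < \<epsilon> * (|v| - \<eta>)\<close>\<close>
  define \<eta> where "\<eta> = (\<epsilon> * norm v / 2) / (norm v + \<epsilon>)"
  have eta: "\<eta> > 0" using v \<open>\<epsilon> > 0\<close> unfolding \<eta>_def by (intro divide_pos_pos mult_pos_pos add_pos_pos) auto
  have "\<eta> * (norm v + \<epsilon>) = \<epsilon> * norm v / 2"
    using add_pos_pos[OF v \<open>\<epsilon> > 0\<close>] unfolding \<eta>_def
    by (intro nonzero_eq_divide_eq[THEN iffD1, OF _ refl]) linarith
  then have key: "norm v * \<eta> < \<epsilon> * (norm v - \<eta>)"
    using mult_pos_pos[OF \<open>\<epsilon> > 0\<close> v] by (simp add: algebra_simps)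
  obtain \<delta> where \<delta>: "\<delta> > 0"
    "\<And>t t'. \<bar>t\<bar> \<le> \<delta> \<Longrightarrow> \<bar>t'\<bar> \<le> \<delta> \<Longrightarrow>
       norm (imm D (move P t') - imm D (move P t) - (t' - t) *\<^sub>R v) \<le> \<eta> * \<bar>t' - t\<bar>"
    using strand_linear[OF P eta] unfolding v_def by metis
  show thesis
  proof (rule that[OF \<delta>(1)], rule notI)
    fix t t' w
    assume t: "\<bar>t\<bar> \<le> \<delta>" "\<bar>t'\<bar> \<le> \<delta>" and w: "w \<noteq> 0" "\<epsilon> * norm w \<le> \<bar>Im (cnj (tangent D P) * w)\<bar>"
      and eq: "imm D (move P t) + w = imm D (move P t')"
    define e where "e = w - (t' - t) *\<^sub>R v"
    have e: "norm e \<le> \<eta> * \<bar>t' - t\<bar>"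
      using \<delta>(2)[OF t] unfolding e_def eq[symmetric] by simp
    have wv: "w = (t' - t) *\<^sub>R v + e" by (simp add: e_def)
    have "Im (cnj v * w) = Im (cnj v * e)"
      by (simp add: wv algebra_simps)
    then have "\<epsilon> * norm w \<le> norm (cnj v * e)"
      using w abs_Im_le_cmod unfolding v_def by (metis order_trans)
    also have "\<dots> \<le> norm v * (\<eta> * \<bar>t' - t\<bar>)"
      using e v by (simp add: norm_mult)
    finally have 1: "\<epsilon> * norm w \<le> norm v * \<eta> * \<bar>t' - t\<bar>" by (simp add: mult.assoc)
    have "norm w \<ge> \<bar>t' - t\<bar> * norm v - norm e"
      unfolding wv by (metis norm_diff_ineq norm_scaleR)
    then have "norm w \<ge> \<bar>t' - t\<bar> * (norm v - \<eta>)"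
      using e by (simp add: algebra_simps)
    then have "\<epsilon> * (\<bar>t' - t\<bar> * (norm v - \<eta>)) \<le> norm v * \<eta> * \<bar>t' - t\<bar>"
      using 1 \<open>\<epsilon> > 0\<close> by (meson mult_left_mono less_imp_le order_trans)
    then have "\<bar>t' - t\<bar> * (\<epsilon> * (norm v - \<eta>)) \<le> \<bar>t' - t\<bar> * (norm v * \<eta>)"
      by (simp add: algebra_simps)
    moreover have "t' \<noteq> t"
    proof
      assume "t' = t"
      with e have "w = 0" by (simp add: wv)
      with w show False by simp
    qed
    ultimately show False using key by simp
  qed
qed

text \<open>By compactness nothing else of the diagram comes near a given point of it.\<close>

lemma local_strands:
  fixes X :: complex
  assumes "\<delta> > 0"
  obtains \<rho> where "\<rho> > 0"
    "\<And>z. z \<in> K \<Longrightarrow> norm (z - X) < \<rho> \<Longrightarrow>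
       \<exists>P t. P \<in> circles D \<and> imm D P = X \<and> \<bar>t\<bar> < \<delta> \<and> z = imm D (move P t)"
proof -
  define \<gamma> where "\<gamma> i t = imm D (i, cis t)" for i t
  define C where "C i = {0..2*pi} - (\<Union>t0\<in>{t0. \<gamma> i t0 = X}. {t0-\<delta><..<t0+\<delta>})" for i
  have \<gamma>: "\<gamma> i = (\<lambda>t. imm D (move (i, cis 0) t))" for i
    by (simp add: \<gamma>_def move_pair fun_eq_iff del: cis_zero)
  have cC: "compact (C i)" for i
    unfolding C_def by (intro compact_diff compact_Icc open_UN ballI open_greaterThanLessThan)
  have "compact (\<gamma> i ` C i)" if "i < ncomp D" for i
    unfolding \<gamma> by (intro compact_continuous_image continuous_imm_move cC)
      (simp add: that del: cis_zero)
  then have "closed (\<Union>i<ncomp D. \<gamma> i ` C i)"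
    by (intro compact_imp_closed compact_UN) auto
  moreover have "X \<notin> (\<Union>i<ncomp D. \<gamma> i ` C i)"
  proof
    assume "X \<in> (\<Union>i<ncomp D. \<gamma> i ` C i)"
    then obtain i t where "t \<in> C i" "\<gamma> i t = X" by auto
    moreover from this have "t \<in> (\<Union>t0\<in>{t0. \<gamma> i t0 = X}. {t0-\<delta><..<t0+\<delta>})"
      using \<open>\<delta> > 0\<close> by (intro UN_I[of t]) auto
    ultimately show False unfolding C_def by blast
  qed
  ultimately have "open (- (\<Union>i<ncomp D. \<gamma> i ` C i))" "X \<in> - (\<Union>i<ncomp D. \<gamma> i ` C i)"
    by (simp_all only: open_Compl Compl_iff simp_thms)
  then obtain \<rho> where \<rho>: "\<rho> > 0" "ball X \<rho> \<subseteq> - (\<Union>i<ncomp D. \<gamma> i ` C i)"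
    by (rule openE)
  show thesis
  proof (rule that[OF \<rho>(1)])
    fix z assume "z \<in> K" and near: "norm (z - X) < \<rho>"
    then obtain i t where it: "i < ncomp D" "0 \<le> t" "t < 2 * pi" "z = \<gamma> i t"
      using circles_cis unfolding \<gamma>_def by (metis imageE)
    have "z \<in> ball X \<rho>" using near by (simp add: dist_norm norm_minus_commute)
    then have "t \<notin> C i" using \<rho>(2) it by blast
    then obtain t0 where t0: "\<gamma> i t0 = X" "t0 - \<delta> < t" "t < t0 + \<delta>"
      using it by (auto simp: C_def)
    show "\<exists>P t. P \<in> circles D \<and> imm D P = X \<and> \<bar>t\<bar> < \<delta> \<and> z = imm D (move P t)"
      using it t0 by (intro exI[of _ "(i, cis t0)"] exI[of _ "t - t0"]) (auto simp: \<gamma>_def move_pair)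
  qed
qed

text \<open>A strand is locally injective as a map from time to the circle, so the finitely many multiple
  points are isolated along it.\<close>

lemma eventually_move_simple:
  assumes P: "P \<in> circles D"
  shows "eventually (\<lambda>t. simple (move P t)) (at 0)"
proof -
  define v where "v = tangent D P"
  have v: "norm v > 0" using tangent_nz[OF P] by (simp add: v_def)
  obtain \<delta> where \<delta>: "\<delta> > 0"
    "\<And>t t'. \<bar>t\<bar> \<le> \<delta> \<Longrightarrow> \<bar>t'\<bar> \<le> \<delta> \<Longrightarrow>
       norm (imm D (move P t') - imm D (move P t) - (t' - t) *\<^sub>R v) \<le> norm v / 2 * \<bar>t' - t\<bar>"
    using strand_linear[OF P, of "norm v / 2"] v unfolding v_def by (metis half_gt_zero)
  have "inj_on (move P) {-\<delta>..\<delta>}"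
  proof (rule inj_onI)
    fix t t' assume "t \<in> {-\<delta>..\<delta>}" "t' \<in> {-\<delta>..\<delta>}" "move P t = move P t'"
    then have "\<bar>t' - t\<bar> * norm v \<le> norm v / 2 * \<bar>t' - t\<bar>"
      using \<delta>(2)[of t t'] by (simp add: abs_le_iff)
    then have "\<bar>t' - t\<bar> * norm v \<le> 0" by (simp add: field_simps)
    then show "t = t'" using v by (simp add: mult_le_0_iff)
  qed
  then have "finite (move P -` doubles \<inter> {-\<delta>..\<delta>})"
    by (rule finite_vimage_IntI[OF finite_doubles])
  then have "closed (move P -` doubles \<inter> {-\<delta>..\<delta>} - {0})"
    by (simp add: finite_imp_closed)
  then have "eventually (\<lambda>t. t \<in> {-\<delta><..<\<delta>} \<inter> - (move P -` doubles \<inter> {-\<delta>..\<delta>} - {0})) (at 0)"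
    by (intro eventually_at_in_open' open_Int open_Compl) (use \<delta>(1) in auto)
  moreover have "eventually (\<lambda>t::real. t \<noteq> 0) (at 0)"
    by (simp add: eventually_at_filter)
  ultimately show ?thesis
  proof eventually_elim
    case (elim t)
    then have "move P t \<notin> doubles" by auto
    then show ?case using P by (simp add: simple_iff)
  qed
qed

end


section \<open>Regions beside a strand and around a crossing\<close>

text \<open>Displacements of length at most \<open>\<delta>\<close> to the left (\<open>\<kappa> = 1\<close>) or to the right (\<open>\<kappa> = -1\<close>) of the direction
  \<open>v\<close>, at an angle to it that is bounded below by \<open>\<epsilon>\<close>.\<close>

definition cone :: "complex \<Rightarrow> real \<Rightarrow> real \<Rightarrow> real \<Rightarrow> complex set" where
  "cone v \<kappa> \<epsilon> \<delta> = {w. w \<noteq> 0 \<and> norm w \<le> \<delta> \<and> \<epsilon> * norm w \<le> \<kappa> * Im (cnj v * w)}"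

lemma convex_cone:
  assumes "\<epsilon> > 0"
  shows "convex (cone v \<kappa> \<epsilon> \<delta>)"
proof (rule convexI)
  fix x y :: complex and a b :: real
  assume x: "x \<in> cone v \<kappa> \<epsilon> \<delta>" and y: "y \<in> cone v \<kappa> \<epsilon> \<delta>" and ab: "0 \<le> a" "0 \<le> b" "a + b = 1"
  define f where "f w = \<kappa> * Im (cnj v * w)" for w
  have f: "f (a *\<^sub>R x + b *\<^sub>R y) = a * f x + b * f y"
    by (simp add: f_def algebra_simps)
  have n: "norm (a *\<^sub>R x + b *\<^sub>R y) \<le> a * norm x + b * norm y"
    using ab norm_triangle_ineq[of "a *\<^sub>R x" "b *\<^sub>R y"] by simp
  have fx: "\<epsilon> * norm x \<le> f x" "norm x \<le> \<delta>" and fy: "\<epsilon> * norm y \<le> f y" "norm y \<le> \<delta>"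
    using x y by (auto simp: cone_def f_def)
  have pos: "f x > 0" "f y > 0"
  proof -
    have "\<epsilon> * norm x > 0" "\<epsilon> * norm y > 0" using x y assms by (auto simp: cone_def)
    with fx fy show "f x > 0" "f y > 0" by linarith+
  qed
  have "a * f x + b * f y > 0"
  proof (cases "a = 0")
    case False
    then have "a * f x > 0" "b * f y \<ge> 0" using ab pos by simp_all
    then show ?thesis by linarith
  qed (use ab pos in auto)
  then have 1: "a *\<^sub>R x + b *\<^sub>R y \<noteq> 0"
    unfolding f[symmetric] by (intro notI) (simp add: f_def)
  have "a * norm x + b * norm y \<le> a * \<delta> + b * \<delta>"
    using fx fy ab by (intro add_mono mult_left_mono) auto
  also have "\<dots> = \<delta>" using ab by (metis distrib_right mult_1)
  finally have 2: "norm (a *\<^sub>R x + b *\<^sub>R y) \<le> \<delta>" using n by linarith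
  have "\<epsilon> * norm (a *\<^sub>R x + b *\<^sub>R y) \<le> \<epsilon> * (a * norm x + b * norm y)"
    using n assms by simp
  also have "\<dots> = a * (\<epsilon> * norm x) + b * (\<epsilon> * norm y)" by (simp add: algebra_simps)
  also have "\<dots> \<le> a * f x + b * f y"
    using fx fy ab by (intro add_mono mult_left_mono) auto
  finally show "a *\<^sub>R x + b *\<^sub>R y \<in> cone v \<kappa> \<epsilon> \<delta>"
    using 1 2 f by (simp add: cone_def f_def)
qed

lemma eventually_cone:
  assumes "\<epsilon> * norm d \<le> \<kappa> * Im (cnj v * d)" "d \<noteq> 0" "\<delta> > 0"
  shows "eventually (\<lambda>s. s *\<^sub>R d \<in> cone v \<kappa> \<epsilon> \<delta>) (at_right (0::real))"
proof -
  have "((\<lambda>s. norm (s *\<^sub>R d)) \<longlongrightarrow> norm (0 *\<^sub>R d)) (at_right (0::real))"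
    by (intro tendsto_intros)
  then have "eventually (\<lambda>s. norm (s *\<^sub>R d) < \<delta>) (at_right (0::real))"
    using \<open>\<delta> > 0\<close> by (intro order_tendstoD(2)) auto
  then show ?thesis
  proof (rule eventually_elim2[OF _ eventually_at_right_less])
    fix s :: real assume s: "norm (s *\<^sub>R d) < \<delta>" "0 < s"
    have "s * (\<epsilon> * norm d) \<le> s * (\<kappa> * Im (cnj v * d))"
      using assms(1) s(2) by simp
    moreover have "\<epsilon> * norm (s *\<^sub>R d) = s * (\<epsilon> * norm d)" using s(2) by simp
    moreover have "\<kappa> * Im (cnj v * (s *\<^sub>R d)) = s * (\<kappa> * Im (cnj v * d))"
      by (simp add: algebra_simps)
    ultimately have "\<epsilon> * norm (s *\<^sub>R d) \<le> \<kappa> * Im (cnj v * (s *\<^sub>R d))" by argo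
    moreover have "s *\<^sub>R d \<noteq> 0" using s assms(2) by simp
    ultimately show "s *\<^sub>R d \<in> cone v \<kappa> \<epsilon> \<delta>"
      using s unfolding cone_def mem_Collect_eq by (intro conjI) (assumption | linarith)+
  qed
qed

lemma normal_pairing:
  assumes "\<kappa> \<in> {-1, 1}"
  shows "\<kappa> * Im (cnj v * (\<kappa> *\<^sub>R (\<i> * v))) = (norm v)\<^sup>2"
proof -
  have "Im (cnj v * (\<i> * v)) = (norm v)\<^sup>2"
    by (simp add: cmod_power2) (simp add: power2_eq_square)
  moreover have "\<kappa> * Im (cnj v * (\<kappa> *\<^sub>R (\<i> * v))) = (\<kappa> * \<kappa>) * Im (cnj v * (\<i> * v))"
    by (simp add: algebra_simps)
  moreover have "\<kappa> * \<kappa> = 1" using assms by auto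
  ultimately show ?thesis by simp
qed

lemma eventually_at_right_obtain_real:
  assumes "eventually P (at_right (0::real))"
  obtains s where "s > 0" "P s"
  using eventually_happens'[OF _ eventually_conj[OF eventually_at_right_less assms]]
  by (auto simp: trivial_limit_at_right_real)

context link
begin

text \<open>The sign \<open>\<kappa>\<close> is 1 for the left and \<open>-1\<close> for the right side.\<close>

definition side :: "real \<Rightarrow> nat \<times> complex \<Rightarrow> complex set" where
  "side \<kappa> P = (THE r. r \<in> Region D \<and>
     (\<forall>\<^sub>F s in at_right 0. imm D P + s *\<^sub>R (\<kappa> *\<^sub>R (\<i> * tangent D P)) \<in> r))"

lemma normal_transverse:
  assumes "P \<in> circles D" "\<kappa> \<in> {-1, 1}"
  shows "\<kappa> * Im (cnj (tangent D P) * (\<kappa> *\<^sub>R (\<i> * tangent D P))) > 0"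
  unfolding normal_pairing[OF assms(2)] using tangent_nz[OF assms(1)] by simp

text \<open>Near a simple point the diagram is the strand through that point, and this strand avoids the
  cones transverse to it.\<close>

lemma simple_cone:
  assumes P: "simple P" and "\<epsilon> > 0"
  obtains \<delta> where "\<delta> > 0"
    "\<And>t w. \<bar>t\<bar> \<le> \<delta> \<Longrightarrow> w \<noteq> 0 \<Longrightarrow> norm w \<le> \<delta> \<Longrightarrow>
       \<epsilon> * norm w \<le> \<bar>Im (cnj (tangent D P) * w)\<bar> \<Longrightarrow> imm D (move P t) + w \<notin> K"
proof -
  have PC: "P \<in> circles D" using P by (rule simple_circles)
  obtain \<delta>1 where \<delta>1: "\<delta>1 > 0"
    "\<And>t t' w. \<bar>t\<bar> \<le> \<delta>1 \<Longrightarrow> \<bar>t'\<bar> \<le> \<delta>1 \<Longrightarrow> w \<noteq> 0 \<Longrightarrow>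
       \<epsilon> * norm w \<le> \<bar>Im (cnj (tangent D P) * w)\<bar> \<Longrightarrow> imm D (move P t) + w \<noteq> imm D (move P t')"
    using strand_cone[OF PC \<open>\<epsilon> > 0\<close>] by blast
  obtain \<rho> where \<rho>: "\<rho> > 0"
    "\<And>z. z \<in> K \<Longrightarrow> norm (z - imm D P) < \<rho> \<Longrightarrow>
       \<exists>P' t. P' \<in> circles D \<and> imm D P' = imm D P \<and> \<bar>t\<bar> < \<delta>1 \<and> z = imm D (move P' t)"
    using local_strands[OF \<delta>1(1), of "imm D P"] by blast
  have "\<exists>\<delta>>0. \<forall>t. dist t 0 < \<delta> \<longrightarrow> dist (imm D (move P t)) (imm D (move P 0)) < \<rho> / 2"
    using isCont_imm_move[OF PC, of 0] \<rho>(1) unfolding continuous_at_eps_delta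
    by (metis half_gt_zero)
  then obtain \<delta>2 where \<delta>2: "\<delta>2 > 0" "\<And>t. \<bar>t\<bar> < \<delta>2 \<Longrightarrow> norm (imm D (move P t) - imm D P) < \<rho> / 2"
    by (auto simp: dist_norm)
  show thesis
  proof (rule that[of "min \<delta>1 (min (\<delta>2 / 2) (\<rho> / 3))"])
    fix t w assume t: "\<bar>t\<bar> \<le> min \<delta>1 (min (\<delta>2 / 2) (\<rho> / 3))" and w: "w \<noteq> 0"
      "norm w \<le> min \<delta>1 (min (\<delta>2 / 2) (\<rho> / 3))" "\<epsilon> * norm w \<le> \<bar>Im (cnj (tangent D P) * w)\<bar>"
    show "imm D (move P t) + w \<notin> K"
    proof
      assume K: "imm D (move P t) + w \<in> K"
      have "norm (imm D (move P t) + w - imm D P) \<le> norm (imm D (move P t) - imm D P) + norm w"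
        by (metis add_diff_eq diff_add_eq norm_triangle_ineq)
      also have "\<dots> < \<rho>" using \<delta>2(2)[of t] \<delta>2(1) \<rho>(1) t w(2) by auto
      finally obtain P' t' where "P' \<in> circles D" "imm D P' = imm D P" "\<bar>t'\<bar> < \<delta>1"
        "imm D (move P t) + w = imm D (move P' t')"
        using \<rho>(2)[OF K] by blast
      moreover from this have "P' = P" using P by (simp add: simple_def)
      ultimately show False using \<delta>1(2)[of t t' w] t w by simp
    qed
  qed (use \<delta>1 \<delta>2 \<rho> in auto)
qed

text \<open>
  Sweeping a convex set of displacements along a strand yields a connected set; if it misses the
  diagram it lies in one region.
\<close>

lemma sweep_in_Region:
  assumes P: "P \<in> circles D" and T: "is_interval T" "t0 \<in> T" and C: "convex C" "c0 \<in> C"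
    and K: "\<And>t w. t \<in> T \<Longrightarrow> w \<in> C \<Longrightarrow> imm D (move P t) + w \<notin> K"
  obtains r where "r \<in> Region D" "\<And>t w. t \<in> T \<Longrightarrow> w \<in> C \<Longrightarrow> imm D (move P t) + w \<in> r"
proof -
  let ?S = "(\<lambda>(t, w). imm D (move P t) + w) ` (T \<times> C)"
  have "continuous_on (T \<times> C) (\<lambda>x. imm D (move P (fst x)) + snd x)"
    by (intro continuous_intros continuous_on_compose2[OF continuous_imm_move[OF P, of UNIV]]) auto
  then have "connected ?S"
    using T C by (intro connected_continuous_image connected_Times)
      (auto simp: convex_connected is_interval_connected case_prod_beta')
  moreover have "?S \<inter> K = {}" using K by fast
  moreover have "?S \<noteq> {}" using T C by auto
  ultimately obtain r where "r \<in> Region D" "?S \<subseteq> r" by (rule connected_in_Region)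
  with that show thesis by fast
qed

text \<open>The cone contains the normal ray that defines \<open>side\<close> once \<open>\<epsilon>\<close> is decreased; sweeping it along the
  strand keeps it in one region.\<close>

lemma side_cone:
  assumes P: "simple P" and \<kappa>: "\<kappa> \<in> {-1, 1}" and "\<epsilon> > 0"
  obtains \<delta> where "\<delta> > 0" "side \<kappa> P \<in> Region D"
    "\<And>t w. \<bar>t\<bar> \<le> \<delta> \<Longrightarrow> w \<in> cone (tangent D P) \<kappa> \<epsilon> \<delta> \<Longrightarrow> imm D (move P t) + w \<in> side \<kappa> P"
proof -
  have PC: "P \<in> circles D" using P by (rule simple_circles)
  define v where "v = tangent D P"
  have v: "norm v > 0" using tangent_nz[OF PC] by (simp add: v_def)
  define \<epsilon>' where "\<epsilon>' = min \<epsilon> (norm v)"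
  have \<epsilon>': "\<epsilon>' > 0" using v \<open>\<epsilon> > 0\<close> by (simp add: \<epsilon>'_def)
  define n where "n = \<kappa> *\<^sub>R (\<i> * v)"
  have nn: "norm n = norm v" "n \<noteq> 0" using \<kappa> v by (auto simp: n_def norm_mult)
  have "\<kappa> * Im (cnj v * n) = norm v * norm v"
    using normal_pairing[OF \<kappa>, of v] by (simp only: n_def power2_eq_square)
  then have n: "\<epsilon>' * norm n \<le> \<kappa> * Im (cnj v * n)"
    using v by (simp add: nn \<epsilon>'_def mult_right_mono)
  obtain \<delta> where \<delta>: "\<delta> > 0"
    "\<And>t w. \<bar>t\<bar> \<le> \<delta> \<Longrightarrow> w \<noteq> 0 \<Longrightarrow> norm w \<le> \<delta> \<Longrightarrow>
       \<epsilon>' * norm w \<le> \<bar>Im (cnj v * w)\<bar> \<Longrightarrow> imm D (move P t) + w \<notin> K"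
    using simple_cone[OF P \<epsilon>'] unfolding v_def by blast
  have ev: "eventually (\<lambda>s. s *\<^sub>R n \<in> cone v \<kappa> \<epsilon>' \<delta>) (at_right (0::real))"
    using n nn \<delta>(1) by (intro eventually_cone)
  obtain s0 where s0: "s0 *\<^sub>R n \<in> cone v \<kappa> \<epsilon>' \<delta>"
    using eventually_at_right_obtain_real[OF ev] by blast
  obtain r where r: "r \<in> Region D"
    "\<And>t w. t \<in> {-\<delta>..\<delta>} \<Longrightarrow> w \<in> cone v \<kappa> \<epsilon>' \<delta> \<Longrightarrow> imm D (move P t) + w \<in> r"
  proof (rule sweep_in_Region[OF PC _ _ convex_cone[OF \<epsilon>'] s0])
    show "imm D (move P t) + w \<notin> K" if "t \<in> {-\<delta>..\<delta>}" "w \<in> cone v \<kappa> \<epsilon>' \<delta>" for t w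
    proof (rule \<delta>(2))
      have "\<epsilon>' * norm w \<le> \<kappa> * Im (cnj v * w)" using that by (simp add: cone_def)
      also have "\<dots> \<le> \<bar>Im (cnj v * w)\<bar>" using \<kappa> by auto
      finally show "\<epsilon>' * norm w \<le> \<bar>Im (cnj v * w)\<bar>" .
    qed (use that in \<open>auto simp: cone_def\<close>)
    show "(0::real) \<in> {-\<delta>..\<delta>}" using \<delta>(1) by simp
  qed (auto simp: is_interval_cc)
  have evr: "\<forall>\<^sub>F s in at_right 0. imm D P + s *\<^sub>R n \<in> r"
    using ev by eventually_elim (use r(2)[of 0] \<delta>(1) in auto)
  have side: "side \<kappa> P = r"
    unfolding side_def n_def[symmetric] v_def[symmetric]
  proof (rule the_equality)
    fix r' assume r': "r' \<in> Region D \<and> (\<forall>\<^sub>F s in at_right 0. imm D P + s *\<^sub>R n \<in> r')"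
    then have "\<forall>\<^sub>F s in at_right 0. imm D P + s *\<^sub>R n \<in> r' \<and> imm D P + s *\<^sub>R n \<in> r"
      using evr by (intro eventually_conj) auto
    then obtain s :: real where "imm D P + s *\<^sub>R n \<in> r' \<and> imm D P + s *\<^sub>R n \<in> r"
      by (rule eventually_at_right_obtain_real)
    then show "r' = r" using Region_unique r' r(1) by blast
  qed (use r evr in simp)
  have "cone v \<kappa> \<epsilon> \<delta> \<subseteq> cone v \<kappa> \<epsilon>' \<delta>"
  proof
    fix w assume w: "w \<in> cone v \<kappa> \<epsilon> \<delta>"
    have "\<epsilon>' * norm w \<le> \<epsilon> * norm w" by (simp add: \<epsilon>'_def mult_right_mono)
    with w show "w \<in> cone v \<kappa> \<epsilon>' \<delta>" unfolding cone_def mem_Collect_eq by (elim conjE, intro conjI) (assumption | linarith)+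
  qed
  then have "imm D (move P t) + w \<in> side \<kappa> P"
    if "\<bar>t\<bar> \<le> \<delta>" "w \<in> cone (tangent D P) \<kappa> \<epsilon> \<delta>" for t w
    using r(2)[of t w] that unfolding v_def side by (auto simp: abs_le_iff)
  with that[OF \<delta>(1)] r(1) side show thesis by blast
qed

lemma side_Region: "simple P \<Longrightarrow> \<kappa> \<in> {-1, 1} \<Longrightarrow> side \<kappa> P \<in> Region D"
  using side_cone[of P \<kappa> 1] zero_less_one by blast

lemma eventually_side:
  assumes P: "simple P" and \<kappa>: "\<kappa> \<in> {-1, 1}" and d: "\<kappa> * Im (cnj (tangent D P) * d) > 0"
  shows "\<forall>\<^sub>F s in at_right 0. imm D P + s *\<^sub>R d \<in> side \<kappa> P"
proof -
  have "d \<noteq> 0" using d by auto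
  define \<epsilon> where "\<epsilon> = \<kappa> * Im (cnj (tangent D P) * d) / norm d"
  have "\<epsilon> > 0" using d \<open>d \<noteq> 0\<close> by (simp add: \<epsilon>_def)
  have \<epsilon>: "\<epsilon> * norm d \<le> \<kappa> * Im (cnj (tangent D P) * d)"
    using \<open>d \<noteq> 0\<close> by (simp add: \<epsilon>_def)
  obtain \<delta> where \<delta>: "\<delta> > 0" "side \<kappa> P \<in> Region D"
    "\<And>t w. \<bar>t\<bar> \<le> \<delta> \<Longrightarrow> w \<in> cone (tangent D P) \<kappa> \<epsilon> \<delta> \<Longrightarrow> imm D (move P t) + w \<in> side \<kappa> P"
    using side_cone[OF P \<kappa> \<open>\<epsilon> > 0\<close>] by blast
  show ?thesis
    using eventually_cone[OF \<epsilon> \<open>d \<noteq> 0\<close> \<delta>(1)]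
    by eventually_elim (use \<delta>(3)[of 0] \<delta>(1) in auto)
qed

lemma side_eqI:
  assumes P: "simple P" and \<kappa>: "\<kappa> \<in> {-1, 1}" and d: "\<kappa> * Im (cnj (tangent D P) * d) > 0"
    and r: "r \<in> Region D" "\<forall>\<^sub>F s in at_right 0. imm D P + s *\<^sub>R d \<in> r"
  shows "side \<kappa> P = r"
proof -
  obtain s :: real where "imm D P + s *\<^sub>R d \<in> side \<kappa> P \<and> imm D P + s *\<^sub>R d \<in> r"
    using eventually_at_right_obtain_real[OF eventually_conj[OF eventually_side[OF P \<kappa> d] r(2)]]
    by blast
  then show ?thesis using Region_unique side_Region[OF P \<kappa>] r(1) by blast
qed

lemma eventually_transverse:
  assumes P: "P \<in> circles D" and d: "\<kappa> * Im (cnj (tangent D P) * d) > 0"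
  shows "\<forall>\<^sub>F t in at 0. \<kappa> * Im (cnj (tangent D (move P t)) * d) > 0"
proof -
  have "((\<lambda>t. tangent D (move P t)) \<longlongrightarrow> tangent D (move P 0)) (at 0)"
    using isCont_tangent_move[OF P, of 0] by (simp add: isCont_def)
  then have "((\<lambda>t. \<kappa> * Im (cnj (tangent D (move P t)) * d)) \<longlongrightarrow> \<kappa> * Im (cnj (tangent D (move P 0)) * d)) (at 0)"
    by (intro tendsto_intros)
  then show ?thesis using d by (intro order_tendstoD(1)) auto
qed

text \<open>The normal at \<open>P\<close> still points to the same side of the strand at nearby times, and its sweep
  stays in one region.\<close>

lemma side_locally_constant:
  assumes P: "simple P" and \<kappa>: "\<kappa> \<in> {-1, 1}"
  shows "\<forall>\<^sub>F t in at 0. side \<kappa> (move P t) = side \<kappa> P"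
proof -
  have PC: "P \<in> circles D" using P by (rule simple_circles)
  define v where "v = tangent D P"
  have v: "norm v > 0" using tangent_nz[OF PC] by (simp add: v_def)
  define n where "n = \<kappa> *\<^sub>R (\<i> * v)"
  have nn: "norm n = norm v" "n \<noteq> 0" using \<kappa> v by (auto simp: n_def norm_mult)
  have n: "\<kappa> * Im (cnj v * n) = norm v * norm v"
    using normal_pairing[OF \<kappa>, of v] by (simp only: n_def power2_eq_square)
  obtain \<delta> where \<delta>: "\<delta> > 0" "side \<kappa> P \<in> Region D"
    "\<And>t w. \<bar>t\<bar> \<le> \<delta> \<Longrightarrow> w \<in> cone v \<kappa> (norm v) \<delta> \<Longrightarrow> imm D (move P t) + w \<in> side \<kappa> P"
    using side_cone[OF P \<kappa> v[unfolded v_def]] unfolding v_def by blast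
  have ev: "eventually (\<lambda>s. s *\<^sub>R n \<in> cone v \<kappa> (norm v) \<delta>) (at_right (0::real))"
    using n nn \<delta>(1) by (intro eventually_cone) auto
  have small: "\<forall>\<^sub>F t in at 0. \<bar>t\<bar> \<le> \<delta>"
    using \<delta>(1) by (auto simp: eventually_at dist_real_def intro!: exI[of _ \<delta>])
  have "\<forall>\<^sub>F t in at 0. \<kappa> * Im (cnj (tangent D (move P t)) * n) > 0"
    using n v by (intro eventually_transverse PC) (simp add: v_def[symmetric])
  with small eventually_move_simple[OF PC] show ?thesis
  proof eventually_elim
    case (elim t)
    show ?case
    proof (rule side_eqI[OF elim(2) \<kappa> elim(3) side_Region[OF P \<kappa>]])
      show "\<forall>\<^sub>F s in at_right 0. imm D (move P t) + s *\<^sub>R n \<in> side \<kappa> P"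
        using ev by eventually_elim (use \<delta>(3) elim(1) in auto)
    qed
  qed
qed

text \<open>
  With \<open>e\<close> the sign of the frame \<open>(tangent P, tangent Q)\<close>, the quadrant on side \<open>\<kappa>1\<close> of the
  strand through \<open>P\<close> and on side \<open>\<kappa>2\<close> of the strand through \<open>Q\<close> is bounded by the half-branch of
  \<open>P\<close> in the direction \<open>- \<kappa>2 * e\<close>. Seen from the crossing, a point of this half-branch displaced
  into the quadrant lies in a cone transverse to the other strand, and \<open>strand_cone\<close> keeps such a
  cone free.
\<close>

lemma crossing_cone:
  assumes PQ: "(P, Q) \<in> double_pairs D" and \<kappa>: "\<kappa>1 \<in> {-1, 1}" "\<kappa>2 \<in> {-1, 1}" and "\<epsilon> > 0"
    and e: "e = sgn (Im (cnj (tangent D P) * tangent D Q))"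
  obtains \<delta> where "\<delta> > 0"
    "\<And>t w. 0 \<le> t \<Longrightarrow> t \<le> \<delta> \<Longrightarrow> w \<in> cone (tangent D P) \<kappa>1 \<epsilon> \<delta> \<Longrightarrow> w \<in> cone (tangent D Q) \<kappa>2 \<epsilon> \<delta> \<Longrightarrow>
       imm D (move P (- \<kappa>2 * e * t)) + w \<notin> K"
proof -
  define u v where "u = tangent D P" and "v = tangent D Q"
  have PC: "P \<in> circles D" and QC: "Q \<in> circles D" and ne: "P \<noteq> Q" and imm: "imm D P = imm D Q"
    using double_pairsD[OF PQ] by auto
  define \<Delta> where "\<Delta> = \<bar>Im (cnj u * v)\<bar>"
  have \<Delta>: "\<Delta> > 0" using transverse[OF PQ] by (simp add: \<Delta>_def u_def v_def)
  have e2: "e * e = 1" "\<bar>e\<bar> = 1" and uv: "Im (cnj u * v) = e * \<Delta>"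
    using transverse[OF PQ] by (auto simp: e u_def v_def \<Delta>_def sgn_if)
  have vu: "Im (cnj v * u) = - e * \<Delta>" using uv by (simp add: algebra_simps)
  have vn: "norm v > 0" using tangent_nz[OF QC] by (simp add: v_def)
  have \<kappa>2: "\<kappa>2 * \<kappa>2 = 1" "\<bar>\<kappa>2\<bar> = 1" using \<kappa> by auto
  \<comment> \<open>the error \<open>\<eta> * t\<close> of the linear approximation costs at most half of the offset \<open>t * \<Delta>\<close>\<close>
  define \<eta> where "\<eta> = \<Delta> / (2 * norm v)"
  have \<eta>: "\<eta> > 0" "norm v * \<eta> = \<Delta> / 2" using \<Delta> vn by (auto simp: \<eta>_def)
  define \<epsilon>' where "\<epsilon>' = min \<epsilon> (\<Delta> / 2 / (norm u + \<eta>))"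
  have un: "norm u + \<eta> > 0" using \<eta>(1) by (simp add: add_nonneg_pos)
  have \<epsilon>': "\<epsilon>' > 0" "\<epsilon>' \<le> \<epsilon>" using \<open>\<epsilon> > 0\<close> \<Delta> un by (auto simp: \<epsilon>'_def)
  have \<epsilon>'2: "\<epsilon>' * (norm u + \<eta>) \<le> \<Delta> / 2"
    unfolding pos_le_divide_eq[OF un, symmetric] by (simp add: \<epsilon>'_def)
  obtain \<delta>0 where \<delta>0: "\<delta>0 > 0"
    "\<And>t t'. \<bar>t\<bar> \<le> \<delta>0 \<Longrightarrow> \<bar>t'\<bar> \<le> \<delta>0 \<Longrightarrow>
       norm (imm D (move P t') - imm D (move P t) - (t' - t) *\<^sub>R u) \<le> \<eta> * \<bar>t' - t\<bar>"
    using strand_linear[OF PC \<eta>(1)] unfolding u_def by blast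
  obtain \<delta>1 where \<delta>1: "\<delta>1 > 0"
    "\<And>t t' w. \<bar>t\<bar> \<le> \<delta>1 \<Longrightarrow> \<bar>t'\<bar> \<le> \<delta>1 \<Longrightarrow> w \<noteq> 0 \<Longrightarrow>
       \<epsilon> * norm w \<le> \<bar>Im (cnj u * w)\<bar> \<Longrightarrow> imm D (move P t) + w \<noteq> imm D (move P t')"
    using strand_cone[OF PC \<open>\<epsilon> > 0\<close>] unfolding u_def by blast
  obtain \<delta>2 where \<delta>2: "\<delta>2 > 0"
    "\<And>t t' w. \<bar>t\<bar> \<le> \<delta>2 \<Longrightarrow> \<bar>t'\<bar> \<le> \<delta>2 \<Longrightarrow> w \<noteq> 0 \<Longrightarrow>
       \<epsilon>' * norm w \<le> \<bar>Im (cnj v * w)\<bar> \<Longrightarrow> imm D (move Q t) + w \<noteq> imm D (move Q t')"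
    using strand_cone[OF QC \<epsilon>'(1)] unfolding v_def by blast
  define \<delta>3 where "\<delta>3 = min \<delta>1 \<delta>2"
  have \<delta>3: "\<delta>3 > 0" using \<delta>1 \<delta>2 by (simp add: \<delta>3_def)
  obtain \<rho> where \<rho>: "\<rho> > 0"
    "\<And>z. z \<in> K \<Longrightarrow> norm (z - imm D P) < \<rho> \<Longrightarrow>
       \<exists>P' t. P' \<in> circles D \<and> imm D P' = imm D P \<and> \<bar>t\<bar> < \<delta>3 \<and> z = imm D (move P' t)"
    using local_strands[OF \<delta>3(1), of "imm D P"] by blast
  define \<delta> where "\<delta> = min (min \<delta>0 \<delta>3) (\<rho> / (2 * (norm u + \<eta> + 1)))"
  have "0 < \<rho> / (2 * (norm u + \<eta> + 1))" using \<rho>(1) un by simp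
  then have \<delta>: "\<delta> > 0" "\<delta> \<le> \<delta>0" "\<delta> \<le> \<delta>1" "\<delta> \<le> \<delta>2" "\<delta> \<le> \<rho> / (2 * (norm u + \<eta> + 1))"
    using \<delta>0 \<delta>3 by (auto simp: \<delta>_def \<delta>3_def)
  have \<delta>\<rho>: "\<delta> * (norm u + \<eta> + 1) < \<rho>"
    using \<delta>(5) un \<rho>(1) by (simp add: field_simps)
  show thesis
  proof (rule that[OF \<delta>(1)], rule notI)
    fix t w
    assume t: "0 \<le> t" "t \<le> \<delta>" and wP: "w \<in> cone (tangent D P) \<kappa>1 \<epsilon> \<delta>"
      and wQ: "w \<in> cone (tangent D Q) \<kappa>2 \<epsilon> \<delta>" and K: "imm D (move P (- \<kappa>2 * e * t)) + w \<in> K"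
    define \<alpha> where "\<alpha> = - \<kappa>2 * e"
    have \<alpha>: "\<bar>\<alpha>\<bar> = 1" "\<bar>\<alpha> * t\<bar> = t" using e2 \<kappa>2 t by (auto simp: \<alpha>_def abs_mult)
    have w: "w \<noteq> 0" "norm w \<le> \<delta>" using wP by (auto simp: cone_def)
    define g where "g = imm D (move P (\<alpha> * t)) - imm D P - (\<alpha> * t) *\<^sub>R u"
    have g: "norm g \<le> \<eta> * t"
      using \<delta>0(2)[of 0 "\<alpha> * t"] t \<delta> \<delta>0(1) \<alpha> by (simp add: g_def)
    define W where "W = imm D (move P (\<alpha> * t)) + w - imm D P"
    have W: "W = (\<alpha> * t) *\<^sub>R u + g + w" by (simp add: W_def g_def)
    have "norm W \<le> norm ((\<alpha> * t) *\<^sub>R u) + norm g + norm w"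
      unfolding W by (metis norm_triangle_ineq add_right_mono order_trans)
    then have nW: "norm W \<le> t * (norm u + \<eta>) + norm w"
      using g \<alpha> t by (simp add: algebra_simps)
    have "norm W < \<rho>"
    proof -
      have "t * (norm u + \<eta>) \<le> \<delta> * (norm u + \<eta>)"
        using t un by (intro mult_right_mono) auto
      then show ?thesis using nW w(2) \<delta>\<rho> by (simp add: algebra_simps)
    qed
    then obtain P' t' where P': "P' \<in> circles D" "imm D P' = imm D P" "\<bar>t'\<bar> < \<delta>3"
        "imm D (move P (\<alpha> * t)) + w = imm D (move P' t')"
      using \<rho>(2)[OF K] by (auto simp: W_def \<alpha>_def)
    have "P' = P \<or> P' = Q" using no_triple[OF P'(1) PC QC] P'(2) imm ne by auto
    then show False
    proof
      assume "P' = P"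
      have "\<epsilon> * norm w \<le> \<bar>Im (cnj u * w)\<bar>"
      proof -
        have "\<epsilon> * norm w \<le> \<kappa>1 * Im (cnj u * w)" using wP by (simp add: cone_def u_def)
        also have "\<dots> \<le> \<bar>Im (cnj u * w)\<bar>" using \<kappa> by auto
        finally show ?thesis .
      qed
      then show False
        using \<delta>1(2)[of "\<alpha> * t" t' w] \<alpha> t \<delta> P'(3,4) w(1) \<open>P' = P\<close> by (simp add: \<delta>3_def)
    next
      assume "P' = Q"
      have "\<kappa>2 * Im (cnj v * W) = t * (- \<kappa>2 * \<kappa>2 * e * Im (cnj v * u)) + \<kappa>2 * Im (cnj v * g) + \<kappa>2 * Im (cnj v * w)"
        unfolding W \<alpha>_def by (simp add: algebra_simps)
      also have "- \<kappa>2 * \<kappa>2 * e * Im (cnj v * u) = (\<kappa>2 * \<kappa>2) * (e * e) * \<Delta>"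
        unfolding vu by (simp add: algebra_simps)
      finally have 1: "\<kappa>2 * Im (cnj v * W) = t * \<Delta> + \<kappa>2 * Im (cnj v * g) + \<kappa>2 * Im (cnj v * w)"
        using e2 \<kappa>2 by simp
      have "\<bar>\<kappa>2 * Im (cnj v * g)\<bar> \<le> norm (cnj v * g)"
        using \<kappa>2 abs_Im_le_cmod[of "cnj v * g"] by (simp only: abs_mult mult_1)
      also have "\<dots> \<le> norm v * (\<eta> * t)" using g vn by (simp add: norm_mult)
      also have "\<dots> = t * \<Delta> / 2" using \<eta>(2) by (metis mult.assoc mult.commute times_divide_eq_right)
      finally have 2: "\<kappa>2 * Im (cnj v * g) \<ge> - (t * \<Delta> / 2)" by linarith
      have 3: "\<kappa>2 * Im (cnj v * w) \<ge> \<epsilon> * norm w" using wQ by (simp add: cone_def v_def)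
      have 4: "\<kappa>2 * Im (cnj v * W) \<ge> t * (\<Delta> / 2) + \<epsilon> * norm w"
        using 1 2 3 by simp
      have "\<epsilon>' * norm W \<le> \<epsilon>' * (t * (norm u + \<eta>) + norm w)"
        using nW \<epsilon>'(1) by simp
      also have "\<dots> = t * (\<epsilon>' * (norm u + \<eta>)) + \<epsilon>' * norm w" by (simp add: algebra_simps)
      also have "\<dots> \<le> t * (\<Delta> / 2) + \<epsilon> * norm w"
        using \<epsilon>'2 \<epsilon>'(2) t by (intro add_mono mult_left_mono mult_right_mono) auto
      also have "\<dots> \<le> \<bar>Im (cnj v * W)\<bar>"
        using 4 \<kappa> by auto
      finally have 5: "\<epsilon>' * norm W \<le> \<bar>Im (cnj v * W)\<bar>" .
      have "\<epsilon> * norm w > 0" "t * (\<Delta> / 2) \<ge> 0" using w(1) \<open>\<epsilon> > 0\<close> t \<Delta> by auto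
      then have "W \<noteq> 0" using 4 by auto
      then show False
        using \<delta>2(2)[of 0 t' W] 5 \<delta>2(1) P'(3,4) \<open>P' = Q\<close> imm by (simp add: \<delta>3_def W_def)
    qed
  qed
qed

text \<open>The direction \<open>d0\<close> lies in the quadrant. Any other direction of the quadrant lies with \<open>d0\<close> in a
  common convex cone, so all of them see the same region.\<close>

lemma quadrant_half:
  assumes PQ: "(P, Q) \<in> double_pairs D" and \<kappa>: "\<kappa>1 \<in> {-1, 1}" "\<kappa>2 \<in> {-1, 1}"
    and e: "e = sgn (Im (cnj (tangent D P) * tangent D Q))"
    and d0: "d0 = (- \<kappa>2 * e) *\<^sub>R tangent D P + (\<kappa>1 * e) *\<^sub>R tangent D Q"
  obtains r where "r \<in> Region D"
    "\<And>d. \<kappa>1 * Im (cnj (tangent D P) * d) > 0 \<Longrightarrow> \<kappa>2 * Im (cnj (tangent D Q) * d) > 0 \<Longrightarrow>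
       \<forall>\<^sub>F s in at_right 0. imm D P + s *\<^sub>R d \<in> r"
    "\<forall>\<^sub>F s in at_right 0. imm D P + s *\<^sub>R d0 \<in> r"
    "\<forall>\<^sub>F t in at_right 0. side \<kappa>1 (move P (- \<kappa>2 * e * t)) = r"
proof -
  define u v where "u = tangent D P" and "v = tangent D Q"
  define X where "X = imm D P"
  have PC: "P \<in> circles D" using double_pairsD[OF PQ] by auto
  define \<Delta> where "\<Delta> = \<bar>Im (cnj u * v)\<bar>"
  have \<Delta>: "\<Delta> > 0" using transverse[OF PQ] by (simp add: \<Delta>_def u_def v_def)
  have e2: "e * e = 1" "e \<in> {-1, 1}" and uv: "Im (cnj u * v) = e * \<Delta>"
    using transverse[OF PQ] by (auto simp: e u_def v_def \<Delta>_def sgn_if)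
  have k2: "\<kappa>1 * \<kappa>1 = 1" "\<kappa>2 * \<kappa>2 = 1" using \<kappa> by auto
  define \<alpha> where "\<alpha> = - \<kappa>2 * e"
  have \<alpha>: "\<alpha> \<in> {-1, 1}" "\<alpha> * \<alpha> = 1" using \<kappa> e2 by (auto simp: \<alpha>_def)
  have "\<kappa>1 * Im (cnj u * d0) = (\<kappa>1 * \<kappa>1) * e * Im (cnj u * v)"
    unfolding d0 u_def[symmetric] v_def[symmetric] by (simp add: algebra_simps)
  also have "\<dots> = (e * e) * \<Delta>" unfolding uv k2 by simp
  finally have d0u: "\<kappa>1 * Im (cnj u * d0) = \<Delta>" by (simp add: e2)
  have "\<kappa>2 * Im (cnj v * d0) = (\<kappa>2 * \<kappa>2) * e * Im (cnj u * v)"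
    unfolding d0 u_def[symmetric] v_def[symmetric] by (simp add: algebra_simps)
  also have "\<dots> = (e * e) * \<Delta>" unfolding uv k2 by simp
  finally have d0v: "\<kappa>2 * Im (cnj v * d0) = \<Delta>" by (simp add: e2)
  have *: "\<exists>r\<in>Region D. (\<forall>\<^sub>F s in at_right 0. X + s *\<^sub>R d \<in> r) \<and> (\<forall>\<^sub>F s in at_right 0. X + s *\<^sub>R d0 \<in> r) \<and>
      (\<forall>\<^sub>F t in at_right 0. \<forall>\<^sub>F s in at_right 0. imm D (move P (\<alpha> * t)) + s *\<^sub>R d0 \<in> r)"
    if d: "\<kappa>1 * Im (cnj u * d) > 0" "\<kappa>2 * Im (cnj v * d) > 0" for d
  proof -
    define \<mu> where "\<mu> d = min (\<kappa>1 * Im (cnj u * d)) (\<kappa>2 * Im (cnj v * d)) / norm d" for d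
    define \<epsilon> where "\<epsilon> = min (\<mu> d) (\<mu> d0)"
    have nz: "d \<noteq> 0" "d0 \<noteq> 0" using d d0u \<Delta> by auto
    have "\<mu> d > 0" "\<mu> d0 > 0" using nz d d0u d0v \<Delta> by (simp_all add: \<mu>_def)
    then have \<epsilon>: "\<epsilon> > 0" by (simp add: \<epsilon>_def)
    have "\<mu> d * norm d = min (\<kappa>1 * Im (cnj u * d)) (\<kappa>2 * Im (cnj v * d))"
      "\<mu> d0 * norm d0 = min (\<kappa>1 * Im (cnj u * d0)) (\<kappa>2 * Im (cnj v * d0))"
      using nz by (simp_all add: \<mu>_def)
    moreover have "\<epsilon> * norm d \<le> \<mu> d * norm d" "\<epsilon> * norm d0 \<le> \<mu> d0 * norm d0"
      by (simp_all add: \<epsilon>_def mult_right_mono)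
    ultimately have le: "\<epsilon> * norm d \<le> \<kappa>1 * Im (cnj u * d)" "\<epsilon> * norm d \<le> \<kappa>2 * Im (cnj v * d)"
      "\<epsilon> * norm d0 \<le> \<kappa>1 * Im (cnj u * d0)" "\<epsilon> * norm d0 \<le> \<kappa>2 * Im (cnj v * d0)"
      by linarith+
    obtain \<delta> where \<delta>: "\<delta> > 0"
      "\<And>t w. 0 \<le> t \<Longrightarrow> t \<le> \<delta> \<Longrightarrow> w \<in> cone u \<kappa>1 \<epsilon> \<delta> \<Longrightarrow> w \<in> cone v \<kappa>2 \<epsilon> \<delta> \<Longrightarrow>
         imm D (move P (\<alpha> * t)) + w \<notin> K"
      using crossing_cone[OF PQ \<kappa> \<epsilon> e] unfolding u_def v_def \<alpha>_def by blast
    define C where "C = cone u \<kappa>1 \<epsilon> \<delta> \<inter> cone v \<kappa>2 \<epsilon> \<delta>"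
    have evd: "\<forall>\<^sub>F s in at_right (0::real). s *\<^sub>R d \<in> C" "\<forall>\<^sub>F s in at_right (0::real). s *\<^sub>R d0 \<in> C"
      unfolding C_def Int_iff
      by (intro eventually_conj eventually_cone le nz \<delta>(1))+
    obtain s0 where s0: "s0 *\<^sub>R d0 \<in> C"
      using eventually_at_right_obtain_real[OF evd(2)] by blast
    define T where "T = {t. 0 \<le> \<alpha> * t \<and> \<alpha> * t \<le> \<delta>}"
    have T: "T = {0..\<delta>} \<or> T = {-\<delta>..0}" using \<alpha>(1) by (auto simp: T_def)
    obtain r where r: "r \<in> Region D" "\<And>t w. t \<in> T \<Longrightarrow> w \<in> C \<Longrightarrow> imm D (move P t) + w \<in> r"
    proof (rule sweep_in_Region[OF PC, of T 0 C "s0 *\<^sub>R d0"])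
      show "imm D (move P t) + w \<notin> K" if "t \<in> T" "w \<in> C" for t w
      proof -
        have "\<alpha> * (\<alpha> * t) = t" using \<alpha>(2) by (simp flip: mult.assoc)
        with \<delta>(2)[of "\<alpha> * t" w] that show ?thesis by (simp add: T_def C_def)
      qed
      show "is_interval T" using T by (auto simp: is_interval_cc)
      show "convex C" unfolding C_def by (intro convex_Int convex_cone \<epsilon>)
    qed (use \<delta>(1) s0 in \<open>auto simp: T_def\<close>)
    have "\<forall>\<^sub>F s in at_right 0. X + s *\<^sub>R d \<in> r"
      using evd(1) by eventually_elim (use r(2)[of 0] \<delta>(1) in \<open>auto simp: T_def X_def\<close>)
    moreover have "\<forall>\<^sub>F s in at_right 0. X + s *\<^sub>R d0 \<in> r"
      using evd(2) by eventually_elim (use r(2)[of 0] \<delta>(1) in \<open>auto simp: T_def X_def\<close>)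
    moreover have "\<forall>\<^sub>F t in at_right 0. \<forall>\<^sub>F s in at_right 0. imm D (move P (\<alpha> * t)) + s *\<^sub>R d0 \<in> r"
    proof -
      have "\<forall>\<^sub>F t in at_right 0. 0 < t \<and> t < \<delta>"
        using \<delta>(1) by (intro eventually_conj eventually_at_right_less)
          (auto simp: eventually_at_right_field)
      then show ?thesis
      proof eventually_elim
        case (elim t)
        have "\<alpha> * (\<alpha> * t) = t" using \<alpha>(2) by (simp flip: mult.assoc)
        with elim have "\<alpha> * t \<in> T" unfolding T_def mem_Collect_eq by linarith
        from evd(2) show ?case by eventually_elim (rule r(2)[OF \<open>\<alpha> * t \<in> T\<close>])
      qed
    qed
    ultimately show ?thesis using r(1) by blast
  qed
  obtain r where r: "r \<in> Region D" "\<forall>\<^sub>F s in at_right 0. X + s *\<^sub>R d0 \<in> r"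
    "\<forall>\<^sub>F t in at_right 0. \<forall>\<^sub>F s in at_right 0. imm D (move P (\<alpha> * t)) + s *\<^sub>R d0 \<in> r"
    using *[of d0] unfolding d0u d0v using \<Delta> by blast
  show thesis
  proof (rule that[OF r(1)])
    fix d assume d: "\<kappa>1 * Im (cnj (tangent D P) * d) > 0" "\<kappa>2 * Im (cnj (tangent D Q) * d) > 0"
    obtain r' where r': "r' \<in> Region D" "\<forall>\<^sub>F s in at_right 0. X + s *\<^sub>R d \<in> r'"
      "\<forall>\<^sub>F s in at_right 0. X + s *\<^sub>R d0 \<in> r'"
      using *[of d] d unfolding u_def v_def by blast
    obtain s :: real where "X + s *\<^sub>R d0 \<in> r \<and> X + s *\<^sub>R d0 \<in> r'"
      using eventually_at_right_obtain_real[OF eventually_conj[OF r(2) r'(3)]] by blast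
    then have "r' = r" using Region_unique r(1) r'(1) by blast
    then show "\<forall>\<^sub>F s in at_right 0. imm D P + s *\<^sub>R d \<in> r" using r'(2) by (simp add: X_def)
  next
    show "\<forall>\<^sub>F s in at_right 0. imm D P + s *\<^sub>R d0 \<in> r" using r(2) by (simp add: X_def)
  next
    have "filterlim (\<lambda>t. \<alpha> * t) (at 0) (at_right 0)"
      unfolding filterlim_at
    proof
      show "\<forall>\<^sub>F t in at_right 0. \<alpha> * t \<in> UNIV \<and> \<alpha> * t \<noteq> 0"
        using eventually_at_right_less[of "0::real"] by eventually_elim (use \<alpha>(1) in auto)
      have "((\<lambda>t. \<alpha> * t) \<longlongrightarrow> \<alpha> * 0) (at_right 0)" by (intro tendsto_intros)
      then show "((\<lambda>t. \<alpha> * t) \<longlongrightarrow> 0) (at_right 0)" by simp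
    qed
    note sub = eventually_compose_filterlim[OF _ this]
    have "\<forall>\<^sub>F t in at 0. \<kappa>1 * Im (cnj (tangent D (move P t)) * d0) > 0"
      using d0u \<Delta> by (intro eventually_transverse PC) (simp add: u_def)
    from sub[OF this] sub[OF eventually_move_simple[OF PC]] r(3)
    have "\<forall>\<^sub>F t in at_right 0. side \<kappa>1 (move P (\<alpha> * t)) = r"
      by eventually_elim (rule side_eqI[OF _ \<kappa>(1) _ r(1)])
    then show "\<forall>\<^sub>F t in at_right 0. side \<kappa>1 (move P (- \<kappa>2 * e * t)) = r"
      by (simp add: \<alpha>_def)
  qed
qed

text \<open>Exchanging the two strands exchanges their roles in the quadrant but keeps \<open>d0\<close>, which identifies
  the regions beside the two bounding half-branches.\<close>

lemma quadrant:
  assumes PQ: "(P, Q) \<in> double_pairs D" and \<kappa>: "\<kappa>1 \<in> {-1, 1}" "\<kappa>2 \<in> {-1, 1}"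
    and e: "e = sgn (Im (cnj (tangent D P) * tangent D Q))"
  obtains r where "r \<in> Region D"
    "\<And>d. \<kappa>1 * Im (cnj (tangent D P) * d) > 0 \<Longrightarrow> \<kappa>2 * Im (cnj (tangent D Q) * d) > 0 \<Longrightarrow>
       \<forall>\<^sub>F s in at_right 0. imm D P + s *\<^sub>R d \<in> r"
    "\<forall>\<^sub>F t in at_right 0. side \<kappa>1 (move P (- \<kappa>2 * e * t)) = r"
    "\<forall>\<^sub>F t in at_right 0. side \<kappa>2 (move Q (\<kappa>1 * e * t)) = r"
proof -
  have QP: "(Q, P) \<in> double_pairs D" and imm: "imm D P = imm D Q"
    using double_pairsD[OF PQ] by auto
  have e': "- e = sgn (Im (cnj (tangent D Q) * tangent D P))"
  proof -
    have "Im (cnj (tangent D Q) * tangent D P) = - Im (cnj (tangent D P) * tangent D Q)" by simp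
    then show ?thesis unfolding e by (simp only: sgn_minus)
  qed
  define d0 where "d0 = (- \<kappa>2 * e) *\<^sub>R tangent D P + (\<kappa>1 * e) *\<^sub>R tangent D Q"
  have d0': "d0 = (- \<kappa>1 * - e) *\<^sub>R tangent D Q + (\<kappa>2 * - e) *\<^sub>R tangent D P"
    by (simp add: d0_def)
  obtain r where r: "r \<in> Region D"
    "\<And>d. \<kappa>1 * Im (cnj (tangent D P) * d) > 0 \<Longrightarrow> \<kappa>2 * Im (cnj (tangent D Q) * d) > 0 \<Longrightarrow>
       \<forall>\<^sub>F s in at_right 0. imm D P + s *\<^sub>R d \<in> r"
    "\<forall>\<^sub>F s in at_right 0. imm D P + s *\<^sub>R d0 \<in> r"
    "\<forall>\<^sub>F t in at_right 0. side \<kappa>1 (move P (- \<kappa>2 * e * t)) = r"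
    using quadrant_half[OF PQ \<kappa> e d0_def] by blast
  obtain r' where r': "r' \<in> Region D"
    "\<And>d. \<kappa>2 * Im (cnj (tangent D Q) * d) > 0 \<Longrightarrow> \<kappa>1 * Im (cnj (tangent D P) * d) > 0 \<Longrightarrow>
       \<forall>\<^sub>F s in at_right 0. imm D Q + s *\<^sub>R d \<in> r'"
    "\<forall>\<^sub>F s in at_right 0. imm D Q + s *\<^sub>R d0 \<in> r'"
    "\<forall>\<^sub>F t in at_right 0. side \<kappa>2 (move Q (- \<kappa>1 * - e * t)) = r'"
    using quadrant_half[OF QP \<kappa>(2,1) e' d0'] by blast
  obtain s :: real where "imm D P + s *\<^sub>R d0 \<in> r \<and> imm D P + s *\<^sub>R d0 \<in> r'"
    using eventually_at_right_obtain_real[OF eventually_conj[OF r(3) r'(3)[folded imm]]] by blast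
  then have "r' = r" using Region_unique r(1) r'(1) by blast
  show thesis
    using that[OF r(1,2,4)] r'(4) \<open>r' = r\<close> by simp
qed

end


section \<open>Propagation from region to region\<close>

context link
begin

text \<open>By the intermediate value theorem a nearby point has the same tangential coordinate as some
  point of the strand, so it is a normal displacement of a point of the strand.\<close>

lemma simple_neighbourhood:
  assumes P: "simple P"
  obtains N where "open N" "imm D P \<in> N" "N \<subseteq> K \<union> side 1 P \<union> side (-1) P"
proof -
  have PC: "P \<in> circles D" using P by (rule simple_circles)
  define v where "v = tangent D P"
  define X where "X = imm D P"
  have v: "norm v > 0" using tangent_nz[OF PC] by (simp add: v_def)
  obtain \<delta>1 where \<delta>1: "\<delta>1 > 0" "side 1 P \<in> Region D"
    "\<And>t w. \<bar>t\<bar> \<le> \<delta>1 \<Longrightarrow> w \<in> cone v 1 (norm v) \<delta>1 \<Longrightarrow> imm D (move P t) + w \<in> side 1 P"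
    using side_cone[OF P insertI2[OF singletonI]] v unfolding v_def by blast
  obtain \<delta>2 where \<delta>2: "\<delta>2 > 0" "side (-1) P \<in> Region D"
    "\<And>t w. \<bar>t\<bar> \<le> \<delta>2 \<Longrightarrow> w \<in> cone v (-1) (norm v) \<delta>2 \<Longrightarrow> imm D (move P t) + w \<in> side (-1) P"
    using side_cone[OF P insertI1] v unfolding v_def by blast
  obtain \<delta>3 where \<delta>3: "\<delta>3 > 0"
    "\<And>t t'. \<bar>t\<bar> \<le> \<delta>3 \<Longrightarrow> \<bar>t'\<bar> \<le> \<delta>3 \<Longrightarrow>
       norm (imm D (move P t') - imm D (move P t) - (t' - t) *\<^sub>R v) \<le> norm v / 2 * \<bar>t' - t\<bar>"
    using strand_linear[OF PC, folded v_def] half_gt_zero[OF v] by blast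
  define \<delta> where "\<delta> = min \<delta>1 \<delta>2"
  have \<delta>: "\<delta> > 0" using \<delta>1 \<delta>2 by (simp add: \<delta>_def)
  have "\<exists>\<delta>'>0. \<forall>t. dist t 0 < \<delta>' \<longrightarrow> dist (imm D (move P t)) (imm D (move P 0)) < \<delta> / 2"
    using isCont_imm_move[OF PC, of 0] half_gt_zero[OF \<delta>]
    unfolding continuous_at_eps_delta by blast
  then obtain \<delta>4 where \<delta>4: "\<delta>4 > 0" "\<And>t. \<bar>t\<bar> < \<delta>4 \<Longrightarrow> norm (imm D (move P t) - X) < \<delta> / 2"
    by (auto simp: dist_norm X_def)
  define h where "h = min (min \<delta> \<delta>3) (\<delta>4 / 2)"
  have h: "h > 0" "h \<le> \<delta>" "h \<le> \<delta>3" "h < \<delta>4" using \<delta> \<delta>3 \<delta>4 by (auto simp: h_def)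
  define x where "x z = Re (cnj v * (z - X))" for z
  have x: "\<bar>x (imm D (move P t)) - t * (norm v)\<^sup>2\<bar> \<le> \<bar>t\<bar> * (norm v)\<^sup>2 / 2" if "\<bar>t\<bar> \<le> h" for t
  proof -
    define g where "g = imm D (move P t) - X - t *\<^sub>R v"
    have g: "norm g \<le> norm v / 2 * \<bar>t\<bar>"
      using \<delta>3(2)[of 0 t] that h \<delta>3(1) by (simp add: g_def X_def)
    have "cnj v * v = (norm v)\<^sup>2" by (metis complex_norm_square mult.commute)
    then have "x (imm D (move P t)) - t * (norm v)\<^sup>2 = Re (cnj v * g)"
      unfolding x_def g_def by (simp add: algebra_simps del: complex_cnj_mult)
    also have "\<bar>\<dots>\<bar> \<le> norm v * norm g"
      using abs_Re_le_cmod[of "cnj v * g"] by (simp only: norm_mult complex_mod_cnj)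
    also have "\<dots> \<le> norm v * (norm v / 2 * \<bar>t\<bar>)" using g by (intro mult_left_mono) auto
    also have "\<dots> = \<bar>t\<bar> * (norm v)\<^sup>2 / 2" by (simp add: power2_eq_square)
    finally show ?thesis .
  qed
  have xp: "x (imm D (move P h)) > 0"
  proof -
    have "h * (norm v)\<^sup>2 > 0" using h v by simp
    moreover have "\<bar>x (imm D (move P h)) - h * (norm v)\<^sup>2\<bar> \<le> h * (norm v)\<^sup>2 / 2"
      using x[of h] h(1) by simp
    ultimately show ?thesis by linarith
  qed
  have xm: "x (imm D (move P (-h))) < 0"
  proof -
    have "h * (norm v)\<^sup>2 > 0" using h v by simp
    moreover have "\<bar>x (imm D (move P (- h))) + h * (norm v)\<^sup>2\<bar> \<le> h * (norm v)\<^sup>2 / 2"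
      using x[of "- h"] h(1) by simp
    ultimately show ?thesis by linarith
  qed
  define N where "N = ball X (\<delta> / 2) \<inter> {z. x (imm D (move P (-h))) < x z} \<inter> {z. x z < x (imm D (move P h))}"
  have "open N"
    unfolding N_def x_def by (intro open_Int open_ball open_Collect_less continuous_intros)
  moreover have "X \<in> N" using xp xm \<delta> by (simp add: N_def x_def)
  moreover have "z \<in> K \<union> side 1 P \<union> side (-1) P" if z: "z \<in> N" for z
  proof -
    have "continuous_on {-h..h} (\<lambda>t. x (imm D (move P t)))"
      unfolding x_def by (intro continuous_intros continuous_imm_move PC)
    then obtain t where t: "-h \<le> t" "t \<le> h" "x (imm D (move P t)) = x z"
      using IVT'[of "\<lambda>t. x (imm D (move P t))" "-h" "x z" h] z h(1) by (auto simp: N_def)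
    define w where "w = z - imm D (move P t)"
    have zw: "z = imm D (move P t) + w" by (simp add: w_def)
    have "norm (z - X) < \<delta> / 2" using z by (simp add: N_def dist_norm norm_minus_commute)
    moreover have "norm (imm D (move P t) - X) < \<delta> / 2" using \<delta>4(2)[of t] t h by auto
    ultimately have nw: "norm w \<le> \<delta>"
      using norm_triangle_ineq4[of "z - X" "imm D (move P t) - X"] by (simp add: w_def)
    have "Re (cnj v * w) = x z - x (imm D (move P t))" by (simp add: w_def x_def algebra_simps)
    then have "Re (cnj v * w) = 0" using t(3) by simp
    then have "norm v * norm w = \<bar>Im (cnj v * w)\<bar>"
      by (metis cmod_eq_Im complex_mod_cnj norm_mult)
    moreover have "A = 1 * I \<or> A = (-1) * I" if "A = \<bar>I\<bar>" for A I :: real using that by linarith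
    ultimately have "norm v * norm w = 1 * Im (cnj v * w) \<or> norm v * norm w = (-1) * Im (cnj v * w)"
      by blast
    then have "w = 0 \<or> w \<in> cone v 1 (norm v) \<delta> \<or> w \<in> cone v (-1) (norm v) \<delta>"
      using nw unfolding cone_def mem_Collect_eq by (metis order_refl)
    then consider "w = 0" | "w \<in> cone v 1 (norm v) \<delta>1" | "w \<in> cone v (-1) (norm v) \<delta>2"
      by (auto simp: cone_def \<delta>_def)
    then show ?thesis
    proof cases
      case 1
      then show ?thesis using PC by (simp add: zw)
    next
      case 2
      then show ?thesis using \<delta>1(3)[of t w] t h by (simp add: zw \<delta>_def abs_le_iff)
    next
      case 3
      then show ?thesis using \<delta>2(3)[of t w] t h by (simp add: zw \<delta>_def abs_le_iff)
    qed
  qed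
  ultimately show thesis using that[of N] by (auto simp: X_def)
qed

lemma in_closure_side:
  assumes P: "simple P" and \<kappa>: "\<kappa> \<in> {-1, 1}"
  shows "imm D P \<in> closure (side \<kappa> P)"
proof -
  have PC: "P \<in> circles D" using P by (rule simple_circles)
  define n where "n = \<kappa> *\<^sub>R (\<i> * tangent D P)"
  have "\<kappa> * Im (cnj (tangent D P) * n) > 0"
    unfolding n_def by (rule normal_transverse[OF PC \<kappa>])
  then have ev: "\<forall>\<^sub>F s in at_right 0. imm D P + s *\<^sub>R n \<in> side \<kappa> P"
    by (rule eventually_side[OF P \<kappa>])
  have "((\<lambda>s. imm D P + s *\<^sub>R n) \<longlongrightarrow> imm D P + 0 *\<^sub>R n) (at_right (0::real))"
    by (intro tendsto_intros)
  then have lim: "((\<lambda>s. imm D P + s *\<^sub>R n) \<longlongrightarrow> imm D P) (at_right (0::real))" by simp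
  have "\<forall>\<^sub>F s in at_right 0. imm D P + s *\<^sub>R n \<in> closure (side \<kappa> P)"
    using ev by eventually_elim (use closure_subset in blast)
  then show ?thesis
    by (rule Lim_in_closed_set[OF closed_closure _ trivial_limit_at_right_real lim])
qed

text \<open>
  The plane stays connected when the finitely many crossings are removed, and near any other point
  of the diagram only two regions are visible, which lie on the two sides of one strand.
\<close>

lemma Region_propagate:
  assumes r0: "r0 \<in> Region D" "\<Phi> r0"
    and step: "\<And>P. simple P \<Longrightarrow> \<Phi> (side (-1) P) \<longleftrightarrow> \<Phi> (side 1 P)"
    and r: "r \<in> Region D"
  shows "\<Phi> r"
proof (rule ccontr)
  assume nr: "\<not> \<Phi> r"
  define G where "G = \<Union>{r \<in> Region D. \<Phi> r}"
  define B where "B = \<Union>{r \<in> Region D. \<not> \<Phi> r}"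
  define X0 where "X0 = - (imm D ` doubles)"
  have disj: "r' \<inter> B = {}" if "r' \<in> Region D" "\<Phi> r'" for r'
    using that Region_unique by (auto simp: B_def)
  have disj': "r' \<inter> G = {}" if "r' \<in> Region D" "\<not> \<Phi> r'" for r'
    using that Region_unique by (auto simp: G_def)
  have KGB: "K \<inter> G = {}" "K \<inter> B = {}" using Region_memD by (auto simp: G_def B_def)
  have conn: "connected X0"
    unfolding X0_def using finite_double_pairs
    by (intro path_connected_imp_connected path_connected_complement_countable countable_finite finite_imageI) auto
  have split: "z \<in> - closure B \<longleftrightarrow> z \<in> closure G" if z: "z \<in> X0" for z
  proof (cases "z \<in> K")
    case False
    then obtain r' where r': "r' \<in> Region D" "z \<in> r'" using Region_exists by blast
    have op: "open r'" using r'(1) by (rule Region_open)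
    show ?thesis
    proof (cases "\<Phi> r'")
      case True
      then have "z \<in> G" using r' by (auto simp: G_def)
      moreover have "r' \<inter> closure B = {}"
        using disj[OF r'(1) True] op by (simp add: open_Int_closure_eq_empty)
      ultimately show ?thesis using r'(2) closure_subset by blast
    next
      case False
      then have "z \<in> B" using r' by (auto simp: B_def)
      moreover have "r' \<inter> closure G = {}"
        using disj'[OF r'(1) False] op by (simp add: open_Int_closure_eq_empty)
      ultimately show ?thesis using r'(2) closure_subset by blast
    qed
  next
    case True
    then obtain P where P: "P \<in> circles D" "z = imm D P" by auto
    have sP: "simple P" using P z by (auto simp: simple_iff X0_def)
    obtain N where N: "open N" "z \<in> N" "N \<subseteq> K \<union> side 1 P \<union> side (-1) P"
      using simple_neighbourhood[OF sP] P(2) by blast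
    have R: "side 1 P \<in> Region D" "side (-1) P \<in> Region D" using side_Region[OF sP] by auto
    have cl: "z \<in> closure (side 1 P)" using in_closure_side[OF sP, of 1] P(2) by simp
    show ?thesis
    proof (cases "\<Phi> (side 1 P)")
      case True
      then have "\<Phi> (side (-1) P)" using step[OF sP] by simp
      then have "N \<inter> B = {}" using N(3) disj R True KGB by blast
      then have "N \<inter> closure B = {}" using N(1) by (simp add: open_Int_closure_eq_empty)
      moreover have "side 1 P \<subseteq> G" using R True by (auto simp: G_def)
      then have "z \<in> closure G" using cl closure_mono by blast
      ultimately show ?thesis using N(2) by blast
    next
      case False
      then have "\<not> \<Phi> (side (-1) P)" using step[OF sP] by simp
      then have "N \<inter> G = {}" using N(3) disj' R False KGB by blast
      then have "N \<inter> closure G = {}" using N(1) by (simp add: open_Int_closure_eq_empty)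
      moreover have "side 1 P \<subseteq> B" using R False by (auto simp: B_def)
      then have "z \<in> closure B" using cl closure_mono by blast
      ultimately show ?thesis using N(2) by blast
    qed
  qed
  have pt: "\<exists>z\<in>X0. z \<in> r'" if "r' \<in> Region D" for r'
  proof -
    have "r' \<noteq> {}" using that by (auto simp: Region_def dest: in_components_nonempty)
    then obtain z where "z \<in> r'" by blast
    moreover from this have "z \<in> X0"
      using Region_memD[OF that] double_pairsD unfolding X0_def by fastforce
    ultimately show ?thesis by blast
  qed
  obtain z0 where z0: "z0 \<in> X0" "z0 \<in> G" using pt[OF r0(1)] r0 by (auto simp: G_def)
  obtain z1 where z1: "z1 \<in> X0" "z1 \<in> B" using pt[OF r] r nr by (auto simp: B_def)
  have "(- closure B) \<inter> X0 = {} \<or> (- closure G) \<inter> X0 = {}"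
  proof (rule connectedD[OF conn])
    show "- closure B \<inter> - closure G \<inter> X0 = {}" using split by blast
    show "X0 \<subseteq> - closure B \<union> - closure G" using split by blast
  qed auto
  moreover have "z0 \<in> - closure B" using z0 split closure_subset by blast
  moreover have "z1 \<in> - closure G"
    using z1 split[OF z1(1)] closure_subset[of B] by blast
  ultimately show False using z0 z1 by blast
qed

lemma r_infinity_Region: "r_infinity D \<in> Region D"
proof -
  have b: "bounded (- (- K))" using compact_K compact_imp_bounded by simp
  obtain r where r: "r \<in> Region D" "\<not> bounded r"
    using cobounded_unbounded_components[OF b] by (auto simp: Region_def)
  have "r_infinity D = r"
    unfolding r_infinity_def
  proof (rule the_equality)
    fix r' assume r': "r' \<in> Region D \<and> \<not> bounded r'"
    with r show "r' = r"
      using cobounded_unique_unbounded_components[OF b, of r r'] unfolding Region_def by simp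
  qed (use r in simp)
  then show ?thesis using r by simp
qed

end


section \<open>The checkerboard sign\<close>

context link
begin

definition loop :: "nat \<Rightarrow> real \<Rightarrow> complex" where
  "loop i x = imm D (i, cis (2 * pi * x))"

definition wind :: "complex \<Rightarrow> complex" where
  "wind z = (\<Sum>i<ncomp D. winding_number (loop i) z)"

lemma C1_strand:
  assumes P: "P \<in> circles D"
  shows "(\<lambda>x. imm D (move P (a * x + b))) C1_differentiable_on S"
  unfolding C1_differentiable_on_def
proof (intro exI[of _ "\<lambda>x. a *\<^sub>R tangent D (move P (a * x + b))"] conjI ballI)
  fix x
  have "((\<lambda>x. a * x + b) has_vector_derivative a) (at x)"
    by (auto intro!: derivative_eq_intros)
  from vector_diff_chain_at[OF this velocity(1)[OF P]]
  show "((\<lambda>x. imm D (move P (a * x + b))) has_vector_derivative a *\<^sub>R tangent D (move P (a * x + b))) (at x)"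
    by (simp add: o_def)
next
  show "continuous_on S (\<lambda>x. a *\<^sub>R tangent D (move P (a * x + b)))"
    by (intro continuous_intros continuous_on_compose2[OF velocity(2)[OF P]]) auto
qed

lemma valid_path_strand:
  "P \<in> circles D \<Longrightarrow> valid_path (\<lambda>x. imm D (move P (a * x + b)))"
  unfolding valid_path_def by (intro C1_differentiable_imp_piecewise C1_strand)

lemma loop_move: "loop i = (\<lambda>x. imm D (move (i, cis 0) (2 * pi * x + 0)))"
  by (simp add: loop_def move_pair fun_eq_iff del: cis_zero)

lemma path_loop: "i < ncomp D \<Longrightarrow> path (loop i)"
  unfolding loop_move by (intro valid_path_imp_path valid_path_strand) (simp del: cis_zero)

lemma loop_closed: "pathfinish (loop i) = pathstart (loop i)"
  by (simp add: loop_def pathfinish_def pathstart_def)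

lemma path_image_loop: "i < ncomp D \<Longrightarrow> path_image (loop i) \<subseteq> K"
  by (auto simp: path_image_def loop_def)

lemma wind_Region:
  assumes r: "r \<in> Region D"
  obtains n :: int where "\<And>z. z \<in> r \<Longrightarrow> wind z = of_int n"
proof -
  have conn: "connected r" and ne: "r \<noteq> {}"
    using r in_components_connected in_components_nonempty by (auto simp: Region_def)
  obtain z0 where z0: "z0 \<in> r" using ne by blast
  have disj: "r \<inter> path_image (loop i) = {}" if "i < ncomp D" for i
    using path_image_loop[OF that] Region_memD[OF r] by blast
  have "\<exists>n::int. winding_number (loop i) z0 = of_int n" if "i < ncomp D" for i
    using integer_winding_number[OF path_loop[OF that] loop_closed] disj[OF that] z0
    by (auto elim!: Ints_cases)
  then obtain n :: "nat \<Rightarrow> int" where n: "\<And>i. i < ncomp D \<Longrightarrow> winding_number (loop i) z0 = of_int (n i)"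
    by metis
  show thesis
  proof (rule that)
    fix z assume "z \<in> r"
    then have "winding_number (loop i) z = of_int (n i)" if "i < ncomp D" for i
      using winding_number_eq[OF path_loop[OF that] loop_closed _ z0 conn disj[OF that]] n[OF that]
      by simp
    then show "wind z = of_int (\<Sum>i<ncomp D. n i)" by (simp add: wind_def)
  qed
qed

lemma move_eq_self:
  assumes P: "P \<in> circles D" and "move P t = P" "0 < t" "t < 2 * pi"
  shows False
proof -
  have "snd P \<noteq> 0" using P by (auto simp: circles_def)
  then have "cis t = 1" using assms(2) by (cases P) (auto simp: move_def)
  then have "cos t = 1" by (metis cis.simps(1) one_complex.sel(1))
  then obtain n :: int where n: "t = real_of_int n * 2 * pi" using cos_one_2pi_int by blast
  have "0 < real_of_int n" "real_of_int n < 1"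
    using assms(3,4) pi_gt_zero unfolding n by (simp_all add: zero_less_mult_iff)
  then have "0 < n" "n < 1" by (simp_all only: of_int_0_less_iff of_int_less_1_iff)
  then show False by linarith
qed

text \<open>
  Starting the circuit at another point of the circle is \<^const>\<open>shiftpath\<close>.
\<close>

lemma winding_number_rebase:
  assumes i: "i < ncomp D" and z: "z \<notin> K"
  shows "winding_number (\<lambda>x. imm D (move (i, cis \<theta>) (2 * pi * x + b))) z = winding_number (loop i) z"
proof -
  define a where "a = frac ((\<theta> + b) / (2 * pi))"
  define n where "n = \<lfloor>(\<theta> + b) / (2 * pi)\<rfloor>"
  have a01: "a \<in> {0..1}" using frac_lt_1[of "(\<theta> + b) / (2 * pi)"] by (simp add: a_def)
  have "a = (\<theta> + b) / (2 * pi) - of_int n" by (simp add: a_def n_def frac_def)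
  then have a: "2 * pi * a = \<theta> + b - 2 * pi * of_int n" by (simp add: field_simps)
  have per: "cis (s - 2 * pi * of_int m) = cis s" for s m
    by (simp add: cis_divide[symmetric] cis_multiple_2pi)
  have "cis (2 * pi * (a + x)) = cis (\<theta> + (2 * pi * x + b))" for x
  proof -
    have "2 * pi * (a + x) = (\<theta> + (2 * pi * x + b)) - 2 * pi * of_int n"
      using a by (simp add: algebra_simps)
    then show ?thesis by (simp only: per)
  qed
  moreover have "cis (2 * pi * (a + x - 1)) = cis (\<theta> + (2 * pi * x + b))" for x
  proof -
    have "2 * pi * (a + x - 1) = (\<theta> + (2 * pi * x + b)) - 2 * pi * of_int (n + 1)"
      using a by (simp add: algebra_simps)
    then show ?thesis by (simp only: per)
  qed
  ultimately have "shiftpath a (loop i) = (\<lambda>x. imm D (move (i, cis \<theta>) (2 * pi * x + b)))"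
    unfolding shiftpath_def loop_def by (simp add: move_pair fun_eq_iff)
  then show ?thesis
    using winding_number_shiftpath[OF path_loop[OF i] _ loop_closed a01, of z] z path_image_loop[OF i]
    by auto
qed

lemma Ln_ii_jump:
  assumes "Re q > 0"
  shows "Ln (\<i> * q) - Ln (- \<i> * q) = \<i> * pi"
proof -
  have "\<i> * q \<noteq> 0" "Im (\<i> * q) > 0" using assms by auto
  then show ?thesis using Ln_minus[of "\<i> * q"] by simp
qed

text \<open>
  With \<open>X\<close> the image of \<open>P\<close> and \<open>v\<close> the velocity there, the part of the strand near \<open>P\<close> avoids the
  ray from \<open>X \<plusminus> s * (\<i> * v)\<close> that points away from \<open>X\<close>. So its share of the winding number is a difference of logarithms; the two branches differ by \<open>\<i> * pi\<close>
  at one end and by \<open>- \<i> * pi\<close> at the other, which makes the jump 1. The remaining part of the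
  curve contributes continuously.
\<close>

lemma winding_number_jump:
  assumes P: "simple P"
  shows "((\<lambda>s. winding_number (loop (fst P)) (imm D P + s *\<^sub>R (\<i> * tangent D P)) -
               winding_number (loop (fst P)) (imm D P + s *\<^sub>R (- (\<i> * tangent D P)))) \<longlongrightarrow> 1) (at_right 0)"
proof -
  have PC: "P \<in> circles D" using P by (rule simple_circles)
  define v where "v = tangent D P"
  define X where "X = imm D P"
  have v: "norm v > 0" "v \<noteq> 0" using tangent_nz[OF PC] by (simp_all add: v_def)
  obtain i \<theta> where i: "i < ncomp D" and Pi: "P = (i, cis \<theta>)"
    using circles_cis[OF PC] by metis
  obtain \<delta>0 where \<delta>0: "\<delta>0 > 0"
    "\<And>t t'. \<bar>t\<bar> \<le> \<delta>0 \<Longrightarrow> \<bar>t'\<bar> \<le> \<delta>0 \<Longrightarrow>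
       norm (imm D (move P t') - imm D (move P t) - (t' - t) *\<^sub>R v) \<le> norm v / 2 * \<bar>t' - t\<bar>"
    using strand_linear[OF PC, folded v_def] half_gt_zero[OF v(1)] by blast
  define \<delta> where "\<delta> = min \<delta>0 (pi / 2)"
  have \<delta>: "0 < \<delta>" "\<delta> \<le> \<delta>0" "\<delta> < pi" using \<delta>0 pi_gt_zero by (auto simp: \<delta>_def min_def)
  define q where "q t = (imm D (move P t) - X) / v" for t
  have q: "\<bar>Re (q t) - t\<bar> \<le> \<bar>t\<bar> / 2" if "\<bar>t\<bar> \<le> \<delta>" for t
  proof -
    have "q t - of_real t = (imm D (move P t) - X - t *\<^sub>R v) / v"
      using v by (simp add: q_def diff_divide_distrib scaleR_conv_of_real)
    also have "norm \<dots> \<le> \<bar>t\<bar> / 2"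
      using \<delta>0(2)[of 0 t] that \<delta> v by (simp add: norm_divide X_def divide_simps mult_ac)
    finally show ?thesis using abs_Re_le_cmod[of "q t - of_real t"] by simp
  qed
  have q0: "q 0 = 0" by (simp add: q_def X_def)
  have Req: "Re (q t) \<noteq> 0" if "\<bar>t\<bar> \<le> \<delta>" "t \<noteq> 0" for t using q[OF that(1)] that(2) by auto
  have "\<bar>Re (q \<delta>) - \<delta>\<bar> \<le> \<delta> / 2" "\<bar>Re (q (- \<delta>)) + \<delta>\<bar> \<le> \<delta> / 2"
    using q[of \<delta>] q[of "- \<delta>"] \<delta>(1) by simp_all
  then have qB: "Re (q \<delta>) > 0" and qA: "Re (q (- \<delta>)) < 0"
    using \<delta>(1) by linarith+
  define g where "g = (\<lambda>x. imm D (move P (2 * pi * x + - \<delta>)))"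
  define x0 where "x0 = \<delta> / pi"
  have x0: "0 < x0" "x0 < 1" "x0 \<in> {0..1}" "2 * pi * x0 - \<delta> = \<delta>" using \<delta> by (auto simp: x0_def)
  have vg: "valid_path g" unfolding g_def by (rule valid_path_strand[OF PC])
  have imK: "path_image g \<subseteq> K" using PC by (auto simp: path_image_def g_def)
  define L where "L = subpath 0 x0 g"
  define M where "M = subpath x0 1 g"
  have vL: "valid_path L" unfolding L_def using x0 by (intro valid_path_subpath vg) auto
  have pM: "path M" unfolding M_def using x0 vg by (intro path_subpath valid_path_imp_path) auto
  have imL: "\<exists>t. \<bar>t\<bar> \<le> \<delta> \<and> w = X + v * q t" if "w \<in> path_image L" for w
  proof -
    obtain x where x: "0 \<le> x" "x \<le> x0" "w = g x"
      using \<open>w \<in> path_image L\<close> x0 by (auto simp: L_def path_image_subpath)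
    have "2 * pi * x \<le> 2 * pi * x0" using x by (intro mult_left_mono) auto
    then have "\<bar>2 * pi * x - \<delta>\<bar> \<le> \<delta>" using x0 x by (auto simp: abs_le_iff)
    moreover have "w = X + v * q (2 * pi * x - \<delta>)" using x v by (simp add: q_def g_def)
    ultimately show ?thesis by blast
  qed
  have XM: "X \<notin> path_image M"
  proof
    assume "X \<in> path_image M"
    then obtain x where x: "x0 \<le> x" "x \<le> 1" "X = g x"
      using x0 by (auto simp: M_def path_image_subpath)
    define t where "t = 2 * pi * x - \<delta>"
    have "2 * pi * x0 \<le> 2 * pi * x" "2 * pi * x \<le> 2 * pi * 1" using x by (intro mult_left_mono; simp)+
    then have t: "0 < t" "t < 2 * pi" using x0(4) \<delta>(1) unfolding t_def by linarith+
    have "imm D (move P t) = imm D P" using x by (simp add: g_def t_def X_def)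
    then have "move P t = P" using P PC by (simp add: simple_def)
    then show False using move_eq_self[OF PC _ t] by simp
  qed
  define z where "z \<kappa> s = X + s *\<^sub>R (\<kappa> *\<^sub>R (\<i> * v))" for \<kappa> s :: real
  have z_lim: "((\<lambda>s. z \<kappa> s) \<longlongrightarrow> X) (at_right 0)" for \<kappa>
  proof -
    have "((\<lambda>s. X + s *\<^sub>R (\<kappa> *\<^sub>R (\<i> * v))) \<longlongrightarrow> X + 0 *\<^sub>R (\<kappa> *\<^sub>R (\<i> * v))) (at_right 0)"
      by (intro tendsto_intros)
    then show ?thesis by (simp add: z_def)
  qed
  have M_lim: "((\<lambda>s. winding_number M (z \<kappa> s)) \<longlongrightarrow> winding_number M X) (at_right 0)" for \<kappa>
    using continuous_at_winding_number[OF pM XM] z_lim by (rule isCont_tendsto_compose)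
  have zK: "\<forall>\<^sub>F s in at_right 0. z \<kappa> s \<notin> K" if \<kappa>: "\<kappa> \<in> {-1, 1}" for \<kappa>
  proof -
    have "\<kappa> * Im (cnj (tangent D P) * (\<kappa> *\<^sub>R (\<i> * v))) > 0"
      unfolding v_def by (rule normal_transverse[OF PC \<kappa>])
    from eventually_side[OF P \<kappa> this] show ?thesis
      by eventually_elim (use Region_memD[OF side_Region[OF P \<kappa>]] in \<open>simp add: z_def X_def\<close>)
  qed
  have L_val: "\<forall>\<^sub>F s in at_right 0. winding_number L (z \<kappa> s) =
      1 / (2 * pi * \<i>) * (Ln (\<kappa> *\<^sub>R \<i> * q \<delta> + of_real s) - Ln (\<kappa> *\<^sub>R \<i> * q (- \<delta>) + of_real s))"
    if \<kappa>: "\<kappa> \<in> {-1, 1}" for \<kappa>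
    using zK[OF \<kappa>] eventually_at_right_less[of 0]
  proof eventually_elim
    case (elim s)
    have kk: "\<kappa> * \<kappa> = 1" using \<kappa> by auto
    \<comment> \<open>multiplication by \<open>c\<close> turns the free ray into the negative real axis\<close>
    define c where "c = \<kappa> *\<^sub>R \<i> / v"
    have c: "c \<noteq> 0" using \<kappa> v by (auto simp: c_def)
    have cw: "c * (X + v * y - z \<kappa> s) = \<kappa> *\<^sub>R \<i> * y + of_real s" for y
      using v kk by (auto simp: c_def z_def field_simps scaleR_conv_of_real simp flip: of_real_mult)
    define S where "S = {w. c * (w - z \<kappa> s) \<notin> \<real>\<^sub>\<le>\<^sub>0}"
    have der: "((\<lambda>w. Ln (c * (w - z \<kappa> s))) has_field_derivative 1 / (w - z \<kappa> s)) (at w within S)"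
      if "w \<in> S" for w
    proof -
      have "w - z \<kappa> s \<noteq> 0" using that by (auto simp: S_def)
      have "((\<lambda>w. Ln (c * (w - z \<kappa> s))) has_field_derivative inverse (c * (w - z \<kappa> s)) * (c * 1)) (at w within S)"
        using that by (auto intro!: derivative_eq_intros simp: S_def)
      moreover have "inverse (c * d) * (c * 1) = 1 / d" for d :: complex
        using c by (cases "d = 0") (auto simp: field_simps)
      ultimately show ?thesis by (simp only:)
    qed
    have sub: "path_image L \<subseteq> S"
    proof
      fix w assume "w \<in> path_image L"
      then obtain t where t: "\<bar>t\<bar> \<le> \<delta>" "w = X + v * q t" using imL by blast
      have "\<kappa> *\<^sub>R \<i> * q t + of_real s \<notin> \<real>\<^sub>\<le>\<^sub>0"
      proof (cases "t = 0")
        case True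
        then show ?thesis using elim(2) q0 by (auto simp: complex_nonpos_Reals_iff)
      next
        case False
        then show ?thesis using Req[OF t(1)] \<kappa> by (auto simp: complex_nonpos_Reals_iff)
      qed
      then show "w \<in> S" unfolding S_def t(2) mem_Collect_eq cw .
    qed
    have "((\<lambda>w. 1 / (w - z \<kappa> s)) has_contour_integral
        (Ln (c * (pathfinish L - z \<kappa> s)) - Ln (c * (pathstart L - z \<kappa> s)))) L"
      by (rule contour_integral_primitive[OF der vL sub])
    moreover have "pathfinish L = X + v * q \<delta>" "pathstart L = X + v * q (- \<delta>)"
    proof -
      have "2 * pi * x0 + - \<delta> = \<delta>" using x0(4) by simp
      then have "g x0 = imm D (move P \<delta>)" by (simp only: g_def)
      then show "pathfinish L = X + v * q \<delta>" "pathstart L = X + v * q (- \<delta>)"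
        using v by (simp_all add: L_def g_def q_def)
    qed
    ultimately have "contour_integral L (\<lambda>w. 1 / (w - z \<kappa> s)) =
        Ln (\<kappa> *\<^sub>R \<i> * q \<delta> + of_real s) - Ln (\<kappa> *\<^sub>R \<i> * q (- \<delta>) + of_real s)"
      by (simp only: cw contour_integral_unique)
    moreover have "z \<kappa> s \<notin> path_image L"
      using sub by (auto simp: S_def)
    ultimately show ?case using winding_number_valid_path[OF vL] by simp
  qed
  have L_lim: "((\<lambda>s. winding_number L (z \<kappa> s)) \<longlongrightarrow>
      1 / (2 * pi * \<i>) * (Ln (\<kappa> *\<^sub>R \<i> * q \<delta>) - Ln (\<kappa> *\<^sub>R \<i> * q (- \<delta>)))) (at_right 0)"
    if \<kappa>: "\<kappa> \<in> {-1, 1}" for \<kappa>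
  proof -
    have n: "\<kappa> *\<^sub>R \<i> * q \<delta> + of_real 0 \<notin> \<real>\<^sub>\<le>\<^sub>0" "\<kappa> *\<^sub>R \<i> * q (- \<delta>) + of_real 0 \<notin> \<real>\<^sub>\<le>\<^sub>0"
      using qA qB \<kappa> by (auto simp: complex_nonpos_Reals_iff)
    have "((\<lambda>s. 1 / (2 * pi * \<i>) * (Ln (\<kappa> *\<^sub>R \<i> * q \<delta> + of_real s) - Ln (\<kappa> *\<^sub>R \<i> * q (- \<delta>) + of_real s))) \<longlongrightarrow>
      1 / (2 * pi * \<i>) * (Ln (\<kappa> *\<^sub>R \<i> * q \<delta> + of_real 0) - Ln (\<kappa> *\<^sub>R \<i> * q (- \<delta>) + of_real 0))) (at_right 0)"
      by (intro tendsto_intros n)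
    then have "((\<lambda>s. 1 / (2 * pi * \<i>) * (Ln (\<kappa> *\<^sub>R \<i> * q \<delta> + of_real s) - Ln (\<kappa> *\<^sub>R \<i> * q (- \<delta>) + of_real s))) \<longlongrightarrow>
      1 / (2 * pi * \<i>) * (Ln (\<kappa> *\<^sub>R \<i> * q \<delta>) - Ln (\<kappa> *\<^sub>R \<i> * q (- \<delta>)))) (at_right 0)" by simp
    then show ?thesis by (rule Lim_transform_eventually) (use L_val[OF \<kappa>] in \<open>eventually_elim, simp\<close>)
  qed
  have split: "\<forall>\<^sub>F s in at_right 0. winding_number L (z \<kappa> s) + winding_number M (z \<kappa> s) = winding_number (loop i) (z \<kappa> s)"
    if \<kappa>: "\<kappa> \<in> {-1, 1}" for \<kappa>
    using zK[OF \<kappa>]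
  proof eventually_elim
    case (elim s)
    have "winding_number L (z \<kappa> s) + winding_number M (z \<kappa> s) = winding_number (subpath 0 1 g) (z \<kappa> s)"
      unfolding L_def M_def using x0 elim imK vg
      by (intro winding_number_subpath_combine valid_path_imp_path) auto
    also have "\<dots> = winding_number (loop i) (z \<kappa> s)"
      using winding_number_rebase[OF i elim, of \<theta> "- \<delta>"] by (simp add: g_def Pi)
    finally show ?case .
  qed
  have lim: "((\<lambda>s. winding_number (loop i) (z \<kappa> s)) \<longlongrightarrow>
      1 / (2 * pi * \<i>) * (Ln (\<kappa> *\<^sub>R \<i> * q \<delta>) - Ln (\<kappa> *\<^sub>R \<i> * q (- \<delta>))) + winding_number M X) (at_right 0)"
    if \<kappa>: "\<kappa> \<in> {-1, 1}" for \<kappa>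
    by (rule Lim_transform_eventually[OF tendsto_add[OF L_lim[OF \<kappa>] M_lim] split[OF \<kappa>]])
  have "((\<lambda>s. winding_number (loop i) (z 1 s) - winding_number (loop i) (z (-1) s)) \<longlongrightarrow>
      (1 / (2 * pi * \<i>) * (Ln (1 *\<^sub>R \<i> * q \<delta>) - Ln (1 *\<^sub>R \<i> * q (- \<delta>))) + winding_number M X) -
      (1 / (2 * pi * \<i>) * (Ln ((-1) *\<^sub>R \<i> * q \<delta>) - Ln ((-1) *\<^sub>R \<i> * q (- \<delta>))) + winding_number M X)) (at_right 0)"
    by (intro tendsto_diff lim) auto
  also have "(1 / (2 * pi * \<i>) * (Ln (1 *\<^sub>R \<i> * q \<delta>) - Ln (1 *\<^sub>R \<i> * q (- \<delta>))) + winding_number M X) -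
      (1 / (2 * pi * \<i>) * (Ln ((-1) *\<^sub>R \<i> * q \<delta>) - Ln ((-1) *\<^sub>R \<i> * q (- \<delta>))) + winding_number M X) =
      1 / (2 * pi * \<i>) * ((Ln (\<i> * q \<delta>) - Ln (- \<i> * q \<delta>)) + (Ln (\<i> * - q (- \<delta>)) - Ln (- \<i> * - q (- \<delta>))))"
    by (simp add: algebra_simps)
  also have "\<dots> = 1"
    using Ln_ii_jump[OF qB] Ln_ii_jump[of "- q (- \<delta>)"] qA by (simp add: field_simps)
  finally show ?thesis by (simp add: z_def X_def v_def Pi)
qed

lemma wind_jump:
  assumes P: "simple P" and "z1 \<in> side 1 P" "z2 \<in> side (-1) P"
  shows "wind z1 = wind z2 + 1"
proof -
  have PC: "P \<in> circles D" using P by (rule simple_circles)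
  define n where "n = \<i> * tangent D P"
  have fP: "fst P < ncomp D" using PC by (auto simp: circles_def)
  note pos = normal_transverse[OF PC, folded n_def]
  have const: "\<forall>\<^sub>F s in at_right 0. wind (imm D P + s *\<^sub>R (\<kappa> *\<^sub>R n)) = wind z"
    if \<kappa>: "\<kappa> \<in> {-1, 1}" and z: "z \<in> side \<kappa> P" for \<kappa> z
  proof -
    obtain m :: int where m: "\<And>z. z \<in> side \<kappa> P \<Longrightarrow> wind z = of_int m"
      using wind_Region[OF side_Region[OF P \<kappa>]] by metis
    from eventually_side[OF P \<kappa> pos[OF \<kappa>]] show ?thesis
      by eventually_elim (use m z in auto)
  qed
  have comp: "((\<lambda>s. winding_number (loop i) (imm D P + s *\<^sub>R n) - winding_number (loop i) (imm D P + s *\<^sub>R (- n)))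
      \<longlongrightarrow> (if i = fst P then 1 else 0)) (at_right 0)" if i: "i < ncomp D" for i
  proof (cases "i = fst P")
    case True
    then show ?thesis using winding_number_jump[OF P] by (simp add: n_def)
  next
    case False
    have "imm D P \<notin> path_image (loop i)"
    proof
      assume "imm D P \<in> path_image (loop i)"
      then obtain x where "imm D (i, cis (2 * pi * x)) = imm D P"
        by (auto simp: path_image_def loop_def)
      then have "(i, cis (2 * pi * x)) = P" using P i unfolding simple_def by (meson cis_in_circles)
      then show False using False by auto
    qed
    then have c: "isCont (winding_number (loop i)) (imm D P)"
      by (intro continuous_at_winding_number path_loop i)
    have "((\<lambda>s. winding_number (loop i) (imm D P + s *\<^sub>R d)) \<longlongrightarrow> winding_number (loop i) (imm D P)) (at_right 0)" for d
    proof (rule isCont_tendsto_compose[OF c])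
      have "((\<lambda>s. imm D P + s *\<^sub>R d) \<longlongrightarrow> imm D P + 0 *\<^sub>R d) (at_right 0)" by (intro tendsto_intros)
      then show "((\<lambda>s. imm D P + s *\<^sub>R d) \<longlongrightarrow> imm D P) (at_right 0)" by simp
    qed
    from tendsto_diff[OF this[of n] this[of "- n"]] show ?thesis using False by simp
  qed
  have "((\<lambda>s. wind (imm D P + s *\<^sub>R n) - wind (imm D P + s *\<^sub>R (- n))) \<longlongrightarrow>
      (\<Sum>i<ncomp D. if i = fst P then 1 else 0)) (at_right 0)"
    unfolding wind_def sum_subtractf[symmetric] by (intro tendsto_sum comp) simp
  then have "((\<lambda>s. wind (imm D P + s *\<^sub>R n) - wind (imm D P + s *\<^sub>R (- n))) \<longlongrightarrow> 1) (at_right 0)"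
    using fP by simp
  moreover have "\<forall>\<^sub>F s in at_right 0. wind (imm D P + s *\<^sub>R n) - wind (imm D P + s *\<^sub>R (- n)) = wind z1 - wind z2"
    using const[of 1, OF _ assms(2)] const[of "-1", OF _ assms(3)] by (auto elim: eventually_elim2)
  ultimately have "((\<lambda>s::real. wind z1 - wind z2) \<longlongrightarrow> 1) (at_right 0)"
    by (rule Lim_transform_eventually)
  then have "wind z1 - wind z2 = 1"
    by (simp only: tendsto_const_iff[OF trivial_limit_at_right_real])
  then show ?thesis by (simp add: algebra_simps)
qed

text \<open>The parity, written as a sign, of the value of \<open>wind\<close> on the region.\<close>

definition checker :: "complex set \<Rightarrow> int" where
  "checker r = (if \<exists>n::int. even n \<and> (\<forall>z\<in>r. wind z = of_int n) then 1 else -1)"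

lemma checker_abs: "checker r * checker r = 1"
  by (simp add: checker_def)

lemma checker_side:
  assumes P: "simple P"
  shows "checker (side 1 P) = - checker (side (-1) P)"
proof -
  have R: "side 1 P \<in> Region D" "side (-1) P \<in> Region D" using side_Region[OF P] by auto
  obtain m :: int where m: "\<And>z. z \<in> side 1 P \<Longrightarrow> wind z = of_int m" using wind_Region[OF R(1)] by metis
  obtain n :: int where n: "\<And>z. z \<in> side (-1) P \<Longrightarrow> wind z = of_int n" using wind_Region[OF R(2)] by metis
  have ne: "r \<noteq> {}" if "r \<in> Region D" for r
    using that by (auto simp: Region_def dest: in_components_nonempty)
  obtain z1 z2 where z: "z1 \<in> side 1 P" "z2 \<in> side (-1) P" using ne R by blast
  have "(of_int m :: complex) = of_int (n + 1)"
    using wind_jump[OF P z] m[OF z(1)] n[OF z(2)] by simp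
  then have mn: "m = n + 1" by (simp only: of_int_eq_iff)
  have ch: "checker r = (if even k then 1 else -1)"
    if "\<And>z. z \<in> r \<Longrightarrow> wind z = of_int k" "z0 \<in> r" for r k z0
  proof -
    have "(\<exists>n::int. even n \<and> (\<forall>z\<in>r. wind z = of_int n)) \<longleftrightarrow> even k"
      using that by (metis of_int_eq_iff)
    then show ?thesis by (simp add: checker_def)
  qed
  show ?thesis using ch[OF m z(1)] ch[OF n z(2)] mn by simp
qed

end


section \<open>Arcs\<close>

lemma continuous_on_move: "continuous_on T (\<lambda>t. move P (\<kappa> * t))"
  unfolding move_def by (intro continuous_intros)

context link
begin

definition arc_of :: "nat \<times> complex \<Rightarrow> (nat \<times> complex) set" where
  "arc_of P = connected_component_set (circles D - under D) P"

lemma arc_of_Arc: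
  assumes "P \<in> circles D - under D"
  shows "arc_of P \<in> Arc D" "P \<in> arc_of P"
  using assms unfolding arc_of_def Arc_def by (simp_all add: componentsI)

lemma Arc_unique: "\<alpha> \<in> Arc D \<Longrightarrow> \<beta> \<in> Arc D \<Longrightarrow> P \<in> \<alpha> \<Longrightarrow> P \<in> \<beta> \<Longrightarrow> \<alpha> = \<beta>"
  unfolding Arc_def by (metis IntI components_eq empty_iff)

lemma Arc_subset: "\<alpha> \<in> Arc D \<Longrightarrow> \<alpha> \<subseteq> circles D - under D"
  unfolding Arc_def by (rule in_components_subset)

lemma arc_of_eqI: "\<alpha> \<in> Arc D \<Longrightarrow> P \<in> \<alpha> \<Longrightarrow> arc_of P = \<alpha>"
  using Arc_subset Arc_unique arc_of_Arc by blast

lemma connected_in_Arc: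
  assumes "connected C" "C \<subseteq> circles D - under D" "C \<noteq> {}"
  obtains \<alpha> where "\<alpha> \<in> Arc D" "C \<subseteq> \<alpha>"
proof -
  have "circles D - under D \<noteq> {}" using assms by blast
  then show thesis
    using exists_component_superset[OF assms(2) _ assms(1)] that unfolding Arc_def by blast
qed

lemma simple_interval:
  assumes P: "P \<in> circles D"
  obtains \<delta> where "\<delta> > 0" "\<And>t. t \<noteq> 0 \<Longrightarrow> \<bar>t\<bar> < \<delta> \<Longrightarrow> simple (move P t)"
  using eventually_move_simple[OF P] by (auto simp: eventually_at dist_real_def)

lemma half_branch_arc:
  assumes P: "P \<in> circles D" and \<kappa>: "\<kappa> \<in> {-1, 1::real}"
  obtains \<alpha> where "\<alpha> \<in> Arc D" "\<forall>\<^sub>F t in at_right 0. move P (\<kappa> * t) \<in> \<alpha>"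
proof -
  obtain \<delta> where \<delta>: "\<delta> > 0" "\<And>t. t \<noteq> 0 \<Longrightarrow> \<bar>t\<bar> < \<delta> \<Longrightarrow> simple (move P t)"
    using simple_interval[OF P] by blast
  let ?C = "(\<lambda>t. move P (\<kappa> * t)) ` {0<..<\<delta>}"
  have "simple (move P (\<kappa> * t))" if "t \<in> {0<..<\<delta>}" for t
    using that \<kappa> by (intro \<delta>(2)) auto
  then have "?C \<subseteq> circles D - under D" using simple_not_under simple_circles by blast
  moreover have "connected ?C"
    by (intro connected_continuous_image continuous_on_move) simp
  ultimately obtain \<alpha> where \<alpha>: "\<alpha> \<in> Arc D" "?C \<subseteq> \<alpha>"
    using connected_in_Arc[of ?C] \<delta>(1) by auto
  have "\<forall>\<^sub>F t in at_right 0. move P (\<kappa> * t) \<in> \<alpha>"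
    unfolding eventually_at_right_field using \<delta>(1) \<alpha>(2) by (intro exI[of _ \<delta>]) auto
  with that \<alpha>(1) show thesis by blast
qed

lemma arc_of_locally_constant:
  assumes P: "P \<in> circles D - under D"
  shows "\<forall>\<^sub>F t in at 0. arc_of (move P t) = arc_of P"
proof -
  obtain \<delta> where \<delta>: "\<delta> > 0" "\<And>t. t \<noteq> 0 \<Longrightarrow> \<bar>t\<bar> < \<delta> \<Longrightarrow> simple (move P t)"
    using simple_interval P by blast
  let ?C = "(\<lambda>t. move P (1 * t)) ` {-\<delta><..<\<delta>}"
  have *: "move P t \<in> circles D - under D" if "\<bar>t\<bar> < \<delta>" for t
  proof (cases "t = 0")
    case False
    with \<delta>(2) that show ?thesis using simple_not_under simple_circles by blast
  qed (use P in simp)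
  have "move P t \<in> circles D - under D" if "t \<in> {-\<delta><..<\<delta>}" for t
    by (rule *) (use that in auto)
  then have "?C \<subseteq> circles D - under D"
    unfolding image_subset_iff mult_1 by blast
  moreover have "connected ?C"
    by (intro connected_continuous_image continuous_on_move) simp
  ultimately obtain \<alpha> where \<alpha>: "\<alpha> \<in> Arc D" "?C \<subseteq> \<alpha>"
    using connected_in_Arc[of ?C] \<delta>(1) by auto
  have "move P t \<in> \<alpha>" if "\<bar>t\<bar> < \<delta>" for t
    using \<alpha>(2) that by (auto simp: abs_less_iff)
  then have "arc_of (move P t) = \<alpha>" if "\<bar>t\<bar> < \<delta>" for t
    using arc_of_eqI[OF \<alpha>(1)] that by blast
  from this[of 0] this show ?thesis
    unfolding eventually_at using \<delta>(1) by (intro exI[of _ \<delta>]) (auto simp: dist_real_def)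
qed

lemma Arc_nonempty: "Arc D \<noteq> {}"
proof -
  have "(0, cis 0) \<in> circles D" using ncomp_pos by (simp del: cis_zero)
  from half_branch_arc[OF this, of 1] show ?thesis by blast
qed

text \<open>A compactness argument: every point of a circle has a neighbourhood meeting at most three arcs.\<close>

lemma finite_Arc: "finite (Arc D)"
proof -
  define M where "M i T = {\<alpha> \<in> Arc D. \<exists>t\<in>T. (i, cis t) \<in> \<alpha>}" for i and T :: "real set"
  have loc: "\<exists>\<delta>>0. finite (M i (ball t0 \<delta>))" if i: "i < ncomp D" for i t0
  proof -
    define P where "P = (i, cis t0)"
    have P: "P \<in> circles D" using i by (simp add: P_def)
    obtain \<alpha> where \<alpha>: "\<alpha> \<in> Arc D" "\<forall>\<^sub>F t in at_right 0. move P (1 * t) \<in> \<alpha>"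
      using half_branch_arc[OF P, of 1] by blast
    obtain \<beta> where \<beta>: "\<beta> \<in> Arc D" "\<forall>\<^sub>F t in at_right 0. move P (-1 * t) \<in> \<beta>"
      using half_branch_arc[OF P, of "-1"] by blast
    obtain b where b: "b > 0" "\<And>t. t > 0 \<Longrightarrow> t < b \<Longrightarrow> move P t \<in> \<alpha> \<and> move P (- t) \<in> \<beta>"
      using eventually_conj[OF \<alpha>(2) \<beta>(2)] unfolding eventually_at_right_field by auto
    have "\<gamma> \<in> {\<alpha>, \<beta>, arc_of P}" if "\<gamma> \<in> M i (ball t0 b)" for \<gamma>
    proof -
      obtain t where t: "\<gamma> \<in> Arc D" "\<bar>t - t0\<bar> < b" "move P (t - t0) \<in> \<gamma>"
        using \<open>\<gamma> \<in> M i (ball t0 b)\<close> by (auto simp: M_def P_def move_pair dist_real_def abs_minus_commute)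
      consider "t - t0 = 0" | "t - t0 > 0" | "t - t0 < 0" by linarith
      then show ?thesis
      proof cases
        case 1
        then show ?thesis using arc_of_eqI[OF t(1)] t(3) by simp
      next
        case 2
        then show ?thesis using b(2)[of "t - t0"] t Arc_unique[OF t(1) \<alpha>(1)] by auto
      next
        case 3
        then show ?thesis using b(2)[of "t0 - t"] t Arc_unique[OF t(1) \<beta>(1)] by auto
      qed
    qed
    then have "finite (M i (ball t0 b))" by (meson finite.emptyI finite_insert finite_subset subsetI)
    with b(1) show ?thesis by blast
  qed
  have "finite (M i {0..2 * pi})" if i: "i < ncomp D" for i
  proof -
    obtain \<delta> where \<delta>: "\<And>t0. \<delta> t0 > 0" "\<And>t0. finite (M i (ball t0 (\<delta> t0)))"
      using loc[OF i] by metis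
    have cover: "{0..2 * pi} \<subseteq> (\<Union>t0\<in>{0..2 * pi}. ball t0 (\<delta> t0))" using \<delta>(1) by force
    obtain F where F: "F \<subseteq> {0..2 * pi}" "finite F" "{0..2 * pi} \<subseteq> (\<Union>t0\<in>F. ball t0 (\<delta> t0))"
      by (rule compactE_image[OF compact_Icc open_ball cover])
    have "M i {0..2 * pi} \<subseteq> (\<Union>t0\<in>F. M i (ball t0 (\<delta> t0)))"
      using F(3) unfolding M_def by blast
    then show ?thesis using F(2) \<delta>(2) by (meson finite_UN_I finite_subset)
  qed
  then have "finite (\<Union>i<ncomp D. M i {0..2 * pi})" by blast
  moreover have "Arc D \<subseteq> (\<Union>i<ncomp D. M i {0..2 * pi})"
  proof
    fix \<alpha> assume \<alpha>: "\<alpha> \<in> Arc D"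
    then have "\<alpha> \<noteq> {}" unfolding Arc_def by (rule in_components_nonempty)
    then obtain P where P: "P \<in> \<alpha>" by blast
    then have "P \<in> circles D" using Arc_subset[OF \<alpha>] by blast
    then obtain i t where it: "i < ncomp D" "0 \<le> t" "t < 2 * pi" "P = (i, cis t)"
      using circles_cis by metis
    then have "\<alpha> \<in> M i {0..2 * pi}" using \<alpha> P unfolding M_def by force
    with it show "\<alpha> \<in> (\<Union>i<ncomp D. M i {0..2 * pi})" by blast
  qed
  ultimately show ?thesis by (rule finite_subset[rotated])
qed

end


section \<open>The jump sum along the circles\<close>

text \<open>The left limit minus the jumps before it is locally constant.\<close>

lemma sum_of_jumps:
  fixes f L R :: "real \<Rightarrow> int"
  assumes R: "\<And>t. \<forall>\<^sub>F s in at_right 0. f (t + s) = R t"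
    and L: "\<And>t. \<forall>\<^sub>F s in at_right 0. f (t - s) = L t"
    and T: "finite T" "T \<subseteq> {a..<b}" "\<And>t. t \<in> {a..<b} \<Longrightarrow> t \<notin> T \<Longrightarrow> L t = R t" and "a \<le> b"
  shows "(\<Sum>t\<in>T. R t - L t) = L b - L a"
proof -
  have near: "\<exists>\<delta>>0. (\<forall>u. t < u \<and> u < t + \<delta> \<longrightarrow> f u = R t) \<and> (\<forall>u. t - \<delta> < u \<and> u < t \<longrightarrow> f u = L t)" for t
  proof -
    obtain \<delta> where \<delta>: "\<delta> > 0" "\<And>s. s > 0 \<Longrightarrow> s < \<delta> \<Longrightarrow> f (t + s) = R t \<and> f (t - s) = L t"
      using eventually_conj[OF R[of t] L[of t]] unfolding eventually_at_right_field by auto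
    have "f u = R t" if "t < u" "u < t + \<delta>" for u using \<delta>(2)[of "u - t"] that by simp
    moreover have "f u = L t" if "t - \<delta> < u" "u < t" for u using \<delta>(2)[of "t - u"] that by simp
    ultimately show ?thesis using \<delta>(1) by blast
  qed
  have nearL: "\<exists>\<delta>>0. (\<forall>u. t < u \<and> u < t + \<delta> \<longrightarrow> L u = R t) \<and> (\<forall>u. t - \<delta> < u \<and> u < t \<longrightarrow> L u = L t)" for t
  proof -
    obtain \<delta> where \<delta>: "\<delta> > 0" "\<And>u. t < u \<Longrightarrow> u < t + \<delta> \<Longrightarrow> f u = R t"
      "\<And>u. t - \<delta> < u \<Longrightarrow> u < t \<Longrightarrow> f u = L t" using near[of t] by blast
    have L_eq: "L u = c" if lo: "lo < u" "\<And>x. lo < x \<Longrightarrow> x < u \<Longrightarrow> f x = c" for u lo c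
    proof -
      obtain \<eta> where \<eta>: "\<eta> > 0" "\<And>x. u - \<eta> < x \<Longrightarrow> x < u \<Longrightarrow> f x = L u" using near[of u] by blast
      define x where "x = (max lo (u - \<eta>) + u) / 2"
      have "lo < x" "u - \<eta> < x" "x < u" using lo(1) \<eta>(1) by (auto simp: x_def)
      then show ?thesis using \<eta>(2) lo(2) by metis
    qed
    have "L u = R t" if "t < u" "u < t + \<delta>" for u
      using that \<delta>(2) by (intro L_eq[of t]) auto
    moreover have "L u = L t" if "t - \<delta> < u" "u < t" for u
      using that \<delta>(3) by (intro L_eq[of "t - \<delta>"]) auto
    ultimately show ?thesis using \<delta>(1) by blast
  qed
  define k where "k t = L t - (\<Sum>u\<in>T \<inter> {..<t}. R u - L u)" for t
  have "k a = k b"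
  proof (rule connected_local_const[of "{a..b}"])
    show "\<forall>t\<in>{a..b}. \<forall>\<^sub>F u in at t within {a..b}. k t = k u"
    proof
      fix t assume t: "t \<in> {a..b}"
      obtain \<delta> where \<delta>: "\<delta> > 0" "\<And>u. t < u \<Longrightarrow> u < t + \<delta> \<Longrightarrow> L u = R t"
        "\<And>u. t - \<delta> < u \<Longrightarrow> u < t \<Longrightarrow> L u = L t" using nearL[of t] by blast
      have "finite (T - {t})" using T(1) by simp
      then obtain \<eta> where \<eta>: "\<eta> > 0" "\<And>x. x \<in> T - {t} \<Longrightarrow> \<eta> \<le> dist t x"
        using finite_set_avoid[of "T - {t}" t] by blast
      have "k t = k u" if u: "u \<in> {a..b}" "u \<noteq> t" "dist u t < min \<delta> \<eta>" for u
      proof (cases "u < t")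
        case True
        have "T \<inter> {..<t} = T \<inter> {..<u}"
        proof -
          have "x < u" if "x \<in> T" "x < t" for x
            using \<eta>(2)[of x] that u True by (auto simp: dist_real_def)
          then show ?thesis using True by auto
        qed
        then show ?thesis using \<delta>(3)[of u] u True by (auto simp: k_def dist_real_def)
      next
        case False
        then have tu: "t < u" using u by simp
        have Tu: "T \<inter> {..<u} = (T \<inter> {..<t}) \<union> (T \<inter> {t})"
        proof -
          have "x \<le> t" if "x \<in> T" "x < u" for x
            using \<eta>(2)[of x] that u tu
            by (cases "x = t") (auto simp: dist_real_def abs_if split: if_splits)
          then show ?thesis using tu by force
        qed
        have "(\<Sum>u\<in>T \<inter> {..<u}. R u - L u) = (\<Sum>u\<in>T \<inter> {..<t}. R u - L u) + (\<Sum>u\<in>T \<inter> {t}. R u - L u)"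
          unfolding Tu using T(1) by (intro sum.union_disjoint) auto
        also have "(\<Sum>u\<in>T \<inter> {t}. R u - L u) = R t - L t"
        proof (cases "t \<in> T")
          case False
          moreover have "t \<in> {a..<b}" using t tu u by simp
          ultimately show ?thesis using T(3)[of t] by simp
        qed simp
        finally show ?thesis using \<delta>(2)[of u] u tu by (simp add: k_def dist_real_def)
      qed
      then show "\<forall>\<^sub>F u in at t within {a..b}. k t = k u"
        unfolding eventually_at using \<delta>(1) \<eta>(1) by (intro exI[of _ "min \<delta> \<eta>"]) auto
    qed
  qed (use \<open>a \<le> b\<close> in auto)
  moreover have "T \<inter> {..<a} = {}" "T \<inter> {..<b} = T" using T(2) by auto
  ultimately show ?thesis by (simp add: k_def)
qed

context link
begin

text \<open>On a circle the left limits at the two ends of a full turn agree.\<close>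

lemma circle_jump_sum:
  fixes F FR FL :: "nat \<times> complex \<Rightarrow> int"
  assumes FR: "\<And>P. P \<in> circles D \<Longrightarrow> \<forall>\<^sub>F t in at_right 0. F (move P t) = FR P"
    and FL: "\<And>P. P \<in> circles D \<Longrightarrow> \<forall>\<^sub>F t in at_right 0. F (move P (- t)) = FL P"
    and eq: "\<And>P. simple P \<Longrightarrow> FL P = FR P"
  shows "(\<Sum>P\<in>doubles. FR P - FL P) = 0"
proof -
  define T where "T i = {t \<in> {0..<2 * pi}. (i, cis t) \<in> doubles}" for i
  define c where "c i t = (i, cis t)" for i :: nat and t
  have dc: "doubles \<subseteq> circles D" using double_pairsD by auto
  have inj: "inj_on (c i) (T i)" for i
  proof (rule inj_onI)
    fix s t assume s: "s \<in> T i" and t: "t \<in> T i" and "c i s = c i t"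
    then have "cis s = cis t" by (simp add: c_def)
    moreover have "Arg2pi (cis u) = u" if "u \<in> T i" for u
      using that by (intro Arg2pi_unique[of 1]) (auto simp: T_def cis_conv_exp)
    ultimately show "s = t" using s t by metis
  qed
  have fT: "finite (T i)" for i
  proof -
    have "c i ` T i \<subseteq> doubles" by (auto simp: T_def c_def)
    then show ?thesis using finite_doubles inj finite_imageD finite_subset by metis
  qed
  have un: "doubles = (\<Union>i<ncomp D. c i ` T i)"
  proof
    show "doubles \<subseteq> (\<Union>i<ncomp D. c i ` T i)"
    proof
      fix P assume P: "P \<in> doubles"
      then obtain i t where it: "i < ncomp D" "0 \<le> t" "t < 2 * pi" "P = (i, cis t)"
        using circles_cis dc by (metis subsetD)
      then have "t \<in> T i" using P by (simp add: T_def)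
      then have "P \<in> c i ` T i" using it by (simp add: c_def)
      with it show "P \<in> (\<Union>i<ncomp D. c i ` T i)" by blast
    qed
  qed (auto simp: T_def c_def)
  have "(\<Sum>P\<in>doubles. FR P - FL P) = (\<Sum>i<ncomp D. \<Sum>P\<in>c i ` T i. FR P - FL P)"
    unfolding un by (intro sum.UNION_disjoint) (auto simp: fT c_def)
  also have "\<dots> = (\<Sum>i<ncomp D. 0)"
  proof (rule sum.cong)
    fix i assume "i \<in> {..<ncomp D}"
    then have i: "c i t \<in> circles D" for t by (simp add: c_def)
    have "(\<Sum>P\<in>c i ` T i. FR P - FL P) = (\<Sum>t\<in>T i. FR (c i t) - FL (c i t))"
      by (simp add: sum.reindex inj)
    also have "\<dots> = FL (c i (2 * pi)) - FL (c i 0)"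
    proof (rule sum_of_jumps[of "\<lambda>t. F (c i t)"])
      fix t
      show "\<forall>\<^sub>F s in at_right 0. F (c i (t + s)) = FR (c i t)"
        using FR[OF i, of t] by (simp add: c_def move_pair)
      show "\<forall>\<^sub>F s in at_right 0. F (c i (t - s)) = FL (c i t)"
        using FL[OF i, of t] by (simp add: c_def move_pair)
      show "FL (c i t) = FR (c i t)" if "t \<in> {0..<2 * pi}" "t \<notin> T i"
        using that i by (intro eq) (auto simp: simple_iff T_def c_def)
    qed (use fT in \<open>auto simp: T_def\<close>)
    also have "\<dots> = 0" by (simp add: c_def)
    finally show "(\<Sum>P\<in>c i ` T i. FR P - FL P) = 0" .
  qed simp
  finally show ?thesis by simp
qed

lemma at_0_halves:
  assumes "\<forall>\<^sub>F t in at (0::real). \<Phi> t" "\<kappa> \<in> {-1, 1}"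
  shows "\<forall>\<^sub>F t in at_right 0. \<Phi> (\<kappa> * t)"
proof -
  obtain \<delta> where "\<delta> > 0" "\<And>t. t \<noteq> 0 \<Longrightarrow> \<bar>t\<bar> < \<delta> \<Longrightarrow> \<Phi> t"
    using assms(1) by (auto simp: eventually_at dist_real_def)
  then show ?thesis
    unfolding eventually_at_right_field using assms(2) by (intro exI[of _ \<delta>]) auto
qed

lemma half_branch_right_side:
  assumes P: "P \<in> circles D" and \<kappa>: "\<kappa> \<in> {-1, 1::real}"
  obtains r where "\<forall>\<^sub>F t in at_right 0. side (-1) (move P (\<kappa> * t)) = r"
proof (cases "simple P")
  case True
  show thesis
    using that at_0_halves[OF side_locally_constant[OF True, of "-1"] \<kappa>] by blast
next
  case False
  then obtain Q where PQ: "(P, Q) \<in> double_pairs D" using P by (force simp: simple_iff)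
  define e where "e = sgn (Im (cnj (tangent D P) * tangent D Q))"
  have e: "e \<in> {-1, 1}" using transverse[OF PQ] by (auto simp: e_def sgn_if)
  have k2: "- \<kappa> * e \<in> {-1, 1}" using e \<kappa> by auto
  have m1: "(-1::real) \<in> {-1, 1}" by simp
  have "- (- \<kappa> * e) * e = \<kappa>" using e by auto
  then show thesis
    using quadrant[OF PQ m1 k2 e_def] that by metis
qed

lemma crossings_double: "(P, Q) \<in> crossings D \<Longrightarrow> (P, Q) \<in> double_pairs D"
  by (simp add: crossings_def)

lemma crossings_over_under:
  assumes "(P, Q) \<in> crossings D"
  shows "P \<in> circles D - under D" "Q \<in> under D"
  using assms under_iff[of P Q] double_pairsD[of P Q] by (auto simp: crossings_def)

lemma inj_on_crossings: "inj_on fst (crossings D)" "inj_on snd (crossings D)"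
proof -
  have partner: "Q = Q'" if "(P, Q) \<in> double_pairs D" "(P, Q') \<in> double_pairs D" for P Q Q'
    using no_triple[of Q P Q'] double_pairsD[OF that(1)] double_pairsD[OF that(2)] by metis
  show "inj_on fst (crossings D)"
    using partner crossings_double by (intro inj_onI) (metis prod.collapse)
  show "inj_on snd (crossings D)"
    using partner crossings_double double_pairsD(5) by (intro inj_onI) (metis prod.collapse)
qed

lemma over_arc_eq: "(P, Q) \<in> crossings D \<Longrightarrow> over_arc D P = arc_of P"
  unfolding over_arc_def
  by (rule the_equality) (use crossings_over_under arc_of_Arc arc_of_eqI in blast)+

text \<open>The crossing sign as a real number, so that it can serve as a direction along the strands.\<close>

definition frame_sign :: "nat \<times> complex \<Rightarrow> nat \<times> complex \<Rightarrow> real" where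
  "frame_sign P Q = sgn (Im (cnj (tangent D P) * tangent D Q))"

lemma frame_sign:
  assumes "(P, Q) \<in> crossings D"
  shows "frame_sign P Q \<in> {-1, 1}" "of_int (crossing_sign D P Q) = frame_sign P Q"
  using transverse[OF crossings_double[OF assms]]
  by (auto simp: frame_sign_def sgn_if crossing_sign_def left_of_def)

lemma the_half_branch_arc:
  fixes good :: "real \<Rightarrow> bool"
  assumes Q: "Q \<in> circles D" and \<kappa>: "\<kappa> \<in> {-1, 1}"
    and good: "\<And>\<eta>. \<eta> \<in> {-1, 1} \<Longrightarrow> good \<eta> \<longleftrightarrow> \<eta> = \<kappa>"
  defines "\<alpha> \<equiv> (THE \<alpha>. \<alpha> \<in> Arc D \<and>
    (\<exists>\<eta>\<in>{-1, 1}. good \<eta> \<and> (\<forall>\<^sub>F s in at_right 0. move Q (\<eta> * s) \<in> \<alpha>)))"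
  shows "\<alpha> \<in> Arc D" "\<forall>\<^sub>F t in at_right 0. move Q (\<kappa> * t) \<in> \<alpha>"
proof -
  obtain \<gamma> where \<gamma>: "\<gamma> \<in> Arc D" "\<forall>\<^sub>F t in at_right 0. move Q (\<kappa> * t) \<in> \<gamma>"
    using half_branch_arc[OF Q \<kappa>] by blast
  have "\<alpha> = \<gamma>"
    unfolding \<alpha>_def
  proof (rule the_equality)
    show "\<gamma> \<in> Arc D \<and> (\<exists>\<eta>\<in>{-1, 1}. good \<eta> \<and> (\<forall>\<^sub>F s in at_right 0. move Q (\<eta> * s) \<in> \<gamma>))"
      using \<gamma> \<kappa> good[OF \<kappa>] by blast
    fix \<beta> assume "\<beta> \<in> Arc D \<and> (\<exists>\<eta>\<in>{-1, 1}. good \<eta> \<and> (\<forall>\<^sub>F s in at_right 0. move Q (\<eta> * s) \<in> \<beta>))"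
    then obtain \<eta> where \<eta>: "\<eta> \<in> {-1, 1}" "good \<eta>" "\<forall>\<^sub>F s in at_right 0. move Q (\<eta> * s) \<in> \<beta>"
      and \<beta>: "\<beta> \<in> Arc D" by blast
    have "\<eta> = \<kappa>" using good[OF \<eta>(1)] \<eta>(2) by simp
    then obtain t where "move Q (\<kappa> * t) \<in> \<gamma> \<and> move Q (\<kappa> * t) \<in> \<beta>"
      using eventually_at_right_obtain_real[OF eventually_conj[OF \<gamma>(2) \<eta>(3)]] by blast
    then show "\<beta> = \<gamma>" using Arc_unique[OF \<beta> \<gamma>(1)] by blast
  qed
  then show "\<alpha> \<in> Arc D" "\<forall>\<^sub>F t in at_right 0. move Q (\<kappa> * t) \<in> \<alpha>" using \<gamma> by simp_all
qed

lemma under_half_branch_side: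
  assumes PQ: "(P, Q) \<in> crossings D" and \<eta>: "\<eta> \<in> {-1, 1}"
  shows "right_of (tangent D P) (\<eta> *\<^sub>R tangent D Q) \<longleftrightarrow> \<eta> = - frame_sign P Q"
    "left_of (tangent D P) (\<eta> *\<^sub>R tangent D Q) \<longleftrightarrow> \<eta> = frame_sign P Q"
proof -
  have "Im (cnj (tangent D P) * (\<eta> *\<^sub>R tangent D Q)) = \<eta> * Im (cnj (tangent D P) * tangent D Q)"
    by (simp add: algebra_simps)
  then show "right_of (tangent D P) (\<eta> *\<^sub>R tangent D Q) \<longleftrightarrow> \<eta> = - frame_sign P Q"
    "left_of (tangent D P) (\<eta> *\<^sub>R tangent D Q) \<longleftrightarrow> \<eta> = frame_sign P Q"
    using \<eta> transverse[OF crossings_double[OF PQ]]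
    unfolding right_of_def left_of_def frame_sign_def by (simp_all only: sgn_if) auto
qed

lemma under_arc_right_eq:
  assumes PQ: "(P, Q) \<in> crossings D"
  shows "under_arc_right D P Q \<in> Arc D"
    "\<forall>\<^sub>F t in at_right 0. move Q (- frame_sign P Q * t) \<in> under_arc_right D P Q"
proof -
  have Q: "Q \<in> circles D" and e: "- frame_sign P Q \<in> {-1, 1}"
    using double_pairsD[OF crossings_double[OF PQ]] frame_sign[OF PQ] by auto
  note * = the_half_branch_arc[OF Q e, of "\<lambda>\<eta>. right_of (tangent D P) (\<eta> *\<^sub>R tangent D Q)",
    OF under_half_branch_side(1)[OF PQ], folded under_arc_right_def]
  show "under_arc_right D P Q \<in> Arc D" by (rule *(1))
  show "\<forall>\<^sub>F t in at_right 0. move Q (- frame_sign P Q * t) \<in> under_arc_right D P Q" by (rule *(2))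
qed

lemma under_arc_left_eq:
  assumes PQ: "(P, Q) \<in> crossings D"
  shows "under_arc_left D P Q \<in> Arc D"
    "\<forall>\<^sub>F t in at_right 0. move Q (frame_sign P Q * t) \<in> under_arc_left D P Q"
proof -
  have Q: "Q \<in> circles D"
    using double_pairsD[OF crossings_double[OF PQ]] by auto
  note * = the_half_branch_arc[OF Q frame_sign(1)[OF PQ], of "\<lambda>\<eta>. left_of (tangent D P) (\<eta> *\<^sub>R tangent D Q)",
    OF under_half_branch_side(2)[OF PQ], folded under_arc_left_def]
  show "under_arc_left D P Q \<in> Arc D" by (rule *(1))
  show "\<forall>\<^sub>F t in at_right 0. move Q (frame_sign P Q * t) \<in> under_arc_left D P Q" by (rule *(2))
qed

lemma region_right_of_both_eq:
  assumes PQ: "(P, Q) \<in> crossings D" and r: "r \<in> Region D"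
    and ev: "\<And>d. (-1) * Im (cnj (tangent D P) * d) > 0 \<Longrightarrow> (-1) * Im (cnj (tangent D Q) * d) > 0 \<Longrightarrow>
       \<forall>\<^sub>F s in at_right 0. imm D P + s *\<^sub>R d \<in> r"
  shows "region_right_of_both D P Q = r"
proof -
  define u v e where "u = tangent D P" and "v = tangent D Q" and "e = frame_sign P Q"
  define d0 where "d0 = e *\<^sub>R u - e *\<^sub>R v"
  have "e * Im (cnj u * v) > 0"
    using transverse[OF crossings_double[OF PQ]]
    unfolding e_def frame_sign_def u_def v_def by (simp only: sgn_if) auto
  moreover have "Im (cnj u * d0) = - (e * Im (cnj u * v))" "Im (cnj v * d0) = - (e * Im (cnj u * v))"
    by (simp_all add: d0_def algebra_simps)
  ultimately have d0: "right_of u d0" "right_of v d0" by (simp_all only: right_of_def)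
  show ?thesis
    unfolding region_right_of_both_def u_def[symmetric] v_def[symmetric]
  proof (rule the_equality)
    show "r \<in> Region D \<and> (\<forall>d. right_of u d \<and> right_of v d \<longrightarrow> (\<forall>\<^sub>F s in at_right 0. imm D P + s *\<^sub>R d \<in> r))"
      using r ev unfolding u_def v_def right_of_def by simp
    fix r' assume r': "r' \<in> Region D \<and> (\<forall>d. right_of u d \<and> right_of v d \<longrightarrow> (\<forall>\<^sub>F s in at_right 0. imm D P + s *\<^sub>R d \<in> r'))"
    then have 1: "\<forall>\<^sub>F s in at_right 0. imm D P + s *\<^sub>R d0 \<in> r'" using d0 by blast
    have 2: "\<forall>\<^sub>F s in at_right 0. imm D P + s *\<^sub>R d0 \<in> r"
      using d0 by (intro ev) (simp_all add: right_of_def u_def v_def)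
    obtain s :: real where "imm D P + s *\<^sub>R d0 \<in> r' \<and> imm D P + s *\<^sub>R d0 \<in> r"
      using eventually_at_right_obtain_real[OF eventually_conj[OF 1 2]] by blast
    then show "r' = r" using Region_unique r r' by blast
  qed
qed

lemma eventually_arc_of:
  "\<alpha> \<in> Arc D \<Longrightarrow> \<forall>\<^sub>F t in at_right 0. move Q (\<kappa> * t) \<in> \<alpha> \<Longrightarrow>
     \<forall>\<^sub>F t in at_right 0. arc_of (move Q (\<kappa> * t)) = \<alpha>"
  by (erule eventually_mono) (rule arc_of_eqI)

text \<open>
  The heart of the invariance proofs. Put \<open>F = (B (region on the right) - A (arc)) * h (arc)\<close> at the
  simple points of the circles. This function is locally constant, and going once around every
  circle its jumps sum to 0. At a crossing the right hand region is reflected in the arc that is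
  passed, and the two jumps there add up to \<open>\<plusminus> (B x - A y) * (h y + h y' - 2 * h z)\<close>.
\<close>

lemma crossing_sum:
  fixes A h :: "(nat \<times> complex) set \<Rightarrow> int" and B :: "complex set \<Rightarrow> int" and m :: int
  assumes shadow: "\<And>P. simple P \<Longrightarrow> [B (side 1 P) = 2 * A (arc_of P) - B (side (-1) P)] (mod m)"
    and color: "\<And>P Q. (P, Q) \<in> crossings D \<Longrightarrow>
      [A (under_arc_left D P Q) = 2 * A (over_arc D P) - A (under_arc_right D P Q)] (mod m)"
  shows "[(\<Sum>(P, Q)\<in>crossings D. crossing_sign D P Q *
      ((B (region_right_of_both D P Q) - A (under_arc_right D P Q)) *
       (h (under_arc_right D P Q) + h (under_arc_left D P Q) - 2 * h (over_arc D P)))) = 0] (mod m)"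
proof -
  define F where "F P = (B (side (-1) P) - A (arc_of P)) * h (arc_of P)" for P
  have ex: "\<exists>c. \<forall>\<^sub>F t in at_right 0. F (move P (\<kappa> * t)) = c"
    if P: "P \<in> circles D" and \<kappa>: "\<kappa> \<in> {-1, 1}" for P and \<kappa> :: real
  proof -
    obtain \<alpha> where \<alpha>: "\<alpha> \<in> Arc D" "\<forall>\<^sub>F t in at_right 0. move P (\<kappa> * t) \<in> \<alpha>"
      using half_branch_arc[OF P \<kappa>] by blast
    obtain r where r: "\<forall>\<^sub>F t in at_right 0. side (-1) (move P (\<kappa> * t)) = r"
      using half_branch_right_side[OF P \<kappa>] by blast
    have "\<forall>\<^sub>F t in at_right 0. F (move P (\<kappa> * t)) = (B r - A \<alpha>) * h \<alpha>"
      using eventually_arc_of[OF \<alpha>] r by eventually_elim (simp add: F_def)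
    then show ?thesis by blast
  qed
  define H where "H \<kappa> P = (SOME c. \<forall>\<^sub>F t in at_right 0. F (move P (\<kappa> * t)) = c)" for \<kappa> :: real and P
  have H: "\<forall>\<^sub>F t in at_right 0. F (move P (\<kappa> * t)) = H \<kappa> P" if "P \<in> circles D" "\<kappa> \<in> {-1, 1}" for P \<kappa>
    unfolding H_def by (rule someI_ex[OF ex[OF that]])
  have H_eq: "H \<kappa> P = (B r - A \<alpha>) * h \<alpha>"
    if P: "P \<in> circles D" and \<kappa>: "\<kappa> \<in> {-1, 1}"
      and \<alpha>: "\<forall>\<^sub>F t in at_right 0. arc_of (move P (\<kappa> * t)) = \<alpha>"
      and r: "\<forall>\<^sub>F t in at_right 0. side (-1) (move P (\<kappa> * t)) = r" for P \<kappa> \<alpha> r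
  proof -
    have "\<forall>\<^sub>F t in at_right (0::real). H \<kappa> P = (B r - A \<alpha>) * h \<alpha>"
      using H[OF P \<kappa>] \<alpha> r by eventually_elim (simp add: F_def)
    then show ?thesis by (rule eventually_at_right_obtain_real)
  qed
  define J where "J P = H 1 P - H (-1) P" for P
  have "(\<Sum>P\<in>doubles. J P) = 0"
    unfolding J_def
  proof (rule circle_jump_sum)
    fix P assume P: "P \<in> circles D"
    show "\<forall>\<^sub>F t in at_right 0. F (move P t) = H 1 P" using H[OF P, of 1] by simp
    show "\<forall>\<^sub>F t in at_right 0. F (move P (- t)) = H (-1) P" using H[OF P, of "-1"] by simp
  next
    fix P assume P: "simple P"
    have PC: "P \<in> circles D - under D" using P simple_circles simple_not_under by blast
    have "H \<kappa> P = (B (side (-1) P) - A (arc_of P)) * h (arc_of P)" if \<kappa>: "\<kappa> \<in> {-1, 1}" for \<kappa>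
      using PC \<kappa> by (intro H_eq at_0_halves[OF arc_of_locally_constant[OF PC] \<kappa>]
        at_0_halves[OF side_locally_constant[OF P, of "-1"] \<kappa>]) auto
    from this[of 1] this[of "-1"] show "H (-1) P = H 1 P" by simp
  qed
  also have doubles: "doubles = fst ` crossings D \<union> snd ` crossings D"
  proof (intro equalityI subsetI)
    fix P assume "P \<in> doubles"
    then obtain Q where PQ: "(P, Q) \<in> double_pairs D" by auto
    then have QP: "(Q, P) \<in> double_pairs D" using double_pairsD by blast
    show "P \<in> fst ` crossings D \<union> snd ` crossings D"
    proof (cases "P \<in> under D")
      case True
      then have "(Q, P) \<in> crossings D" using QP by (simp add: crossings_def)
      then show ?thesis by force
    next
      case False
      then have "(P, Q) \<in> crossings D" using PQ under_iff[OF PQ] by (simp add: crossings_def)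
      then show ?thesis by force
    qed
  next
    fix P assume "P \<in> fst ` crossings D \<union> snd ` crossings D"
    then consider Q where "(P, Q) \<in> crossings D" | Q where "(Q, P) \<in> crossings D" by force
    then obtain Q where "(P, Q) \<in> double_pairs D"
      using crossings_double double_pairsD(5) by cases blast+
    then show "P \<in> doubles" by force
  qed
  also have "(\<Sum>P\<in>fst ` crossings D \<union> snd ` crossings D. J P) =
      (\<Sum>P\<in>fst ` crossings D. J P) + (\<Sum>P\<in>snd ` crossings D. J P)"
  proof (rule sum.union_disjoint)
    have "finite (crossings D)"
      using finite_double_pairs by (rule finite_subset[rotated]) (auto simp: crossings_def)
    then show "finite (fst ` crossings D)" "finite (snd ` crossings D)" by simp_all
    show "fst ` crossings D \<inter> snd ` crossings D = {}" using crossings_over_under by fastforce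
  qed
  also have "(\<Sum>P\<in>fst ` crossings D. J P) = (\<Sum>(P, Q)\<in>crossings D. J P)"
    using inj_on_crossings(1) by (simp add: sum.reindex case_prod_beta')
  also have "(\<Sum>P\<in>snd ` crossings D. J P) = (\<Sum>(P, Q)\<in>crossings D. J Q)"
    using inj_on_crossings(2) by (simp add: sum.reindex case_prod_beta')
  finally have "(\<Sum>(P, Q)\<in>crossings D. J P) + (\<Sum>(P, Q)\<in>crossings D. J Q) = 0"
    by simp
  moreover have "(\<Sum>(P, Q)\<in>crossings D. - (J P + J Q)) =
      - (\<Sum>(P, Q)\<in>crossings D. J P) - (\<Sum>(P, Q)\<in>crossings D. J Q)"
    by (simp add: case_prod_beta' sum_negf sum_subtractf)
  ultimately have sum0: "(\<Sum>(P, Q)\<in>crossings D. - (J P + J Q)) = 0" by linarith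
  have "[crossing_sign D P Q *
      ((B (region_right_of_both D P Q) - A (under_arc_right D P Q)) *
       (h (under_arc_right D P Q) + h (under_arc_left D P Q) - 2 * h (over_arc D P))) = - (J P + J Q)] (mod m)"
    if PQ: "(P, Q) \<in> crossings D" for P Q
  proof -
    have PQd: "(P, Q) \<in> double_pairs D" using PQ by (rule crossings_double)
    have PC: "P \<in> circles D" and QC: "Q \<in> circles D" using double_pairsD[OF PQd] by auto
    define e where "e = frame_sign P Q"
    have e: "e \<in> {-1, 1}" "e * e = 1" using frame_sign[OF PQ] by (auto simp: e_def)
    then have e': "- e \<in> {-1, 1}" by auto
    have es: "e = sgn (Im (cnj (tangent D P) * tangent D Q))" by (simp add: e_def frame_sign_def)
    define y y' z where "y = under_arc_right D P Q" and "y' = under_arc_left D P Q" and "z = over_arc D P"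
    have one: "(1::real) \<in> {-1, 1}" "(-1::real) \<in> {-1, 1}" by auto
    \<comment> \<open>three of the four quadrants: \<open>r1\<close> lies across the under-arc \<open>y\<close> from \<open>x\<close>, and \<open>r2\<close> across the
      over-arc \<open>z\<close>\<close>
    obtain x where x: "x \<in> Region D"
      "\<And>d. (-1) * Im (cnj (tangent D P) * d) > 0 \<Longrightarrow> (-1) * Im (cnj (tangent D Q) * d) > 0 \<Longrightarrow>
         \<forall>\<^sub>F s in at_right 0. imm D P + s *\<^sub>R d \<in> x"
      "\<forall>\<^sub>F t in at_right 0. side (-1) (move P (- (-1) * e * t)) = x"
      "\<forall>\<^sub>F t in at_right 0. side (-1) (move Q (-1 * e * t)) = x"
      by (rule quadrant[OF PQd one(2) one(2) es]) blast
    have xeq: "region_right_of_both D P Q = x" using region_right_of_both_eq[OF PQ x(1,2)] by blast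
    obtain r1 where r1: "\<forall>\<^sub>F t in at_right 0. side (-1) (move P (- 1 * e * t)) = r1"
      "\<forall>\<^sub>F t in at_right 0. side 1 (move Q (-1 * e * t)) = r1"
      by (rule quadrant[OF PQd one(2) one(1) es]) blast
    obtain r2 where r2: "\<forall>\<^sub>F t in at_right 0. side 1 (move P (- (-1) * e * t)) = r2"
      "\<forall>\<^sub>F t in at_right 0. side (-1) (move Q (1 * e * t)) = r2"
      by (rule quadrant[OF PQd one(1) one(2) es]) blast
    have az: "\<forall>\<^sub>F t in at_right 0. arc_of (move P (\<kappa> * t)) = z" if "\<kappa> \<in> {-1, 1}" for \<kappa>
      unfolding z_def over_arc_eq[OF PQ]
      by (rule at_0_halves[OF arc_of_locally_constant[OF crossings_over_under(1)[OF PQ]] that])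
    have ay: "\<forall>\<^sub>F t in at_right 0. arc_of (move Q (- e * t)) = y"
      unfolding y_def e_def by (rule eventually_arc_of[OF under_arc_right_eq[OF PQ]])
    have ay': "\<forall>\<^sub>F t in at_right 0. arc_of (move Q (e * t)) = y'"
      unfolding y'_def e_def by (rule eventually_arc_of[OF under_arc_left_eq[OF PQ]])
    have HP: "H e P = (B x - A z) * h z"
      using x(3) by (intro H_eq[OF PC e(1) az[OF e(1)]]) simp
    have HP': "H (- e) P = (B r1 - A z) * h z"
      using r1(1) by (intro H_eq[OF PC e' az[OF e']]) simp
    have HQ: "H (- e) Q = (B x - A y) * h y"
      using x(4) by (intro H_eq[OF QC e' ay]) simp
    have HQ': "H e Q = (B r2 - A y') * h y'"
      using r2(2) by (intro H_eq[OF QC e(1) ay']) simp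
    have simpleQ: "\<forall>\<^sub>F t in at_right 0. simple (move Q (- e * t))"
      by (rule at_0_halves[OF eventually_move_simple[OF QC] e'])
    have "\<forall>\<^sub>F t in at_right (0::real). [B r1 = 2 * A y - B x] (mod m)"
      using simpleQ r1(2) x(4) ay
    proof eventually_elim
      case (elim t)
      show ?case using shadow[OF elim(1)] elim(2-4) by simp
    qed
    then have Br1: "[B r1 = 2 * A y - B x] (mod m)" by (rule eventually_at_right_obtain_real)
    have simpleP: "\<forall>\<^sub>F t in at_right 0. simple (move P (e * t))"
      by (rule at_0_halves[OF eventually_move_simple[OF PC] e(1)])
    have "\<forall>\<^sub>F t in at_right (0::real). [B r2 = 2 * A z - B x] (mod m)"
      using simpleP r2(1) x(3) az[OF e(1)]
    proof eventually_elim
      case (elim t)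
      show ?case using shadow[OF elim(1)] elim(2-4) by simp
    qed
    then have Br2: "[B r2 = 2 * A z - B x] (mod m)" by (rule eventually_at_right_obtain_real)
    have Ay': "[A y' = 2 * A z - A y] (mod m)"
      using color[OF PQ] by (simp add: y_def y'_def z_def)
    obtain i where i: "B r1 = 2 * A y - B x + m * i" using Br1 by (metis cong_iff_lin cong_sym)
    obtain j where j: "B r2 = 2 * A z - B x + m * j" using Br2 by (metis cong_iff_lin cong_sym)
    obtain l where l: "A y' = 2 * A z - A y + m * l" using Ay' by (metis cong_iff_lin cong_sym)
    \<comment> \<open>the half-branch in the direction \<open>e\<close> leaves the crossing if \<open>e = 1\<close> and enters it if \<open>e = -1\<close>\<close>
    have sum_e: "- (J P + J Q) = crossing_sign D P Q * (H (- e) P - H e P + (H (- e) Q - H e Q))"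
    proof -
      have "of_int (crossing_sign D P Q) = e" using frame_sign(2)[OF PQ] by (simp add: e_def)
      then have "crossing_sign D P Q = 1 \<and> e = 1 \<or> crossing_sign D P Q = -1 \<and> e = -1"
        by (auto simp: crossing_sign_def split: if_splits)
      then show ?thesis by (auto simp: J_def)
    qed
    have "H (- e) P - H e P + (H (- e) Q - H e Q) =
        (B x - A y) * (h y + h y' - 2 * h z) + m * (i * h z - (j - l) * h y')"
      unfolding HP HP' HQ HQ' i j l by (simp add: algebra_simps)
    then have "[(B x - A y) * (h y + h y' - 2 * h z) = H (- e) P - H e P + (H (- e) Q - H e Q)] (mod m)"
      by (simp add: cong_iff_lin)
    then show ?thesis
      unfolding sum_e xeq y_def[symmetric] y'_def[symmetric] z_def[symmetric] by (rule cong_scalar_left)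
  qed
  then have "[(\<Sum>(P, Q)\<in>crossings D. crossing_sign D P Q *
      ((B (region_right_of_both D P Q) - A (under_arc_right D P Q)) *
       (h (under_arc_right D P Q) + h (under_arc_left D P Q) - 2 * h (over_arc D P)))) =
      (\<Sum>(P, Q)\<in>crossings D. - (J P + J Q))] (mod m)"
    by (intro cong_sum) auto
  then show ?thesis unfolding sum0 .
qed

end


section \<open>Mochizuki's cocycle modulo p\<close>

lemmas cong_iff_mod = unique_euclidean_semiring_class.cong_def

lemma fermat_int:
  fixes y :: int
  assumes "prime p"
  shows "[y ^ p = y] (mod int p)"
proof (cases "int p dvd y")
  case True
  then have "int p dvd y ^ p" using assms by (simp add: dvd_power prime_gt_0_nat dvd_trans)
  with True have "[y ^ p = 0] (mod int p)" "[0 = y] (mod int p)"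
    by (simp_all only: cong_0_iff cong_sym_eq[of 0 y])
  then show ?thesis by (rule cong_trans)
next
  case False
  have p: "prime (int p)" using assms by simp
  then have cop: "coprime y (int p)" using False by (metis prime_imp_coprime coprime_commute)
  define n where "n = nat (y mod int p)"
  have pos: "int p > 0" using assms prime_gt_0_nat by simp
  have n: "int n = y mod int p" using pos by (simp add: n_def)
  have "\<not> p dvd n"
  proof
    assume "p dvd n"
    then have "int p dvd int n" by simp
    then show False using False by (simp add: n dvd_mod_iff)
  qed
  then have "[n ^ (p - 1) = 1] (mod p)" by (rule fermat_theorem[OF assms])
  then have "[int (n ^ (p - 1)) = int 1] (mod int p)" by (simp only: cong_int_iff)
  then have "[int n ^ (p - 1) = 1] (mod int p)" by simp
  moreover have ny: "[int n = y] (mod int p)" by (simp add: n cong_iff_mod)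
  ultimately have "[y ^ (p - 1) = 1] (mod int p)" by (meson cong_pow cong_sym cong_trans)
  then have "[y ^ (p - 1) * y = 1 * y] (mod int p)" by (rule cong_scalar_right)
  moreover have "y ^ (p - 1) * y = y ^ p"
    using assms prime_gt_0_nat by (metis power_minus_mult)
  ultimately show ?thesis by simp
qed

text \<open>\<open>x\<^sup>p - y\<^sup>p = (x - y) * (\<Sum>i. x\<^sup>i * y\<^sup>p\<^sup>-\<^sup>1\<^sup>-\<^sup>i)\<close>, and both factors are divisible by \<open>p\<close>.\<close>

lemma power_p_cong:
  fixes x y :: int
  assumes "[x = y] (mod int p)"
  shows "[x ^ p = y ^ p] (mod (int p * int p))"
proof -
  have 1: "int p dvd x - y" using assms by (simp add: cong_iff_dvd_diff)
  have "[(\<Sum>i<p. y ^ (p - Suc i) * x ^ i) = (\<Sum>i<p. y ^ (p - 1))] (mod int p)"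
  proof (rule cong_sum)
    fix i assume i: "i \<in> {..<p}"
    have "[y ^ (p - Suc i) * x ^ i = y ^ (p - Suc i) * y ^ i] (mod int p)"
      by (intro cong_scalar_left cong_pow assms)
    moreover have "y ^ (p - Suc i) * y ^ i = y ^ (p - 1)"
      using i by (simp flip: power_add)
    ultimately show "[y ^ (p - Suc i) * x ^ i = y ^ (p - 1)] (mod int p)" by simp
  qed
  moreover have "[(\<Sum>i<p. y ^ (p - 1)) = 0] (mod int p)" by (simp add: cong_0_iff)
  ultimately have "[(\<Sum>i<p. y ^ (p - Suc i) * x ^ i) = 0] (mod int p)" by (rule cong_trans)
  then have "int p dvd (\<Sum>i<p. y ^ (p - Suc i) * x ^ i)" by (simp add: cong_0_iff)
  with 1 have "int p * int p dvd (x - y) * (\<Sum>i<p. y ^ (p - Suc i) * x ^ i)"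
    by (rule mult_dvd_mono)
  then show ?thesis
    by (simp add: cong_iff_dvd_diff power_diff_sumr2)
qed

lemma cong_cancel_p:
  fixes a b :: int
  assumes "0 < p" and "[int p * a = int p * b] (mod (int p * int p))"
  shows "[a = b] (mod int p)"
proof -
  have "int p * int p dvd int p * (a - b)"
    using assms(2) by (simp add: cong_iff_dvd_diff right_diff_distrib)
  then show ?thesis using assms(1) by (simp add: cong_iff_dvd_diff)
qed

text \<open>The second factor of Mochizuki's cocycle, before reduction.\<close>

definition fermat_gap :: "nat \<Rightarrow> int \<Rightarrow> int \<Rightarrow> int" where
  "fermat_gap p y z = (y ^ p + (2 * z - y) ^ p - 2 * z ^ p) div int p"

lemma mochizuki_fermat_gap: "mochizuki_cocycle p x y z = ((x - y) * fermat_gap p y z) mod int p"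
  by (simp add: mochizuki_cocycle_def fermat_gap_def)

context
  fixes p :: nat
  assumes p: "prime p"
begin

lemma p_pos: "0 < p"
  using p prime_gt_0_nat by blast

lemma p_fermat_gap: "int p * fermat_gap p y z = y ^ p + (2 * z - y) ^ p - 2 * z ^ p"
proof -
  have "[y ^ p + (2 * z - y) ^ p - 2 * z ^ p = y + (2 * z - y) - 2 * z] (mod int p)"
    by (intro cong_add cong_diff cong_scalar_left fermat_int p)
  then have "int p dvd y ^ p + (2 * z - y) ^ p - 2 * z ^ p" by (simp add: cong_0_iff)
  then show ?thesis by (simp add: fermat_gap_def)
qed

lemma fermat_gap_power:
  assumes "[y' = 2 * z - y] (mod int p)"
  shows "[int p * fermat_gap p y z = y ^ p + y' ^ p - 2 * z ^ p] (mod (int p * int p))"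
  unfolding p_fermat_gap
  by (intro cong_add cong_diff cong_refl power_p_cong cong_sym[OF assms])

lemma fermat_gap_cong:
  assumes "[y = y'] (mod int p)" "[z = z'] (mod int p)"
  shows "[fermat_gap p y z = fermat_gap p y' z'] (mod int p)"
proof (rule cong_cancel_p[OF p_pos])
  show "[int p * fermat_gap p y z = int p * fermat_gap p y' z'] (mod (int p * int p))"
    unfolding p_fermat_gap
    by (intro cong_add cong_diff cong_scalar_left power_p_cong assms)
qed

lemma fermat_gap_scale: "fermat_gap p (k * y) (k * z) = k ^ p * fermat_gap p y z"
proof -
  have e: "2 * (k * z) - k * y = k * (2 * z - y)" by (simp add: algebra_simps)
  have "int p * fermat_gap p (k * y) (k * z) = int p * (k ^ p * fermat_gap p y z)"
    unfolding p_fermat_gap e power_mult_distrib mult.left_commute[of "int p"]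
    by (simp add: algebra_simps)
  then show ?thesis using p_pos by simp
qed

definition translation_gap :: "int \<Rightarrow> int \<Rightarrow> int" where
  "translation_gap b n = ((n + b) ^ p - n ^ p - b ^ p) div int p"

lemma p_translation_gap: "int p * translation_gap b n = (n + b) ^ p - n ^ p - b ^ p"
proof -
  have "[(n + b) ^ p - n ^ p - b ^ p = (n + b) - n - b] (mod int p)"
    by (intro cong_diff fermat_int p)
  then have "int p dvd (n + b) ^ p - n ^ p - b ^ p" by (simp add: cong_0_iff)
  then show ?thesis by (simp add: translation_gap_def)
qed

text \<open>A translation changes the second factor of the cocycle by a second difference.\<close>

lemma fermat_gap_translate:
  assumes y': "[y' = 2 * z - y] (mod int p)"
  shows "[fermat_gap p (y + b) (z + b) = fermat_gap p y z +
    (translation_gap b y + translation_gap b y' - 2 * translation_gap b z)] (mod int p)"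
proof -
  have e: "2 * (z + b) - (y + b) = (2 * z - y) + b" by simp
  have "int p * fermat_gap p (y + b) (z + b) = int p * fermat_gap p y z +
    (int p * translation_gap b y + int p * translation_gap b (2 * z - y) - 2 * (int p * translation_gap b z))"
    unfolding p_fermat_gap p_translation_gap e by (simp add: algebra_simps)
  then have "int p * fermat_gap p (y + b) (z + b) = int p * (fermat_gap p y z +
    (translation_gap b y + translation_gap b (2 * z - y) - 2 * translation_gap b z))"
    by (simp add: algebra_simps)
  then have 1: "fermat_gap p (y + b) (z + b) = fermat_gap p y z +
    (translation_gap b y + translation_gap b (2 * z - y) - 2 * translation_gap b z)"
    using p_pos by simp
  have "[translation_gap b (2 * z - y) = translation_gap b y'] (mod int p)"
  proof (rule cong_cancel_p[OF p_pos])
    show "[int p * translation_gap b (2 * z - y) = int p * translation_gap b y'] (mod (int p * int p))"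
      unfolding p_translation_gap
      by (intro cong_diff cong_refl power_p_cong cong_add cong_sym[OF y'])
  qed
  then show ?thesis unfolding 1 by (intro cong_add cong_diff cong_refl)
qed

text \<open>Since \<open>x\<close> and \<open>x + 1\<close> have the product \<open>x + 2\<close>, the values of an endomorphism form an arithmetic
  progression.\<close>

lemma End_R_affine:
  assumes f: "f \<in> End_R p" and p2: "2 \<le> p"
  shows "x \<in> R p \<Longrightarrow> f x = ((f 1 - f 0) * x + f 0) mod int p"
proof -
  have fR: "f x \<in> R p" if "x \<in> R p" for x using f that by (auto simp: End_R_def)
  have op: "f (quandle_op p x y) = quandle_op p (f x) (f y)" if "x \<in> R p" "y \<in> R p" for x y
    using f that by (auto simp: End_R_def)
  have mR: "z mod int p \<in> R p" for z using p_pos by (simp add: R_def)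
  have nat: "[f (int n mod int p) = (f 1 - f 0) * int n + f 0] (mod int p)" for n
  proof (induction n rule: less_induct)
    case (less n)
    consider "n = 0" | "n = 1" | m where "n = Suc (Suc m)" by (metis One_nat_def not0_implies_Suc)
    then show ?case
    proof cases
      case 3
      have "[2 * (int (Suc m) mod int p) - int m mod int p = 2 * int (Suc m) - int m] (mod int p)"
        by (intro cong_diff cong_scalar_left) simp_all
      then have "quandle_op p (int m mod int p) (int (Suc m) mod int p) = int n mod int p"
        unfolding quandle_op_def cong_iff_mod by (simp add: 3 add.commute)
      then have "f (int n mod int p) = f (quandle_op p (int m mod int p) (int (Suc m) mod int p))"
        by (simp only:)
      also have "\<dots> = quandle_op p (f (int m mod int p)) (f (int (Suc m) mod int p))"
        by (intro op mR)
      finally have "[f (int n mod int p) = 2 * f (int (Suc m) mod int p) - f (int m mod int p)] (mod int p)"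
        by (simp add: quandle_op_def cong_iff_mod)
      also have "[2 * f (int (Suc m) mod int p) - f (int m mod int p) =
          2 * ((f 1 - f 0) * int (Suc m) + f 0) - ((f 1 - f 0) * int m + f 0)] (mod int p)"
        using 3 by (intro cong_diff cong_scalar_left less.IH) auto
      also have "2 * ((f 1 - f 0) * int (Suc m) + f 0) - ((f 1 - f 0) * int m + f 0) = (f 1 - f 0) * int n + f 0"
        by (simp add: 3 algebra_simps)
      finally show ?thesis .
    qed (use p2 in simp_all)
  qed
  assume x: "x \<in> R p"
  have "int (nat x) mod int p = x" using x by (simp add: R_def)
  then have "[f x = (f 1 - f 0) * x + f 0] (mod int p)" using nat[of "nat x"] x by (simp add: R_def)
  then show ?thesis using fR[OF x] by (simp add: cong_iff_mod R_def)
qed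

end


section \<open>Equivariant bijections between free actions\<close>

locale free_action =
  fixes G :: "'g set" and mul :: "'g \<Rightarrow> 'g \<Rightarrow> 'g" and e :: 'g
    and act :: "'g \<Rightarrow> 'v \<Rightarrow> 'v" and N :: "'v set"
  assumes act_closed: "g \<in> G \<Longrightarrow> v \<in> N \<Longrightarrow> act g v \<in> N"
    and mul_closed: "g \<in> G \<Longrightarrow> h \<in> G \<Longrightarrow> mul g h \<in> G"
    and act_mul: "g \<in> G \<Longrightarrow> h \<in> G \<Longrightarrow> v \<in> N \<Longrightarrow> act g (act h v) = act (mul g h) v"
    and unit: "e \<in> G" "v \<in> N \<Longrightarrow> act e v = v"
    and inverse: "g \<in> G \<Longrightarrow> \<exists>h\<in>G. mul h g = e"
    and free: "v \<in> N \<Longrightarrow> inj_on (\<lambda>g. act g v) G"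
begin

definition orbit :: "'v \<Rightarrow> 'v set" where
  "orbit v = (\<lambda>g. act g v) ` G"

lemma orbit_act: "g \<in> G \<Longrightarrow> v \<in> N \<Longrightarrow> w \<in> orbit v \<Longrightarrow> act g w \<in> orbit v"
  using mul_closed by (auto simp: orbit_def act_mul)

lemma orbit_act_iff:
  assumes g: "g \<in> G" and v: "v \<in> N" and w: "w \<in> N"
  shows "act g w \<in> orbit v \<longleftrightarrow> w \<in> orbit v"
proof
  assume gw: "act g w \<in> orbit v"
  obtain h where h: "h \<in> G" "mul h g = e" using inverse[OF g] by blast
  then have "act h (act g w) = w" using g w by (simp add: act_mul unit)
  then show "w \<in> orbit v" using orbit_act[OF h(1) v gw] by simp
qed (rule orbit_act[OF g v])

lemma free_action_diff_orbit:
  assumes "v \<in> N"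
  shows "free_action G mul e act (N - orbit v)"
  by unfold_locales
    (use act_closed mul_closed act_mul unit inverse free orbit_act_iff[OF _ assms] in auto)

lemma image_mset_orbit:
  assumes "v \<in> N" and "\<And>g. g \<in> G \<Longrightarrow> \<rho> (act g v) = \<tau> g (\<rho> v)"
  shows "image_mset \<rho> (mset_set (orbit v)) = image_mset (\<lambda>g. \<tau> g (\<rho> v)) (mset_set G)"
proof (cases "finite G")
  case True
  have "image_mset \<rho> (mset_set (orbit v)) = image_mset (\<rho> \<circ> (\<lambda>g. act g v)) (mset_set G)"
    unfolding orbit_def by (simp add: image_mset_mset_set[OF free[OF assms(1)], symmetric] multiset.map_comp)
  also have "\<dots> = image_mset (\<lambda>g. \<tau> g (\<rho> v)) (mset_set G)"
    using assms(2) True by (intro image_mset_cong) simp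
  finally show ?thesis .
next
  case False
  then have "infinite (orbit v)"
    unfolding orbit_def using free[OF assms(1)] finite_imageD by blast
  with False show ?thesis by simp
qed

end

text \<open>
  Two finite free actions of one group with labellings that transform by the same rule. If the
  multisets of labels agree, some point of the second set carries the label of a chosen point of
  the first; matching their orbits leaves equal multisets on the rest.
\<close>

lemma equivariant_bijection:
  assumes "free_action G mul e act N" and "free_action G mul e act' N'"
    and "finite N" and "finite N'"
    and "\<And>g v. g \<in> G \<Longrightarrow> v \<in> N \<Longrightarrow> \<rho> (act g v) = \<tau> g (\<rho> v)"
    and "\<And>g v. g \<in> G \<Longrightarrow> v \<in> N' \<Longrightarrow> \<rho>' (act' g v) = \<tau> g (\<rho>' v)"
    and "image_mset \<rho> (mset_set N) = image_mset \<rho>' (mset_set N')"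
  shows "\<exists>\<phi>. bij_betw \<phi> N N' \<and> (\<forall>v\<in>N. \<rho>' (\<phi> v) = \<rho> v) \<and> (\<forall>g\<in>G. \<forall>v\<in>N. \<phi> (act g v) = act' g (\<phi> v))"
  using assms
proof (induction "card N" arbitrary: N N' rule: less_induct)
  case less
  interpret A: free_action G mul e act N by (rule less.prems)
  interpret A': free_action G mul e act' N' by (rule less.prems)
  note fin = less.prems(3,4) and \<rho> = less.prems(5) and \<rho>' = less.prems(6) and eq = less.prems(7)
  show ?case
  proof (cases "N = {}")
    case True
    with eq have "mset_set N' = {#}" by simp
    then have "N' = {}" using fin by (simp add: mset_set_empty_iff)
    with True show ?thesis by (auto simp: bij_betw_def)
  next
    case False
    then obtain v where v: "v \<in> N" by blast
    have "\<rho> v \<in># image_mset \<rho> (mset_set N)" using v fin by simp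
    then have "\<rho> v \<in># image_mset \<rho>' (mset_set N')" using eq by simp
    then obtain v' where v': "v' \<in> N'" "\<rho>' v' = \<rho> v" using fin by auto
    define X where "X = A.orbit v"
    define X' where "X' = A'.orbit v'"
    have XN: "X \<subseteq> N" "X' \<subseteq> N'"
      using v v' A.act_closed A'.act_closed by (auto simp: X_def X'_def A.orbit_def A'.orbit_def)
    have vX: "v \<in> X" using A.unit v by (force simp: X_def A.orbit_def)
    have split: "mset_set N = mset_set X + mset_set (N - X)" "mset_set N' = mset_set X' + mset_set (N' - X')"
      using XN fin by (simp_all add: mset_set_Diff subset_imp_msubset_mset_set finite_subset)
    have "image_mset \<rho> (mset_set X) = image_mset \<rho>' (mset_set X')"
      unfolding X_def X'_def
      using A.image_mset_orbit[of v \<rho> \<tau>] A'.image_mset_orbit[of v' \<rho>' \<tau>] v v' \<rho> \<rho>' by simp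
    then have eq': "image_mset \<rho> (mset_set (N - X)) = image_mset \<rho>' (mset_set (N' - X'))"
      using eq unfolding split by simp
    have "card (N - X) < card N"
      using vX v fin(1) by (intro psubset_card_mono) auto
    from less.hyps[OF this A.free_action_diff_orbit[OF v, folded X_def]
        A'.free_action_diff_orbit[OF v'(1), folded X'_def] _ _ _ _ eq']
    obtain \<phi> where \<phi>: "bij_betw \<phi> (N - X) (N' - X')" "\<And>w. w \<in> N - X \<Longrightarrow> \<rho>' (\<phi> w) = \<rho> w"
      "\<And>g w. g \<in> G \<Longrightarrow> w \<in> N - X \<Longrightarrow> \<phi> (act g w) = act' g (\<phi> w)"
      using fin \<rho> \<rho>' by auto
    define \<psi> where "\<psi> w = act' (inv_into G (\<lambda>g. act g v) w) v'" for w
    have \<psi>: "\<psi> (act g v) = act' g v'" if "g \<in> G" for g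
      using inv_into_f_f[OF A.free[OF v] that] by (simp add: \<psi>_def)
    define \<Phi> where "\<Phi> w = (if w \<in> X then \<psi> w else \<phi> w)" for w
    have bX: "bij_betw \<psi> X X'"
    proof (rule bij_betw_imageI)
      have "inj_on (\<psi> \<circ> (\<lambda>g. act g v)) G"
        using A'.free[OF v'(1)] by (rule inj_on_cong[THEN iffD1, rotated]) (simp add: \<psi>)
      then show "inj_on \<psi> X" unfolding X_def A.orbit_def by (rule inj_on_imageI)
      show "\<psi> ` X = X'"
        unfolding X_def X'_def A.orbit_def A'.orbit_def image_image by (intro image_cong) (simp_all add: \<psi>)
    qed
    have "bij_betw \<Phi> (X \<union> (N - X)) (X' \<union> (N' - X'))"
    proof (rule bij_betw_combine)
      show "bij_betw \<Phi> X X'" using bX by (rule bij_betw_cong[THEN iffD1, rotated]) (simp add: \<Phi>_def)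
      show "bij_betw \<Phi> (N - X) (N' - X')"
        using \<phi>(1) by (rule bij_betw_cong[THEN iffD1, rotated]) (simp add: \<Phi>_def)
    qed auto
    then have "bij_betw \<Phi> N N'" using XN by (simp add: Un_absorb1)
    moreover have "\<rho>' (\<Phi> w) = \<rho> w" if w: "w \<in> N" for w
    proof (cases "w \<in> X")
      case True
      then obtain g where g: "g \<in> G" "w = act g v" by (auto simp: X_def A.orbit_def)
      then have "\<Phi> w = act' g v'" using True \<psi> by (simp add: \<Phi>_def)
      then show ?thesis using \<rho>[OF g(1) v] \<rho>'[OF g(1) v'(1)] v'(2) g(2) by simp
    qed (use w \<phi>(2) in \<open>simp add: \<Phi>_def\<close>)
    moreover have "\<Phi> (act g w) = act' g (\<Phi> w)" if g: "g \<in> G" and w: "w \<in> N" for g w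
    proof (cases "w \<in> X")
      case True
      then obtain h where h: "h \<in> G" "w = act h v" by (auto simp: X_def A.orbit_def)
      have gw: "act g w = act (mul g h) v" using A.act_mul[OF g h(1) v] h(2) by simp
      have "act g w \<in> X" using A.orbit_act[OF g v] True by (simp add: X_def)
      then have "\<Phi> (act g w) = act' (mul g h) v'"
        using \<psi>[OF A.mul_closed[OF g h(1)]] gw by (simp add: \<Phi>_def)
      also have "\<dots> = act' g (act' h v')" using A'.act_mul[OF g h(1) v'(1)] by simp
      also have "act' h v' = \<Phi> w" using True \<psi>[OF h(1)] h(2) by (simp add: \<Phi>_def)
      finally show ?thesis .
    next
      case False
      then have "act g w \<notin> X" using A.orbit_act_iff[OF g v w] by (simp add: X_def)
      then show ?thesis using False \<phi>(3)[OF g, of w] w by (simp add: \<Phi>_def)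
    qed
    ultimately show ?thesis by blast
  qed
qed


section \<open>The total weight of a shadow coloring\<close>

lemma R_cong_eq: "x \<in> R p \<Longrightarrow> y \<in> R p \<Longrightarrow> [x = y] (mod int p) \<Longrightarrow> x = y"
  by (simp add: R_def cong_iff_mod)

lemma mod_in_R: "0 < p \<Longrightarrow> x mod int p \<in> R p"
  by (simp add: R_def)

lemma affine_mod_right: "(k * (x mod m) + b) mod m = (k * x + b) mod (m::int)"
  by (metis mod_add_left_eq mod_mult_right_eq)

lemma affine_mod_left: "((k mod m) * x + b mod m) mod m = (k * x + b) mod (m::int)"
proof -
  have "[(k mod m) * x + b mod m = k * x + b] (mod m)"
    by (intro cong_add cong_scalar_right) simp_all
  then show ?thesis unfolding cong_iff_mod .
qed

lemma quandle_op_eq_iff: "z \<in> R p \<Longrightarrow> quandle_op p x y = z \<longleftrightarrow> [z = 2 * y - x] (mod int p)"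
  by (auto simp: R_def cong_iff_mod quandle_op_def)

context link
begin

lemma region_right_of_both_Region:
  assumes PQ: "(P, Q) \<in> crossings D"
  shows "region_right_of_both D P Q \<in> Region D"
proof -
  have one: "(-1::real) \<in> {-1, 1}" by auto
  obtain x where "x \<in> Region D"
    "\<And>d. (-1) * Im (cnj (tangent D P) * d) > 0 \<Longrightarrow> (-1) * Im (cnj (tangent D Q) * d) > 0 \<Longrightarrow>
       \<forall>\<^sub>F s in at_right 0. imm D P + s *\<^sub>R d \<in> x"
    by (rule quadrant[OF crossings_double[OF PQ] one one refl]) blast
  then show ?thesis using region_right_of_both_eq[OF PQ] by metis
qed

lemma over_arc_Arc: "(P, Q) \<in> crossings D \<Longrightarrow> over_arc D P \<in> Arc D"
  using over_arc_eq crossings_over_under(1) arc_of_Arc(1) by metis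

text \<open>Shadow colorings by integers up to congruence, so that sums and multiples of colorings can be
  formed before reduction.\<close>

definition shadow_mod :: "int \<Rightarrow> ((nat \<times> complex) set \<Rightarrow> int) \<Rightarrow> (complex set \<Rightarrow> int) \<Rightarrow> bool" where
  "shadow_mod m A B \<longleftrightarrow>
     (\<forall>P. simple P \<longrightarrow> [B (side 1 P) = 2 * A (arc_of P) - B (side (-1) P)] (mod m)) \<and>
     (\<forall>P Q. (P, Q) \<in> crossings D \<longrightarrow>
        [A (under_arc_left D P Q) = 2 * A (over_arc D P) - A (under_arc_right D P Q)] (mod m))"

lemma shadow_modD:
  assumes "shadow_mod m A B"
  shows "simple P \<Longrightarrow> [B (side 1 P) = 2 * A (arc_of P) - B (side (-1) P)] (mod m)"
    "(P, Q) \<in> crossings D \<Longrightarrow>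
        [A (under_arc_left D P Q) = 2 * A (over_arc D P) - A (under_arc_right D P Q)] (mod m)"
  using assms unfolding shadow_mod_def by blast+

definition total_weight :: "nat \<Rightarrow> ((nat \<times> complex) set \<Rightarrow> int) \<Rightarrow> (complex set \<Rightarrow> int) \<Rightarrow> int" where
  "total_weight p A B = (\<Sum>(P, Q)\<in>crossings D. crossing_sign D P Q *
     ((B (region_right_of_both D P Q) - A (under_arc_right D P Q)) *
      fermat_gap p (A (under_arc_right D P Q)) (A (over_arc D P))))"

lemma shadow_weight_total:
  "[shadow_weight p D c = total_weight p (c \<circ> Inl) (c \<circ> Inr)] (mod int p)"
proof -
  have "[shadow_weight p D c = (\<Sum>(P, Q)\<in>crossings D. weight p D c P Q)] (mod int p)"
    by (simp add: shadow_weight_def)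
  also have "[(\<Sum>(P, Q)\<in>crossings D. weight p D c P Q) = total_weight p (c \<circ> Inl) (c \<circ> Inr)] (mod int p)"
    unfolding total_weight_def weight_def mochizuki_fermat_gap
    by (rule cong_sum) (auto intro!: cong_scalar_left)
  finally show ?thesis .
qed

lemma total_weight_cong:
  assumes p: "prime p" and A: "\<And>\<alpha>. \<alpha> \<in> Arc D \<Longrightarrow> [A \<alpha> = A' \<alpha>] (mod int p)"
    and B: "\<And>r. r \<in> Region D \<Longrightarrow> [B r = B' r] (mod int p)"
  shows "[total_weight p A B = total_weight p A' B'] (mod int p)"
  unfolding total_weight_def
  by (rule cong_sum)
    (auto intro!: cong_mult cong_diff cong_refl fermat_gap_cong[OF p] A B
      under_arc_right_eq over_arc_Arc region_right_of_both_Region)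

lemma total_weight_scale:
  assumes p: "prime p"
  shows "[total_weight p (\<lambda>\<alpha>. k * A \<alpha>) (\<lambda>r. k * B r) = k\<^sup>2 * total_weight p A B] (mod int p)"
proof -
  have "total_weight p (\<lambda>\<alpha>. k * A \<alpha>) (\<lambda>r. k * B r) = (k * k ^ p) * total_weight p A B"
    unfolding total_weight_def sum_distrib_left fermat_gap_scale[OF p]
    by (rule sum.cong) (auto simp: algebra_simps)
  moreover have "[k * k ^ p = k * k] (mod int p)"
    by (intro cong_scalar_left fermat_int p)
  ultimately show ?thesis by (simp add: power2_eq_square cong_scalar_right)
qed

lemma total_weight_translate:
  assumes p: "prime p" and AB: "shadow_mod (int p) A B"
  shows "[total_weight p (\<lambda>\<alpha>. A \<alpha> + b) (\<lambda>r. B r + b) = total_weight p A B] (mod int p)"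
proof -
  let ?h = "\<lambda>\<alpha>. translation_gap p b (A \<alpha>)"
  note sh = shadow_modD(1)[OF AB] and co = shadow_modD(2)[OF AB]
  let ?E = "\<lambda>P Q. crossing_sign D P Q * ((B (region_right_of_both D P Q) - A (under_arc_right D P Q)) *
       (?h (under_arc_right D P Q) + ?h (under_arc_left D P Q) - 2 * ?h (over_arc D P)))"
  have "[total_weight p (\<lambda>\<alpha>. A \<alpha> + b) (\<lambda>r. B r + b) =
      (\<Sum>(P, Q)\<in>crossings D. crossing_sign D P Q *
        ((B (region_right_of_both D P Q) - A (under_arc_right D P Q)) *
         (fermat_gap p (A (under_arc_right D P Q)) (A (over_arc D P)) +
          (?h (under_arc_right D P Q) + ?h (under_arc_left D P Q) - 2 * ?h (over_arc D P)))))] (mod int p)"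
    unfolding total_weight_def
    by (rule cong_sum) (auto intro!: cong_scalar_left fermat_gap_translate[OF p] co)
  also have "(\<Sum>(P, Q)\<in>crossings D. crossing_sign D P Q *
        ((B (region_right_of_both D P Q) - A (under_arc_right D P Q)) *
         (fermat_gap p (A (under_arc_right D P Q)) (A (over_arc D P)) +
          (?h (under_arc_right D P Q) + ?h (under_arc_left D P Q) - 2 * ?h (over_arc D P))))) =
      total_weight p A B + (\<Sum>(P, Q)\<in>crossings D. ?E P Q)"
    unfolding total_weight_def sum.distrib[symmetric]
    by (rule sum.cong) (auto simp: algebra_simps)
  also have "[total_weight p A B + (\<Sum>(P, Q)\<in>crossings D. ?E P Q) = total_weight p A B + 0] (mod int p)"
    by (intro cong_add cong_refl crossing_sum[OF sh co])
  finally show ?thesis by simp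
qed

text \<open>
  The checkerboard sign is a shadow coloring over the integers whose arcs all carry 0, so the jump
  sum may be used modulo \<open>p\<^sup>2\<close>, with \<open>h\<close> the \<open>p\<close>-th power of the arc color.
\<close>

lemma total_weight_shift:
  assumes p: "prime p" and co: "\<And>P Q. (P, Q) \<in> crossings D \<Longrightarrow>
      [A (under_arc_left D P Q) = 2 * A (over_arc D P) - A (under_arc_right D P Q)] (mod int p)"
  shows "[total_weight p A (\<lambda>r. B r + t * checker r) = total_weight p A B] (mod int p)"
proof -
  let ?h = "\<lambda>\<alpha>. A \<alpha> ^ p"
  define W where "W = (\<Sum>(P, Q)\<in>crossings D. crossing_sign D P Q *
     (checker (region_right_of_both D P Q) * fermat_gap p (A (under_arc_right D P Q)) (A (over_arc D P))))"
  have "int p * W = (\<Sum>(P, Q)\<in>crossings D. crossing_sign D P Q *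
     (checker (region_right_of_both D P Q) * (int p * fermat_gap p (A (under_arc_right D P Q)) (A (over_arc D P)))))"
    unfolding W_def sum_distrib_left by (rule sum.cong) (auto simp: algebra_simps)
  also have "[\<dots> = (\<Sum>(P, Q)\<in>crossings D. crossing_sign D P Q *
     ((checker (region_right_of_both D P Q) - 0) *
       (?h (under_arc_right D P Q) + ?h (under_arc_left D P Q) - 2 * ?h (over_arc D P))))] (mod (int p * int p))"
    unfolding diff_zero
    by (rule cong_sum) (auto intro!: cong_scalar_left fermat_gap_power[OF p] co)
  also have "[(\<Sum>(P, Q)\<in>crossings D. crossing_sign D P Q *
     ((checker (region_right_of_both D P Q) - 0) *
       (?h (under_arc_right D P Q) + ?h (under_arc_left D P Q) - 2 * ?h (over_arc D P)))) = 0] (mod (int p * int p))"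
    by (rule crossing_sum[where A = "\<lambda>_. 0"]) (simp_all add: checker_side)
  finally have "[int p * W = int p * 0] (mod (int p * int p))" by simp
  then have "[W = 0] (mod int p)" by (rule cong_cancel_p[OF p_pos[OF p]])
  then have "[total_weight p A B + t * W = total_weight p A B + t * 0] (mod int p)"
    by (intro cong_add cong_refl cong_scalar_left)
  moreover have "total_weight p A (\<lambda>r. B r + t * checker r) = total_weight p A B + t * W"
    unfolding total_weight_def W_def sum_distrib_left sum.distrib[symmetric]
    by (rule sum.cong) (auto simp: algebra_simps)
  ultimately show ?thesis by simp
qed


section \<open>Affine maps act on shadow colorings\<close>

lemma adjacent_sides:
  assumes P: "simple P"
  shows "adjacent_along D (arc_of P) (side (-1) P) (side 1 P)"
proof -
  have PC: "P \<in> circles D - under D" using P simple_circles simple_not_under by blast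
  note pos = normal_transverse[OF DiffD1[OF PC]]
  have "\<forall>\<^sub>F s in at_right 0. imm D P - s *\<^sub>R (\<i> * tangent D P) \<in> side (-1) P"
    using eventually_side[OF P _ pos[of "-1"]] by simp
  moreover have "\<forall>\<^sub>F s in at_right 0. imm D P + s *\<^sub>R (\<i> * tangent D P) \<in> side 1 P"
    using eventually_side[OF P _ pos[of 1]] by simp
  moreover have "\<forall>Q\<in>circles D. imm D Q = imm D P \<longrightarrow> Q = P" using P by (simp add: simple_def)
  ultimately show ?thesis
    unfolding adjacent_along_def using arc_of_Arc(2)[OF PC] by blast
qed

lemma adjacent_alongE:
  assumes "adjacent_along D \<alpha> r1 r2" "\<alpha> \<in> Arc D" "r1 \<in> Region D" "r2 \<in> Region D"
  obtains P where "simple P" "\<alpha> = arc_of P" "r1 = side (-1) P" "r2 = side 1 P"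
proof -
  obtain P where P: "P \<in> \<alpha>" "\<forall>Q\<in>circles D. imm D Q = imm D P \<longrightarrow> Q = P"
    and r1: "\<forall>\<^sub>F s in at_right 0. imm D P - s *\<^sub>R (\<i> * tangent D P) \<in> r1"
    and r2: "\<forall>\<^sub>F s in at_right 0. imm D P + s *\<^sub>R (\<i> * tangent D P) \<in> r2"
    using assms(1) unfolding adjacent_along_def by blast
  have sP: "simple P" using P Arc_subset[OF assms(2)] by (auto simp: simple_def)
  note pos = normal_transverse[OF simple_circles[OF sP]]
  have "side (-1) P = r1"
    using side_eqI[OF sP _ pos[of "-1"] assms(3)] r1 by simp
  moreover have "side 1 P = r2"
    using side_eqI[OF sP _ pos[of 1] assms(4)] r2 by simp
  moreover have "arc_of P = \<alpha>" using arc_of_eqI[OF assms(2) P(1)] .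
  ultimately show thesis using that sP by blast
qed

lemma SCol_iff:
  "c \<in> SCol p D \<longleftrightarrow>
     c \<in> (Arc D <+> Region D) \<rightarrow>\<^sub>E R p \<and> shadow_mod (int p) (c \<circ> Inl) (c \<circ> Inr)"
proof (cases "c \<in> (Arc D <+> Region D) \<rightarrow>\<^sub>E R p")
  case True
  then have arc: "c (Inl \<alpha>) \<in> R p" if "\<alpha> \<in> Arc D" for \<alpha> using that by (auto simp: PiE_iff)
  have reg: "c (Inr r) \<in> R p" if "r \<in> Region D" for r using True that by (auto simp: PiE_iff)
  have "coloring p D (c \<circ> Inl) \<longleftrightarrow> (\<forall>P Q. (P, Q) \<in> crossings D \<longrightarrow>
      [(c \<circ> Inl) (under_arc_left D P Q) = 2 * (c \<circ> Inl) (over_arc D P) - (c \<circ> Inl) (under_arc_right D P Q)] (mod int p))"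
    unfolding coloring_def using arc under_arc_left_eq(1) by (auto simp: quandle_op_eq_iff)
  moreover have "(\<forall>\<alpha>\<in>Arc D. \<forall>r1\<in>Region D. \<forall>r2\<in>Region D. adjacent_along D \<alpha> r1 r2 \<longrightarrow>
        quandle_op p (c (Inr r1)) (c (Inl \<alpha>)) = c (Inr r2)) \<longleftrightarrow>
      (\<forall>P. simple P \<longrightarrow> [(c \<circ> Inr) (side 1 P) = 2 * (c \<circ> Inl) (arc_of P) - (c \<circ> Inr) (side (-1) P)] (mod int p))"
    (is "?L \<longleftrightarrow> ?R")
  proof
    assume L: ?L
    show ?R
    proof (intro allI impI)
      fix P assume P: "simple P"
      then have "arc_of P \<in> Arc D" using arc_of_Arc simple_circles simple_not_under by blast
      moreover have "side (-1) P \<in> Region D" "side 1 P \<in> Region D" using side_Region[OF P] by auto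
      ultimately show "[(c \<circ> Inr) (side 1 P) = 2 * (c \<circ> Inl) (arc_of P) - (c \<circ> Inr) (side (-1) P)] (mod int p)"
        using L adjacent_sides[OF P] reg by (auto simp: quandle_op_eq_iff)
    qed
  next
    assume R: ?R
    show ?L
    proof (intro ballI impI)
      fix \<alpha> r1 r2 assume *: "\<alpha> \<in> Arc D" "r1 \<in> Region D" "r2 \<in> Region D" "adjacent_along D \<alpha> r1 r2"
      obtain P where P: "simple P" "\<alpha> = arc_of P" "r1 = side (-1) P" "r2 = side 1 P"
        using adjacent_alongE[OF *(4,1,2,3)] by blast
      show "quandle_op p (c (Inr r1)) (c (Inl \<alpha>)) = c (Inr r2)"
        using R[rule_format, OF P(1)] P(2-4) unfolding quandle_op_eq_iff[OF reg[OF *(3)]] by simp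
    qed
  qed
  ultimately show ?thesis using True unfolding SCol_def shadow_mod_def by blast
qed (auto simp: SCol_def)

lemma SCol_shadow: "c \<in> SCol p D \<Longrightarrow> shadow_mod (int p) (c \<circ> Inl) (c \<circ> Inr)"
  by (simp add: SCol_iff)

lemma SCol_values:
  assumes "c \<in> SCol p D"
  shows "\<alpha> \<in> Arc D \<Longrightarrow> c (Inl \<alpha>) \<in> R p" "r \<in> Region D \<Longrightarrow> c (Inr r) \<in> R p"
  using assms by (auto simp: SCol_iff PiE_iff)

lemma SCol_at_SCol: "c \<in> SCol_at p D a \<Longrightarrow> c \<in> SCol p D"
  by (simp add: SCol_at_def)

text \<open>The arc colors and the color at infinity determine the rest, region by region.\<close>

lemma SCol_at_eqI:
  assumes c: "c \<in> SCol_at p D a" and d: "d \<in> SCol_at p D a"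
    and arcs: "\<And>\<alpha>. \<alpha> \<in> Arc D \<Longrightarrow> c (Inl \<alpha>) = d (Inl \<alpha>)"
  shows "c = d"
proof -
  have cS: "c \<in> SCol p D" and dS: "d \<in> SCol p D" using c d by (simp_all add: SCol_at_def)
  have eq: "c (Inr r) = d (Inr r)" if r: "r \<in> Region D" for r
  proof (rule Region_propagate[of "r_infinity D" "\<lambda>r. c (Inr r) = d (Inr r)"])
    show "c (Inr (r_infinity D)) = d (Inr (r_infinity D))" using c d by (simp add: SCol_at_def)
    fix P assume P: "simple P"
    have A: "arc_of P \<in> Arc D" using P arc_of_Arc simple_circles simple_not_under by blast
    have R1: "side (-1) P \<in> Region D" "side 1 P \<in> Region D" using side_Region[OF P] by auto
    have 1: "[c (Inr (side 1 P)) = 2 * c (Inl (arc_of P)) - c (Inr (side (-1) P))] (mod int p)"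
      using shadow_modD(1)[OF SCol_shadow[OF cS] P] by (simp only: o_apply)
    have 2: "[d (Inr (side 1 P)) = 2 * c (Inl (arc_of P)) - d (Inr (side (-1) P))] (mod int p)"
      using shadow_modD(1)[OF SCol_shadow[OF dS] P] by (simp only: o_apply arcs[OF A])
    have "[c (Inr (side 1 P)) + c (Inr (side (-1) P)) = d (Inr (side 1 P)) + d (Inr (side (-1) P))] (mod int p)"
    proof -
      have "[c (Inr (side 1 P)) + c (Inr (side (-1) P)) = 2 * c (Inl (arc_of P))] (mod int p)"
        using cong_add[OF 1 cong_refl[of "c (Inr (side (-1) P))"]] by simp
      moreover have "[d (Inr (side 1 P)) + d (Inr (side (-1) P)) = 2 * c (Inl (arc_of P))] (mod int p)"
        using cong_add[OF 2 cong_refl[of "d (Inr (side (-1) P))"]] by simp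
      ultimately show ?thesis by (meson cong_sym cong_trans)
    qed
    then show "(c (Inr (side (-1) P)) = d (Inr (side (-1) P))) \<longleftrightarrow> (c (Inr (side 1 P)) = d (Inr (side 1 P)))"
      using R_cong_eq SCol_values(2)[OF cS] SCol_values(2)[OF dS] R1
      by (metis cong_add_lcancel cong_add_rcancel)
  qed (use r r_infinity_Region in auto)
  show ?thesis
  proof (rule PiE_ext)
    show "c \<in> (Arc D <+> Region D) \<rightarrow>\<^sub>E R p" "d \<in> (Arc D <+> Region D) \<rightarrow>\<^sub>E R p"
      using cS dS by (simp_all add: SCol_iff)
    show "c u = d u" if "u \<in> Arc D <+> Region D" for u using that arcs eq by auto
  qed
qed

lemma finite_SCol_at: "finite (SCol_at p D a)"
proof (rule inj_on_finite)
  show "inj_on (\<lambda>c. restrict (c \<circ> Inl) (Arc D)) (SCol_at p D a)"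
  proof (rule inj_onI)
    fix c d assume *: "c \<in> SCol_at p D a" "d \<in> SCol_at p D a"
      "restrict (c \<circ> Inl) (Arc D) = restrict (d \<circ> Inl) (Arc D)"
    have "c (Inl \<alpha>) = d (Inl \<alpha>)" if "\<alpha> \<in> Arc D" for \<alpha>
      using fun_cong[OF *(3), of \<alpha>] that by simp
    then show "c = d" by (rule SCol_at_eqI[OF *(1,2)])
  qed
  show "(\<lambda>c. restrict (c \<circ> Inl) (Arc D)) ` SCol_at p D a \<subseteq> Arc D \<rightarrow>\<^sub>E R p"
    using SCol_values(1) SCol_at_SCol by (auto simp: PiE_iff)
  show "finite (Arc D \<rightarrow>\<^sub>E R p)"
    using finite_Arc by (intro finite_PiE) (simp_all add: R_def)
qed

text \<open>
  The image of a shadow coloring under \<open>x \<mapsto> k * x + b\<close>, corrected by a multiple of the checkerboard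
  sign so that the unbounded region gets the color \<open>a\<close>.
\<close>

definition affine_recolor :: "nat \<Rightarrow> int \<Rightarrow> int \<Rightarrow> int \<Rightarrow> shadow \<Rightarrow> shadow" where
  "affine_recolor p a k b c = restrict (case_sum
     (\<lambda>\<alpha>. (k * c (Inl \<alpha>) + b) mod int p)
     (\<lambda>r. (k * c (Inr r) + b +
        (a - (k * c (Inr (r_infinity D)) + b)) * checker (r_infinity D) * checker r) mod int p))
     (Arc D <+> Region D)"

lemma affine_Inl [simp]:
  "\<alpha> \<in> Arc D \<Longrightarrow> affine_recolor p a k b c (Inl \<alpha>) = (k * c (Inl \<alpha>) + b) mod int p"
  by (simp add: affine_recolor_def InlI)

lemma affine_Inr:
  "r \<in> Region D \<Longrightarrow> affine_recolor p a k b c (Inr r) = (k * c (Inr r) + b +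
     (a - (k * c (Inr (r_infinity D)) + b)) * checker (r_infinity D) * checker r) mod int p"
  by (simp add: affine_recolor_def InrI)

lemma shadow_mod_affine:
  assumes "shadow_mod m A B"
  shows "shadow_mod m (\<lambda>\<alpha>. k * A \<alpha> + b) (\<lambda>r. k * B r + b + t * checker r)"
  unfolding shadow_mod_def
proof (intro conjI allI impI)
  fix P assume P: "simple P"
  then have "[k * B (side 1 P) + (b + t * checker (side 1 P)) =
      k * (2 * A (arc_of P) - B (side (-1) P)) + (b + t * checker (side 1 P))] (mod m)"
    by (intro cong_add cong_refl cong_scalar_left shadow_modD(1)[OF assms])
  moreover have "k * (2 * A (arc_of P) - B (side (-1) P)) + (b + t * checker (side 1 P)) =
      2 * (k * A (arc_of P) + b) - (k * B (side (-1) P) + b + t * checker (side (-1) P))"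
    using checker_side[OF P] by (simp add: algebra_simps)
  ultimately show "[k * B (side 1 P) + b + t * checker (side 1 P) =
      2 * (k * A (arc_of P) + b) - (k * B (side (-1) P) + b + t * checker (side (-1) P))] (mod m)"
    by (simp add: add.assoc)
next
  fix P Q assume "(P, Q) \<in> crossings D"
  then have "[k * A (under_arc_left D P Q) + b =
      k * (2 * A (over_arc D P) - A (under_arc_right D P Q)) + b] (mod m)"
    by (intro cong_add cong_refl cong_scalar_left shadow_modD(2)[OF assms])
  then show "[k * A (under_arc_left D P Q) + b =
      2 * (k * A (over_arc D P) + b) - (k * A (under_arc_right D P Q) + b)] (mod m)"
    by (simp add: algebra_simps)
qed

lemma shadow_mod_cong:
  assumes "shadow_mod m A B" and A: "\<And>\<alpha>. \<alpha> \<in> Arc D \<Longrightarrow> [A' \<alpha> = A \<alpha>] (mod m)"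
    and B: "\<And>r. r \<in> Region D \<Longrightarrow> [B' r = B r] (mod m)"
  shows "shadow_mod m A' B'"
  unfolding shadow_mod_def
proof (intro conjI allI impI)
  fix P assume P: "simple P"
  have a: "arc_of P \<in> Arc D" using P arc_of_Arc simple_circles simple_not_under by blast
  have r: "side (-1) P \<in> Region D" "side 1 P \<in> Region D" using side_Region[OF P] by auto
  have "[B' (side 1 P) = B (side 1 P)] (mod m)" by (rule B[OF r(2)])
  also have "[B (side 1 P) = 2 * A (arc_of P) - B (side (-1) P)] (mod m)"
    by (rule shadow_modD(1)[OF assms(1) P])
  also have "[2 * A (arc_of P) - B (side (-1) P) = 2 * A' (arc_of P) - B' (side (-1) P)] (mod m)"
    by (intro cong_diff cong_scalar_left cong_sym[OF A[OF a]] cong_sym[OF B[OF r(1)]])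
  finally show "[B' (side 1 P) = 2 * A' (arc_of P) - B' (side (-1) P)] (mod m)" .
next
  fix P Q assume PQ: "(P, Q) \<in> crossings D"
  have "[A' (under_arc_left D P Q) = A (under_arc_left D P Q)] (mod m)"
    by (rule A[OF under_arc_left_eq(1)[OF PQ]])
  also have "[A (under_arc_left D P Q) = 2 * A (over_arc D P) - A (under_arc_right D P Q)] (mod m)"
    by (rule shadow_modD(2)[OF assms(1) PQ])
  also have "[2 * A (over_arc D P) - A (under_arc_right D P Q) =
      2 * A' (over_arc D P) - A' (under_arc_right D P Q)] (mod m)"
    by (intro cong_diff cong_scalar_left cong_sym[OF A[OF over_arc_Arc[OF PQ]]]
        cong_sym[OF A[OF under_arc_right_eq(1)[OF PQ]]])
  finally show "[A' (under_arc_left D P Q) = 2 * A' (over_arc D P) - A' (under_arc_right D P Q)] (mod m)" .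
qed

lemma affine_SCol_at:
  assumes p: "0 < p" and c: "c \<in> SCol p D" and a: "a \<in> R p"
  shows "affine_recolor p a k b c \<in> SCol_at p D a"
proof -
  have sh: "shadow_mod (int p) (c \<circ> Inl) (c \<circ> Inr)" by (rule SCol_shadow[OF c])
  have "shadow_mod (int p) (affine_recolor p a k b c \<circ> Inl) (affine_recolor p a k b c \<circ> Inr)"
    by (rule shadow_mod_cong[OF shadow_mod_affine[OF sh, of k b
        "(a - (k * c (Inr (r_infinity D)) + b)) * checker (r_infinity D)"]])
      (simp_all add: affine_Inr cong_iff_mod)
  moreover have "affine_recolor p a k b c \<in> (Arc D <+> Region D) \<rightarrow>\<^sub>E R p"
    using p by (auto simp: affine_recolor_def R_def)
  ultimately have "affine_recolor p a k b c \<in> SCol p D" by (simp add: SCol_iff)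
  moreover have "affine_recolor p a k b c (Inr (r_infinity D)) = a"
  proof -
    have "k * c (Inr (r_infinity D)) + b +
        (a - (k * c (Inr (r_infinity D)) + b)) * checker (r_infinity D) * checker (r_infinity D) = a"
      by (simp add: mult.assoc checker_abs)
    then show ?thesis using a by (simp add: affine_Inr[OF r_infinity_Region] R_def)
  qed
  ultimately show ?thesis by (simp add: SCol_at_def)
qed

lemma affine_eqI:
  assumes "0 < p" "c \<in> SCol p D" "a \<in> R p" "d \<in> SCol_at p D a"
    and "\<And>\<alpha>. \<alpha> \<in> Arc D \<Longrightarrow> d (Inl \<alpha>) = (k * c (Inl \<alpha>) + b) mod int p"
  shows "affine_recolor p a k b c = d"
  by (rule SCol_at_eqI[OF affine_SCol_at[OF assms(1-3)] assms(4)]) (simp add: assms(5))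

text \<open>The correction by the checkerboard sign, the translation and the dilation are undone one after
  the other.\<close>

lemma shadow_weight_affine:
  assumes p: "prime p" and c: "c \<in> SCol p D"
  shows "shadow_weight p D (affine_recolor p a k b c) = (k\<^sup>2 * shadow_weight p D c) mod int p"
proof -
  let ?A = "c \<circ> Inl" and ?B = "c \<circ> Inr"
  define t where "t = (a - (k * c (Inr (r_infinity D)) + b)) * checker (r_infinity D)"
  have sh: "shadow_mod (int p) ?A ?B" by (rule SCol_shadow[OF c])
  have sh1: "shadow_mod (int p) (\<lambda>\<alpha>. k * ?A \<alpha>) (\<lambda>r. k * ?B r)"
    using shadow_mod_affine[OF sh, of k 0 0] by simp
  have sh2: "shadow_mod (int p) (\<lambda>\<alpha>. k * ?A \<alpha> + b) (\<lambda>r. k * ?B r + b)"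
    using shadow_mod_affine[OF sh, of k b 0] by simp
  have "[shadow_weight p D (affine_recolor p a k b c) =
      total_weight p (affine_recolor p a k b c \<circ> Inl) (affine_recolor p a k b c \<circ> Inr)] (mod int p)"
    by (rule shadow_weight_total)
  also have "[total_weight p (affine_recolor p a k b c \<circ> Inl) (affine_recolor p a k b c \<circ> Inr) =
      total_weight p (\<lambda>\<alpha>. k * ?A \<alpha> + b) (\<lambda>r. k * ?B r + b + t * checker r)] (mod int p)"
    by (rule total_weight_cong[OF p]) (simp_all add: affine_Inr cong_iff_mod t_def)
  also have "[total_weight p (\<lambda>\<alpha>. k * ?A \<alpha> + b) (\<lambda>r. k * ?B r + b + t * checker r) =
      total_weight p (\<lambda>\<alpha>. k * ?A \<alpha> + b) (\<lambda>r. k * ?B r + b)] (mod int p)"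
    by (rule total_weight_shift[OF p shadow_modD(2)[OF sh2]])
  also have "[total_weight p (\<lambda>\<alpha>. k * ?A \<alpha> + b) (\<lambda>r. k * ?B r + b) =
      total_weight p (\<lambda>\<alpha>. k * ?A \<alpha>) (\<lambda>r. k * ?B r)] (mod int p)"
    by (rule total_weight_translate[OF p sh1])
  also have "[total_weight p (\<lambda>\<alpha>. k * ?A \<alpha>) (\<lambda>r. k * ?B r) = k\<^sup>2 * total_weight p ?A ?B] (mod int p)"
    by (rule total_weight_scale[OF p])
  also have "[k\<^sup>2 * total_weight p ?A ?B = k\<^sup>2 * shadow_weight p D c] (mod int p)"
    by (intro cong_scalar_left cong_sym[OF shadow_weight_total])
  finally have "shadow_weight p D (affine_recolor p a k b c) mod int p = (k\<^sup>2 * shadow_weight p D c) mod int p"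
    by (simp add: cong_iff_mod)
  then show ?thesis by (simp add: shadow_weight_def)
qed

lemma zero_SCol:
  assumes "0 < p"
  shows "restrict (\<lambda>_. 0) (Arc D <+> Region D) \<in> SCol p D"
proof -
  have "shadow_mod (int p) (\<lambda>_. 0) (\<lambda>_. 0)" by (simp add: shadow_mod_def)
  then have "shadow_mod (int p) (restrict (\<lambda>_. 0) (Arc D <+> Region D) \<circ> Inl) (restrict (\<lambda>_. 0) (Arc D <+> Region D) \<circ> Inr)"
    by (rule shadow_mod_cong) (simp_all add: InlI InrI)
  then show ?thesis using assms by (simp add: SCol_iff R_def)
qed

definition constant_coloring :: "nat \<Rightarrow> int \<Rightarrow> int \<Rightarrow> shadow" where
  "constant_coloring p a b = affine_recolor p a 0 b (restrict (\<lambda>_. 0) (Arc D <+> Region D))"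

lemma constant_coloring_SCol_at:
  "0 < p \<Longrightarrow> a \<in> R p \<Longrightarrow> constant_coloring p a b \<in> SCol_at p D a"
  unfolding constant_coloring_def by (intro affine_SCol_at zero_SCol)

lemma constant_coloring_Inl [simp]:
  "\<alpha> \<in> Arc D \<Longrightarrow> constant_coloring p a b (Inl \<alpha>) = b mod int p"
  by (simp add: constant_coloring_def)

lemma shadow_weight_constant:
  "prime p \<Longrightarrow> shadow_weight p D (constant_coloring p a b) = 0"
  unfolding constant_coloring_def by (simp add: shadow_weight_affine zero_SCol p_pos)

lemma affine_0: "0 < p \<Longrightarrow> c \<in> SCol p D \<Longrightarrow> a \<in> R p \<Longrightarrow> affine_recolor p a 0 b c = constant_coloring p a b"
  by (rule affine_eqI) (simp_all add: constant_coloring_SCol_at)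

lemma affine_constant:
  assumes "0 < p" "a \<in> R p"
  shows "affine_recolor p a k b (constant_coloring p a c) = constant_coloring p a (k * c + b)"
  by (rule affine_eqI)
    (use assms in \<open>simp_all add: constant_coloring_SCol_at SCol_at_SCol[OF constant_coloring_SCol_at] affine_mod_right\<close>)

lemma constant_coloring_mod:
  assumes "0 < p" "a \<in> R p"
  shows "constant_coloring p a (b mod int p) = constant_coloring p a b"
  by (rule SCol_at_eqI) (use assms in \<open>auto intro: constant_coloring_SCol_at\<close>)

lemma affine_mod:
  assumes "0 < p" "c \<in> SCol p D" "a \<in> R p"
  shows "affine_recolor p a (k mod int p) (b mod int p) c = affine_recolor p a k b c"
  by (rule affine_eqI) (use assms in \<open>simp_all add: affine_SCol_at affine_mod_left\<close>)

lemma affine_affine: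
  assumes "0 < p" "c \<in> SCol p D" "a \<in> R p"
  shows "affine_recolor p a k b (affine_recolor p a k' b' c) = affine_recolor p a (k * k' mod int p) ((k * b' + b) mod int p) c"
  unfolding affine_mod[OF assms]
  by (rule affine_eqI)
    (use assms in \<open>simp_all add: affine_SCol_at SCol_at_SCol[OF affine_SCol_at] affine_mod_right\<close>, simp add: algebra_simps)

definition nonconstant :: "nat \<Rightarrow> int \<Rightarrow> shadow set" where
  "nonconstant p a = SCol_at p D a - constant_coloring p a ` R p"

lemma nonconstant_iff:
  assumes "0 < p" "a \<in> R p" "c \<in> SCol_at p D a"
  shows "c \<in> nonconstant p a \<longleftrightarrow> (\<exists>\<alpha>\<in>Arc D. \<exists>\<beta>\<in>Arc D. c (Inl \<alpha>) \<noteq> c (Inl \<beta>))"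
proof -
  have "c \<in> constant_coloring p a ` R p"
    if "\<forall>\<alpha>\<in>Arc D. \<forall>\<beta>\<in>Arc D. c (Inl \<alpha>) = c (Inl \<beta>)"
  proof -
    obtain \<alpha> where \<alpha>: "\<alpha> \<in> Arc D" using Arc_nonempty by blast
    have R: "c (Inl \<alpha>) \<in> R p" using SCol_values(1)[OF SCol_at_SCol[OF assms(3)] \<alpha>] .
    have "c = constant_coloring p a (c (Inl \<alpha>))"
    proof (rule SCol_at_eqI[OF assms(3) constant_coloring_SCol_at[OF assms(1,2)]])
      fix \<beta> assume "\<beta> \<in> Arc D"
      moreover from this have "c (Inl \<beta>) = c (Inl \<alpha>)" using that \<alpha> by blast
      ultimately show "c (Inl \<beta>) = constant_coloring p a (c (Inl \<alpha>)) (Inl \<beta>)"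
        using R by (simp add: R_def)
    qed
    then show ?thesis using R by blast
  qed
  moreover have "c \<notin> constant_coloring p a ` R p"
    if "\<alpha> \<in> Arc D" "\<beta> \<in> Arc D" "c (Inl \<alpha>) \<noteq> c (Inl \<beta>)" for \<alpha> \<beta>
    using that by (intro notI) (elim imageE, simp)
  ultimately show ?thesis using assms(3) unfolding nonconstant_def by blast
qed

end

text \<open>The pair \<open>(k, b)\<close> stands for the affine map \<open>x \<mapsto> k * x + b\<close>.\<close>

definition affine_group :: "nat \<Rightarrow> (int \<times> int) set" where
  "affine_group p = {1..<int p} \<times> {0..<int p}"

definition affine_mul :: "nat \<Rightarrow> int \<times> int \<Rightarrow> int \<times> int \<Rightarrow> int \<times> int" where
  "affine_mul p g h = ((fst g * fst h) mod int p, (fst g * snd h + snd g) mod int p)"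

lemma coprime_unit:
  assumes "prime p" "k \<in> {1..<int p}"
  shows "coprime k (int p)"
proof -
  have "\<not> int p dvd k" using assms(2) by (simp add: zdvd_not_zless)
  moreover have "prime (int p)" using assms(1) by simp
  ultimately show ?thesis by (metis prime_imp_coprime coprime_commute)
qed

lemma unit_mod_range:
  assumes "prime p" "coprime k (int p)"
  shows "k mod int p \<in> {1..<int p}"
proof -
  have p: "1 < p" using assms(1) by (rule prime_gt_1_nat)
  have "k mod int p \<noteq> 0"
  proof
    assume "k mod int p = 0"
    then have "int p dvd k" by (simp only: dvd_eq_mod_eq_0)
    then have "is_unit (int p)" using coprime_common_divisor[OF assms(2) _ dvd_refl] by blast
    then show False using p by simp
  qed
  moreover have "0 \<le> k mod int p" "k mod int p < int p" using p by simp_all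
  ultimately show ?thesis by simp
qed

lemma affine_mul_closed:
  assumes p: "prime p" and g: "g \<in> affine_group p" and h: "h \<in> affine_group p"
  shows "affine_mul p g h \<in> affine_group p"
proof -
  have "coprime (fst g) (int p)" "coprime (fst h) (int p)"
    using g h by (auto simp: affine_group_def intro!: coprime_unit[OF p])
  then have "coprime (fst g * fst h) (int p)" by (simp only: coprime_mult_left_iff simp_thms)
  from unit_mod_range[OF p this] show ?thesis
    using prime_gt_0_nat[OF p] by (simp add: affine_group_def affine_mul_def)
qed

lemma affine_mul_inverse:
  assumes p: "prime p" and g: "g \<in> affine_group p"
  shows "\<exists>h\<in>affine_group p. affine_mul p h g = (1, 0)"
proof -
  have k: "fst g \<in> {1..<int p}" using g by (auto simp: affine_group_def)
  obtain l where l: "[fst g * l = 1] (mod int p)"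
    using cong_solve_coprime_int[OF coprime_unit[OF p k]] by blast
  then have "[l * fst g = 1] (mod int p)" by (simp only: mult.commute)
  then have lc: "coprime l (int p)" unfolding coprime_iff_invertible_int by blast
  define h where "h = (l mod int p, (- (l mod int p * snd g)) mod int p)"
  have "h \<in> affine_group p"
    using unit_mod_range[OF p lc] prime_gt_0_nat[OF p] by (simp add: h_def affine_group_def)
  moreover have "(l mod int p) * fst g mod int p = 1"
    using l prime_gt_1_nat[OF p] unfolding cong_iff_mod mod_mult_left_eq
    by (simp add: mult.commute)
  then have "affine_mul p h g = (1, 0)"
    by (simp add: affine_mul_def h_def mod_add_right_eq)
  ultimately show ?thesis by blast
qed

context link
begin

text \<open>Two distinct arc colors determine the affine map, so the affine group acts freely here.\<close>

lemma free_action_nonconstant: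
  assumes p: "prime p" and a: "a \<in> R p"
  shows "free_action (affine_group p) (affine_mul p) (1, 0)
    (\<lambda>g. affine_recolor p a (fst g) (snd g)) (nonconstant p a)"
proof -
  have pp: "0 < p" "1 < p" using p prime_gt_0_nat prime_gt_1_nat by auto
  have at: "v \<in> SCol_at p D a" "v \<in> SCol p D" if "v \<in> nonconstant p a" for v
    using that by (simp_all add: nonconstant_def SCol_at_def)
  have two: "\<exists>\<alpha>\<in>Arc D. \<exists>\<beta>\<in>Arc D. v (Inl \<alpha>) \<noteq> v (Inl \<beta>)" if "v \<in> nonconstant p a" for v
    using that nonconstant_iff[OF pp(1) a at(1)[OF that]] by simp
  show ?thesis
  proof
    fix g v assume g: "g \<in> affine_group p" and v: "v \<in> nonconstant p a"
    have k: "fst g \<in> {1..<int p}" using g by (auto simp: affine_group_def)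
    have w: "affine_recolor p a (fst g) (snd g) v \<in> SCol_at p D a" using affine_SCol_at[OF pp(1) at(2)[OF v] a] .
    obtain \<alpha> \<beta> where ab: "\<alpha> \<in> Arc D" "\<beta> \<in> Arc D" "v (Inl \<alpha>) \<noteq> v (Inl \<beta>)"
      using two[OF v] by blast
    have "affine_recolor p a (fst g) (snd g) v (Inl \<alpha>) \<noteq> affine_recolor p a (fst g) (snd g) v (Inl \<beta>)"
    proof
      assume "affine_recolor p a (fst g) (snd g) v (Inl \<alpha>) = affine_recolor p a (fst g) (snd g) v (Inl \<beta>)"
      then have "[fst g * v (Inl \<alpha>) + snd g = fst g * v (Inl \<beta>) + snd g] (mod int p)"
        using ab by (simp add: cong_iff_mod)
      then have "[v (Inl \<alpha>) = v (Inl \<beta>)] (mod int p)"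
        unfolding cong_add_rcancel cong_mult_lcancel[OF coprime_unit[OF p k]] .
      then show False
        using R_cong_eq SCol_values(1)[OF at(2)[OF v]] ab by blast
    qed
    then show "affine_recolor p a (fst g) (snd g) v \<in> nonconstant p a"
      unfolding nonconstant_iff[OF pp(1) a w] using ab by blast
  next
    fix g h assume "g \<in> affine_group p" "h \<in> affine_group p"
    then show "affine_mul p g h \<in> affine_group p" by (rule affine_mul_closed[OF p])
  next
    fix g h v assume v: "v \<in> nonconstant p a"
    show "affine_recolor p a (fst g) (snd g) (affine_recolor p a (fst h) (snd h) v) =
        affine_recolor p a (fst (affine_mul p g h)) (snd (affine_mul p g h)) v"
      unfolding affine_mul_def fst_conv snd_conv by (rule affine_affine[OF pp(1) at(2)[OF v] a])
  next
    show "(1, 0) \<in> affine_group p" using pp by (simp add: affine_group_def)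
  next
    fix v assume v: "v \<in> nonconstant p a"
    have "v (Inl \<alpha>) = (1 * v (Inl \<alpha>) + 0) mod int p" if "\<alpha> \<in> Arc D" for \<alpha>
      using SCol_values(1)[OF at(2)[OF v] that] by (simp add: R_def)
    from affine_eqI[OF pp(1) at(2)[OF v] a at(1)[OF v] this]
    show "affine_recolor p a (fst (1, 0)) (snd (1, 0)) v = v" by simp
  next
    fix g assume "g \<in> affine_group p"
    then show "\<exists>h\<in>affine_group p. affine_mul p h g = (1, 0)" by (rule affine_mul_inverse[OF p])
  next
    fix v assume v: "v \<in> nonconstant p a"
    obtain \<alpha> \<beta> where ab: "\<alpha> \<in> Arc D" "\<beta> \<in> Arc D" "v (Inl \<alpha>) \<noteq> v (Inl \<beta>)"
      using two[OF v] by blast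
    define x y where "x = v (Inl \<alpha>)" and "y = v (Inl \<beta>)"
    have "\<not> [x = y] (mod int p)"
      using ab SCol_values(1)[OF at(2)[OF v]] R_cong_eq unfolding x_def y_def by blast
    then have "\<not> int p dvd x - y" by (simp only: cong_iff_dvd_diff not_False_eq_True)
    moreover have "prime (int p)" using p by simp
    ultimately have xyc: "coprime (x - y) (int p)" by (metis prime_imp_coprime coprime_commute)
    show "inj_on (\<lambda>g. affine_recolor p a (fst g) (snd g) v) (affine_group p)"
    proof (rule inj_onI)
      fix g h assume g: "g \<in> affine_group p" and h: "h \<in> affine_group p"
        and eq: "affine_recolor p a (fst g) (snd g) v = affine_recolor p a (fst h) (snd h) v"
      have R: "fst g \<in> R p" "snd g \<in> R p" "fst h \<in> R p" "snd h \<in> R p"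
        using g h by (auto simp: affine_group_def R_def)
      have 1: "[fst g * x + snd g = fst h * x + snd h] (mod int p)"
        using fun_cong[OF eq, of "Inl \<alpha>"] ab by (simp add: cong_iff_mod x_def)
      have 2: "[fst g * y + snd g = fst h * y + snd h] (mod int p)"
        using fun_cong[OF eq, of "Inl \<beta>"] ab by (simp add: cong_iff_mod y_def)
      have "[fst g * (x - y) = fst h * (x - y)] (mod int p)"
        using cong_diff[OF 1 2] by (simp add: right_diff_distrib)
      then have "[fst g = fst h] (mod int p)" using cong_mult_rcancel[OF xyc] by blast
      then have k: "fst g = fst h" using R_cong_eq R by blast
      have "[snd g = snd h] (mod int p)" using 1 unfolding k cong_add_lcancel .
      then have "snd g = snd h" using R_cong_eq R by blast
      with k show "g = h" by (rule prod_eqI)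
    qed
  qed
qed

end


section \<open>The invariant as a multiset on one base color\<close>

lemma count_image_mset_set:
  assumes "finite S"
  shows "count (image_mset f (mset_set S)) t = card {x \<in> S. f x = t}"
proof -
  have "count (image_mset f (mset_set S)) t = (\<Sum>y\<in>f -` {t} \<inter> S. count (mset_set S) y)"
    using assms by (simp add: count_image_mset)
  also have "\<dots> = (\<Sum>y\<in>f -` {t} \<inter> S. 1)"
    using assms by (intro sum.cong) simp_all
  also have "\<dots> = card (f -` {t} \<inter> S)" by simp
  also have "f -` {t} \<inter> S = {x \<in> S. f x = t}" by auto
  finally show ?thesis .
qed

context link
begin

text \<open>Recoloring by the identity map with a new color at infinity is injective and keeps the weight.\<close>

lemma card_SCol_at_le:
  assumes p: "prime p" and a: "a \<in> R p" "a' \<in> R p"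
  shows "card {c \<in> SCol_at p D a. shadow_weight p D c = t} \<le> card {c \<in> SCol_at p D a'. shadow_weight p D c = t}"
proof (rule card_inj_on_le)
  have pp: "0 < p" using p by (rule p_pos)
  show "inj_on (affine_recolor p a' 1 0) {c \<in> SCol_at p D a. shadow_weight p D c = t}"
  proof (rule inj_onI)
    fix c d assume "c \<in> {c \<in> SCol_at p D a. shadow_weight p D c = t}" "d \<in> {c \<in> SCol_at p D a. shadow_weight p D c = t}"
      and eq: "affine_recolor p a' 1 0 c = affine_recolor p a' 1 0 d"
    then have cd: "c \<in> SCol_at p D a" "d \<in> SCol_at p D a" by auto
    show "c = d"
    proof (rule SCol_at_eqI[OF cd])
      fix \<alpha> assume \<alpha>: "\<alpha> \<in> Arc D"
      have "[c (Inl \<alpha>) = d (Inl \<alpha>)] (mod int p)"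
        using fun_cong[OF eq, of "Inl \<alpha>"] \<alpha> by (simp add: cong_iff_mod)
      then show "c (Inl \<alpha>) = d (Inl \<alpha>)"
        using R_cong_eq SCol_values(1)[OF SCol_at_SCol \<alpha>] cd by blast
    qed
  qed
  show "affine_recolor p a' 1 0 ` {c \<in> SCol_at p D a. shadow_weight p D c = t} \<subseteq> {c \<in> SCol_at p D a'. shadow_weight p D c = t}"
  proof clarify
    fix c assume c: "c \<in> SCol_at p D a"
    have "shadow_weight p D (affine_recolor p a' 1 0 c) = shadow_weight p D c mod int p"
      by (simp add: shadow_weight_affine[OF p SCol_at_SCol[OF c]])
    then have "shadow_weight p D (affine_recolor p a' 1 0 c) = shadow_weight p D c"
      by (simp add: shadow_weight_def)
    then show "affine_recolor p a' 1 0 c \<in> SCol_at p D a' \<and>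
        shadow_weight p D (affine_recolor p a' 1 0 c) = shadow_weight p D c"
      using affine_SCol_at[OF pp SCol_at_SCol[OF c] a(2)] by simp
  qed
qed (use finite_SCol_at in simp)

lemma count_invariant:
  assumes p: "prime p" and a: "a \<in> R p"
  shows "count (shadow_cocycle_invariant p D) t = p * card {c \<in> SCol_at p D a. shadow_weight p D c = t}"
proof -
  have UN: "SCol p D = (\<Union>a\<in>R p. SCol_at p D a)"
    using SCol_values(2)[OF _ r_infinity_Region] by (auto simp: SCol_at_def)
  have fin: "finite (SCol p D)" unfolding UN by (simp add: finite_SCol_at R_def)
  have "count (shadow_cocycle_invariant p D) t = card {c \<in> SCol p D. shadow_weight p D c = t}"
    unfolding shadow_cocycle_invariant_def by (rule count_image_mset_set[OF fin])
  also have "{c \<in> SCol p D. shadow_weight p D c = t} =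
      (\<Union>b\<in>R p. {c \<in> SCol_at p D b. shadow_weight p D c = t})"
    unfolding UN by blast
  also have "card \<dots> = (\<Sum>b\<in>R p. card {c \<in> SCol_at p D b. shadow_weight p D c = t})"
  proof (rule card_UN_disjoint)
    show "finite (R p)" by (simp add: R_def)
    show "\<forall>b\<in>R p. finite {c \<in> SCol_at p D b. shadow_weight p D c = t}"
      by (simp add: finite_SCol_at)
    show "\<forall>b\<in>R p. \<forall>b'\<in>R p. b \<noteq> b' \<longrightarrow> {c \<in> SCol_at p D b. shadow_weight p D c = t} \<inter>
        {c \<in> SCol_at p D b'. shadow_weight p D c = t} = {}"
      by (auto simp: SCol_at_def)
  qed
  also have "\<dots> = (\<Sum>b\<in>R p. card {c \<in> SCol_at p D a. shadow_weight p D c = t})"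
    by (intro sum.cong refl antisym card_SCol_at_le p a)
  also have "\<dots> = p * card {c \<in> SCol_at p D a. shadow_weight p D c = t}"
    by (simp add: R_def)
  finally show ?thesis .
qed

text \<open>The constant colorings are images of a coloring under the constant maps, the case \<open>k = 0\<close> of the
  action, and so have weight 0.\<close>

lemma weights_split:
  assumes p: "prime p" and a: "a \<in> R p"
  shows "image_mset (shadow_weight p D) (mset_set (SCol_at p D a)) =
    replicate_mset p 0 + image_mset (shadow_weight p D) (mset_set (nonconstant p a))"
proof -
  have pp: "0 < p" using p by (rule p_pos)
  define C where "C = constant_coloring p a ` R p"
  have CS: "C \<subseteq> SCol_at p D a" using constant_coloring_SCol_at[OF pp a] by (auto simp: C_def)
  have fC: "finite C" by (simp add: C_def R_def)
  have "inj_on (constant_coloring p a) (R p)"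
  proof (rule inj_onI)
    fix b b' assume b: "b \<in> R p" "b' \<in> R p" and eq: "constant_coloring p a b = constant_coloring p a b'"
    obtain \<alpha> where "\<alpha> \<in> Arc D" using Arc_nonempty by blast
    then have "b mod int p = b' mod int p" using fun_cong[OF eq, of "Inl \<alpha>"] by simp
    then show "b = b'" using b by (simp add: R_def)
  qed
  then have cC: "card C = p" unfolding C_def by (simp add: card_image R_def)
  have "mset_set (SCol_at p D a) = mset_set C + mset_set (nonconstant p a)"
    using CS finite_SCol_at[of p a] fC unfolding nonconstant_def C_def[symmetric]
    by (simp add: mset_set_Diff subset_imp_msubset_mset_set)
  moreover have "image_mset (shadow_weight p D) (mset_set C) = image_mset (\<lambda>_. 0) (mset_set C)"
    using fC by (intro image_mset_cong) (auto simp: C_def shadow_weight_constant[OF p])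
  ultimately show ?thesis by (simp add: image_mset_const_eq cC)
qed

lemma edge_iff:
  assumes p: "prime p" and a: "a \<in> R p" and S: "S \<subseteq> End_R p"
    and v: "v \<in> SCol_at p D a" and w: "w \<in> SCol_at p D a"
  shows "(v, w) \<in> edges (coloring_quiver p S D a) \<longleftrightarrow> (\<exists>f\<in>S. w = affine_recolor p a (f 1 - f 0) (f 0) v)"
proof -
  have "(v, w) \<in> edges (coloring_quiver p S D a) \<longleftrightarrow> (\<exists>f\<in>S. \<forall>\<alpha>\<in>Arc D. w (Inl \<alpha>) = f (v (Inl \<alpha>)))"
    using v w by (simp add: coloring_quiver_def)
  also have "\<dots> \<longleftrightarrow> (\<exists>f\<in>S. w = affine_recolor p a (f 1 - f 0) (f 0) v)"
  proof (rule bex_cong[OF refl])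
    fix f assume "f \<in> S"
    then have f: "f x = ((f 1 - f 0) * x + f 0) mod int p" if "x \<in> R p" for x
      using End_R_affine[OF p _ prime_ge_2_nat[OF p] that] S by blast
    have vR: "v (Inl \<alpha>) \<in> R p" if "\<alpha> \<in> Arc D" for \<alpha> using SCol_values(1)[OF SCol_at_SCol[OF v] that] .
    show "(\<forall>\<alpha>\<in>Arc D. w (Inl \<alpha>) = f (v (Inl \<alpha>))) \<longleftrightarrow> w = affine_recolor p a (f 1 - f 0) (f 0) v"
    proof
      assume "\<forall>\<alpha>\<in>Arc D. w (Inl \<alpha>) = f (v (Inl \<alpha>))"
      then have "w (Inl \<alpha>) = ((f 1 - f 0) * v (Inl \<alpha>) + f 0) mod int p" if "\<alpha> \<in> Arc D" for \<alpha>
        using f[OF vR[OF that]] that by simp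
      then show "w = affine_recolor p a (f 1 - f 0) (f 0) v"
        using affine_eqI[OF p_pos[OF p] SCol_at_SCol[OF v] a w] by metis
    next
      assume "w = affine_recolor p a (f 1 - f 0) (f 0) v"
      then show "\<forall>\<alpha>\<in>Arc D. w (Inl \<alpha>) = f (v (Inl \<alpha>))" using f[OF vR] by simp
    qed
  qed
  finally show ?thesis .
qed

end


section \<open>Quivers and invariants\<close>

text \<open>On the nonconstant colorings this is the bijection between free actions; constants are sent to
  constants. The noninvertible maps \<open>k = 0\<close> are respected because they send every coloring to a
  constant.\<close>

lemma equivariant_shadow_bijection:
  assumes "link D" and "link D'" and p: "prime p" and a: "a \<in> R p"
    and weights: "image_mset (shadow_weight p D) (mset_set (SCol_at p D a)) =
      image_mset (shadow_weight p D') (mset_set (SCol_at p D' a))"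
  obtains \<phi> where "bij_betw \<phi> (SCol_at p D a) (SCol_at p D' a)"
    "\<And>v. v \<in> SCol_at p D a \<Longrightarrow> shadow_weight p D' (\<phi> v) = shadow_weight p D v"
    "\<And>k b v. v \<in> SCol_at p D a \<Longrightarrow> \<phi> (link.affine_recolor D p a k b v) = link.affine_recolor D' p a k b (\<phi> v)"
proof -
  interpret X: link D by fact
  interpret Y: link D' by fact
  have pp: "0 < p" using p by (rule p_pos)
  let ?G = "affine_group p"
  let ?N = "X.nonconstant p a" and ?M = "Y.nonconstant p a"
  have NS: "?N \<subseteq> SCol_at p D a" "?M \<subseteq> SCol_at p D' a"
    by (auto simp: X.nonconstant_def Y.nonconstant_def)
  have "\<exists>\<phi>. bij_betw \<phi> ?N ?M \<and> (\<forall>v\<in>?N. shadow_weight p D' (\<phi> v) = shadow_weight p D v) \<and>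
      (\<forall>g\<in>?G. \<forall>v\<in>?N. \<phi> (X.affine_recolor p a (fst g) (snd g) v) = Y.affine_recolor p a (fst g) (snd g) (\<phi> v))"
  proof (rule equivariant_bijection[OF X.free_action_nonconstant[OF p a] Y.free_action_nonconstant[OF p a],
        where \<tau> = "\<lambda>g t. ((fst g)\<^sup>2 * t) mod int p"])
    show "finite ?N" "finite ?M"
      using X.finite_SCol_at Y.finite_SCol_at by (simp_all add: X.nonconstant_def Y.nonconstant_def)
    show "image_mset (shadow_weight p D) (mset_set ?N) = image_mset (shadow_weight p D') (mset_set ?M)"
      using weights unfolding X.weights_split[OF p a] Y.weights_split[OF p a] by simp
    show "shadow_weight p D (X.affine_recolor p a (fst g) (snd g) v) = ((fst g)\<^sup>2 * shadow_weight p D v) mod int p"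
      if "v \<in> ?N" for g v
      using that NS(1) by (intro X.shadow_weight_affine[OF p X.SCol_at_SCol]) blast
    show "shadow_weight p D' (Y.affine_recolor p a (fst g) (snd g) v) = ((fst g)\<^sup>2 * shadow_weight p D' v) mod int p"
      if "v \<in> ?M" for g v
      using that NS(2) by (intro Y.shadow_weight_affine[OF p Y.SCol_at_SCol]) blast
  qed
  then obtain \<phi>0 where \<phi>0': "bij_betw \<phi>0 ?N ?M" "\<And>v. v \<in> ?N \<Longrightarrow> shadow_weight p D' (\<phi>0 v) = shadow_weight p D v"
    "\<And>g v. g \<in> ?G \<Longrightarrow> v \<in> ?N \<Longrightarrow> \<phi>0 (X.affine_recolor p a (fst g) (snd g) v) = Y.affine_recolor p a (fst g) (snd g) (\<phi>0 v)"
    by blast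
  note \<phi>0 = \<phi>0'(1,2) \<phi>0'(3)[of "(k, b)" for k b, simplified fst_conv snd_conv]
  obtain \<alpha> where \<alpha>: "\<alpha> \<in> Arc D" using X.Arc_nonempty by blast
  obtain \<beta> where \<beta>: "\<beta> \<in> Arc D'" using Y.Arc_nonempty by blast
  define \<phi> where "\<phi> v = (if v \<in> ?N then \<phi>0 v else Y.constant_coloring p a (v (Inl \<alpha>)))" for v
  have \<phi>_const: "\<phi> (X.constant_coloring p a b) = Y.constant_coloring p a b" for b
  proof -
    have "X.constant_coloring p a b \<notin> ?N"
      using X.constant_coloring_mod[OF pp a, of b, symmetric] mod_in_R[OF pp, of b]
      by (auto simp: X.nonconstant_def)
    then show ?thesis using Y.constant_coloring_mod[OF pp a] \<alpha> by (simp add: \<phi>_def)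
  qed
  have split: "SCol_at p D a = ?N \<union> X.constant_coloring p a ` R p"
    "SCol_at p D' a = ?M \<union> Y.constant_coloring p a ` R p"
    using X.constant_coloring_SCol_at[OF pp a] Y.constant_coloring_SCol_at[OF pp a]
    by (auto simp: X.nonconstant_def Y.nonconstant_def)
  have "bij_betw \<phi> (?N \<union> X.constant_coloring p a ` R p) (?M \<union> Y.constant_coloring p a ` R p)"
  proof (rule bij_betw_combine)
    show "bij_betw \<phi> ?N ?M"
      using \<phi>0(1) by (rule bij_betw_cong[THEN iffD1, rotated]) (simp add: \<phi>_def)
    show "bij_betw \<phi> (X.constant_coloring p a ` R p) (Y.constant_coloring p a ` R p)"
    proof (rule bij_betw_imageI)
      show "inj_on \<phi> (X.constant_coloring p a ` R p)"
      proof (rule inj_onI, clarify)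
        fix b b' assume b: "b \<in> R p" "b' \<in> R p"
          and eq: "\<phi> (X.constant_coloring p a b) = \<phi> (X.constant_coloring p a b')"
        have "b mod int p = b' mod int p"
          using fun_cong[OF eq[unfolded \<phi>_const], of "Inl \<beta>"] \<beta> by simp
        then show "X.constant_coloring p a b = X.constant_coloring p a b'" using b by (simp add: R_def)
      qed
      show "\<phi> ` X.constant_coloring p a ` R p = Y.constant_coloring p a ` R p"
        by (simp add: image_image \<phi>_const)
    qed
    show "?M \<inter> Y.constant_coloring p a ` R p = {}" by (auto simp: Y.nonconstant_def)
  qed
  then have bij: "bij_betw \<phi> (SCol_at p D a) (SCol_at p D' a)" by (simp add: split)
  have weight: "shadow_weight p D' (\<phi> v) = shadow_weight p D v" if v: "v \<in> SCol_at p D a" for v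
  proof (cases "v \<in> ?N")
    case True
    then show ?thesis using \<phi>0(2) by (simp add: \<phi>_def)
  next
    case False
    then obtain b where "v = X.constant_coloring p a b" using v unfolding split(1) by blast
    then show ?thesis
      by (simp add: \<phi>_const X.shadow_weight_constant[OF p] Y.shadow_weight_constant[OF p])
  qed
  have equiv: "\<phi> (X.affine_recolor p a k b v) = Y.affine_recolor p a k b (\<phi> v)" if v: "v \<in> SCol_at p D a" for k b v
  proof (cases "v \<in> ?N")
    case True
    have vS: "v \<in> SCol p D" using v by (rule X.SCol_at_SCol)
    have "\<phi> v \<in> SCol_at p D' a" using bij v by (rule bij_betwE[THEN bspec])
    then have wS: "\<phi> v \<in> SCol p D'" by (rule Y.SCol_at_SCol)
    define k' b' where "k' = k mod int p" and "b' = b mod int p"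
    have X': "X.affine_recolor p a k b v = X.affine_recolor p a k' b' v"
      unfolding k'_def b'_def by (rule X.affine_mod[OF pp vS a, symmetric])
    have Y': "Y.affine_recolor p a k b (\<phi> v) = Y.affine_recolor p a k' b' (\<phi> v)"
      unfolding k'_def b'_def by (rule Y.affine_mod[OF pp wS a, symmetric])
    show ?thesis
    proof (cases "k' = 0")
      case True
      then show ?thesis
        unfolding X' Y' by (simp add: X.affine_0[OF pp vS a] Y.affine_0[OF pp wS a] \<phi>_const)
    next
      case False
      then have "0 < k'" using pp pos_mod_sign[of "int p" k] unfolding k'_def by linarith
      then have g: "(k', b') \<in> ?G" using pp by (simp add: affine_group_def k'_def b'_def)
      have "X.affine_recolor p a k' b' v \<in> ?N"
        using free_action.act_closed[OF X.free_action_nonconstant[OF p a] g \<open>v \<in> ?N\<close>] by simp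
      then show ?thesis
        unfolding X' Y' using \<phi>0(3)[OF g \<open>v \<in> ?N\<close>] \<open>v \<in> ?N\<close> by (simp add: \<phi>_def)
    qed
  next
    case False
    then obtain c where "v = X.constant_coloring p a c" using v unfolding split(1) by blast
    then show ?thesis
      by (simp add: \<phi>_const X.affine_constant[OF pp a] Y.affine_constant[OF pp a])
  qed
  show thesis using that bij weight equiv by blast
qed

lemma vertices_coloring_quiver: "vertices (coloring_quiver p S D a) = SCol_at p D a"
  by (simp add: coloring_quiver_def)

theorem theorem6p1:
  fixes D D' :: diagram and p :: nat and a :: int and S :: "(int \<Rightarrow> int) set"
  assumes "link_diagram D" and "link_diagram D'"
    and "prime p" and "odd p"
    and "a \<in> R p" and "S \<subseteq> End_R p"
  shows "isomorphic_cocycle_quivers (cocycle_quiver p S D a) (cocycle_quiver p S D' a)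
    \<longleftrightarrow> shadow_cocycle_invariant p D = shadow_cocycle_invariant p D'"
proof -
  have links: "link D" "link D'" using assms(1,2) by (simp_all add: link_def)
  interpret X: link D by (rule links)
  interpret Y: link D' by (rule links)
  note p = assms(3) and a = assms(5) and S = assms(6)
  have pp: "0 < p" using p by (rule p_pos)
  let ?V = "SCol_at p D a" and ?W = "SCol_at p D' a"
  let ?\<rho> = "shadow_weight p D" and ?\<sigma> = "shadow_weight p D'"
  have count: "count (image_mset ?\<rho> (mset_set ?V)) t = count (image_mset ?\<sigma> (mset_set ?W)) t \<longleftrightarrow>
      count (shadow_cocycle_invariant p D) t = count (shadow_cocycle_invariant p D') t" for t
    unfolding X.count_invariant[OF p a] Y.count_invariant[OF p a]
      count_image_mset_set[OF X.finite_SCol_at] count_image_mset_set[OF Y.finite_SCol_at]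
    using pp by simp
  have invariant: "shadow_cocycle_invariant p D = shadow_cocycle_invariant p D' \<longleftrightarrow>
      image_mset ?\<rho> (mset_set ?V) = image_mset ?\<sigma> (mset_set ?W)"
    using count by (simp add: multiset_eq_iff)
  let ?E = "edges (coloring_quiver p S D a)" and ?E' = "edges (coloring_quiver p S D' a)"
  have iso: "isomorphic_cocycle_quivers (cocycle_quiver p S D a) (cocycle_quiver p S D' a) \<longleftrightarrow>
      (\<exists>\<phi>. bij_betw \<phi> ?V ?W \<and> (\<forall>v\<in>?V. \<forall>w\<in>?V. (v, w) \<in> ?E \<longleftrightarrow> (\<phi> v, \<phi> w) \<in> ?E') \<and>
        (\<forall>v\<in>?V. ?\<rho> v = ?\<sigma> (\<phi> v)))"
    by (simp only: isomorphic_cocycle_quivers_def cocycle_quiver_def fst_conv snd_conv vertices_coloring_quiver)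
  show ?thesis unfolding iso invariant
  proof
    assume "\<exists>\<phi>. bij_betw \<phi> ?V ?W \<and> (\<forall>v\<in>?V. \<forall>w\<in>?V. (v, w) \<in> ?E \<longleftrightarrow> (\<phi> v, \<phi> w) \<in> ?E') \<and>
        (\<forall>v\<in>?V. ?\<rho> v = ?\<sigma> (\<phi> v))"
    then obtain \<phi> where \<phi>: "bij_betw \<phi> ?V ?W" "\<forall>v\<in>?V. ?\<rho> v = ?\<sigma> (\<phi> v)" by (elim exE conjE)
    have "mset_set ?W = image_mset \<phi> (mset_set ?V)"
      using \<phi>(1) by (simp add: image_mset_mset_set bij_betw_def)
    then have "image_mset ?\<sigma> (mset_set ?W) = image_mset (?\<sigma> \<circ> \<phi>) (mset_set ?V)"
      by (simp add: multiset.map_comp)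
    also have "\<dots> = image_mset ?\<rho> (mset_set ?V)"
      using \<phi>(2) X.finite_SCol_at by (intro image_mset_cong) simp
    finally show "image_mset ?\<rho> (mset_set ?V) = image_mset ?\<sigma> (mset_set ?W)" by simp
  next
    assume weights: "image_mset ?\<rho> (mset_set ?V) = image_mset ?\<sigma> (mset_set ?W)"
    obtain \<phi> where bij: "bij_betw \<phi> ?V ?W" and weight: "\<And>v. v \<in> ?V \<Longrightarrow> ?\<sigma> (\<phi> v) = ?\<rho> v"
      and equiv: "\<And>k b v. v \<in> ?V \<Longrightarrow> \<phi> (X.affine_recolor p a k b v) = Y.affine_recolor p a k b (\<phi> v)"
      using equivariant_shadow_bijection[OF links p a weights] by blast
    have W: "\<phi> v \<in> ?W" if "v \<in> ?V" for v using bij that by (rule bij_betwE[THEN bspec])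
    have edge: "(v, w) \<in> ?E \<longleftrightarrow> (\<phi> v, \<phi> w) \<in> ?E'" if v: "v \<in> ?V" and w: "w \<in> ?V" for v w
      unfolding X.edge_iff[OF p a S v w] Y.edge_iff[OF p a S W[OF v] W[OF w]]
    proof (rule bex_cong[OF refl])
      fix f
      have "X.affine_recolor p a (f 1 - f 0) (f 0) v \<in> ?V"
        by (rule X.affine_SCol_at[OF pp X.SCol_at_SCol[OF v] a])
      with w have "\<phi> w = \<phi> (X.affine_recolor p a (f 1 - f 0) (f 0) v) \<longleftrightarrow> w = X.affine_recolor p a (f 1 - f 0) (f 0) v"
        by (rule inj_on_eq_iff[OF bij_betw_imp_inj_on[OF bij]])
      then show "w = X.affine_recolor p a (f 1 - f 0) (f 0) v \<longleftrightarrow> \<phi> w = Y.affine_recolor p a (f 1 - f 0) (f 0) (\<phi> v)"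
        unfolding equiv[OF v] by (rule sym)
    qed
    show "\<exists>\<phi>. bij_betw \<phi> ?V ?W \<and> (\<forall>v\<in>?V. \<forall>w\<in>?V. (v, w) \<in> ?E \<longleftrightarrow> (\<phi> v, \<phi> w) \<in> ?E') \<and>
        (\<forall>v\<in>?V. ?\<rho> v = ?\<sigma> (\<phi> v))"
      using bij edge weight by (intro exI[of _ \<phi>] conjI ballI) simp_all
  qed
qed

end
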